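(* Let $H$ and $B$ be conjugate harmonic functions of $(x^1,x^2)$ and let $\mathcal{E}_p$, $H_p=\mathrm{Re}\,\mathcal{E}_p$ and $\mathcal{F}_{2n-1}$ be defined from $\mathcal{E}_1=H+iB$ as in the context. Outside the singularities of these functions the following hold. (i) For every integer $n\ge0$ (level $1+6n$), the metric $$ds^2=\mathcal{F}_{2n-1}\bar{\mathcal{F}}_{2n-1}H_{2n+1}^{1/3}\big[(dx^1)^2+(dx^2)^2\big]+H_{2n+1}^{1/3}\big[(dx^3)^2+\dots+(dx^8)^2\big]+H_{2n+1}^{-2/3}\big[(-1)^{n+1}(dx^9)^2+(-1)^n(dx^{10})^2+(-1)^n(dx^{11})^2\big]$$ with 3-form potential $A_{9\,10\,11}=(-1)^n/H_{2n+1}$ solves the bosonic equations of motion of eleven-dimensional supergravity ($\epsilon=+1$, time in 9) if $n$ is even, and of its exotic counterpart of signature $(2,9,-)$ ($\epsilon=-1$, times in 10 and 11) if $n$ is odd. (ii) For every integer $n>0$ (level $-1+6n$), the metric $$ds^2=\mathcal{F}_{2n-1}\bar{\mathcal{F}}_{2n-1}H_{2n}^{1/3}\big[(dx^1)^2+(dx^2)^2\big]+H_{2n}^{1/3}\big[(dx^3)^2+\dots+(dx^8)^2\big]+H_{2n}^{-2/3}\big[(-1)^{n}(dx^9)^2+(-1)^{n+1}(dx^{10})^2+(-1)^{n+1}(dx^{11})^2\big]$$ with $A_{9\,10\,11}=(-1)^{n+1}/H_{2n}$ solves the bosonic equations of motion of eleven-dimensional supergravity ($\epsilon=+1$, time in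 9) if $n$ is odd, and of its exotic counterpart of signature $(2,9,-)$ ($\epsilon=-1$, times in 10 and 11) if $n$ is even.
   Context: Coordinates are $x^1,\dots,x^{11}$; all fields depend only on $(x^1,x^2)$, and $z=x^1+ix^2$. $H,B$ are real functions with $\partial_1H=\partial_2B$, $\partial_2H=-\partial_1B$, so $\mathcal{E}_1=H+iB$ is analytic in $z$. Define recursively $$\mathcal{E}_{2n}=\frac{1}{\mathcal{E}_{2n-1}},\qquad \mathcal{E}_{2n+1}=2-\mathcal{E}_{2n}\qquad(n>0),$$ $$H_p=\mathrm{Re}\,\mathcal{E}_p,\qquad \mathcal{F}_{-1}=1,\qquad \mathcal{F}_{2n-1}=\mathcal{E}_1\mathcal{E}_3\cdots\mathcal{E}_{2n-1}\quad(n>0).$$ Everything is considered on an open set of the $(x^1,x^2)$-plane on which all functions entering are defined, the $\mathcal{E}_p$ involved are nonzero, and the function $H_p$ entering the metric is positive (so that the metric has the stated signature). The bosonic equations of motion are the Euler–Lagrange equations of $\int d^{11}x\sqrt{|g|}\big(R-\frac{\epsilon}{2\cdot4!}F_{\mu\nu\rho\sigma}F^{\mu\nu\rho\sigma}\big)$ plus a Chern–Simons term proportional to $\int A\wedge F\wedge F$, where $F_{\mu\nu\rho\sigma}=4\,\partial_{[\mu}A_{\nu\rho\sigma]}$. The only nonvanishing components of $A$ are $A_{9\,10\,11}$ and its antisymmetric permutations. The notation $(t,s,\pm)$ denotes a theory with $t$ time and $s$ space directions and kinetic sign $\epsilon=\pm1$; $(1,10,+)$ is ordinary eleven-dimensional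 supergravity and $(2,9,-)$ is an exotic counterpart. *)

theory Defs
  imports "HOL-Analysis.Analysis"
begin

definition pdrv :: "'i::finite \<Rightarrow> (real ^ 'i \<Rightarrow> 'v::real_normed_vector) \<Rightarrow> real ^ 'i \<Rightarrow> 'v" where
  "pdrv \<mu> f x = vector_derivative (\<lambda>t. f (x + t *\<^sub>R axis \<mu> 1)) (at 0)"

text \<open>A Lagrangian density is a function \<open>L q d dd\<close> of the value \<open>q\<close> of a field, of its first
  derivatives \<open>d \<mu>\<close> and of its second derivatives \<open>dd \<mu> \<nu>\<close>. With \<open>w\<close> a direction in field
  space (i.e. a choice of field component), \<open>euler L \<phi> w x\<close> is the component along \<open>w\<close> of
  \<open>\<partial>L/\<partial>\<phi> - \<partial>\<^sub>\<mu>(\<partial>L/\<partial>(\<partial>\<^sub>\<mu>\<phi>)) + \<partial>\<^sub>\<mu>\<partial>\<^sub>\<nu>(\<partial>L/\<partial>(\<partial>\<^sub>\<mu>\<partial>\<^sub>\<nu>\<phi>))\<close> at the point \<open>x\<close>. The last sum runs over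
  all ordered pairs \<open>(\<mu>, \<nu>)\<close>, so the derivative with respect to \<open>\<partial>\<^sub>\<mu>\<partial>\<^sub>\<nu>\<phi> = \<partial>\<^sub>\<nu>\<partial>\<^sub>\<mu>\<phi>\<close> is taken along the
  symmetrised unit direction, with weight one half on each of the two slots.\<close>

type_synonym ('i, 'v) lagrangian = "'v \<Rightarrow> ('i \<Rightarrow> 'v) \<Rightarrow> ('i \<Rightarrow> 'i \<Rightarrow> 'v) \<Rightarrow> real"

definition euler ::
  "('i::finite, 'v::real_normed_vector) lagrangian \<Rightarrow> (real ^ 'i \<Rightarrow> 'v) \<Rightarrow> 'v \<Rightarrow> real ^ 'i \<Rightarrow> real" where
  "euler L \<phi> w x =
     (let d1 = (\<lambda>y \<alpha>. pdrv \<alpha> \<phi> y); d2 = (\<lambda>y \<alpha> \<beta>. pdrv \<alpha> (pdrv \<beta> \<phi>) y) in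
        deriv (\<lambda>s. L (\<phi> x + s *\<^sub>R w) (d1 x) (d2 x)) 0
      - (\<Sum>\<mu>\<in>UNIV. pdrv \<mu> (\<lambda>y. deriv (\<lambda>s.
            L (\<phi> y) (\<lambda>\<alpha>. d1 y \<alpha> + (if \<alpha> = \<mu> then s else 0) *\<^sub>R w) (d2 y)) 0) x)
      + (\<Sum>\<mu>\<in>UNIV. \<Sum>\<nu>\<in>UNIV. pdrv \<mu> (pdrv \<nu> (\<lambda>y. deriv (\<lambda>s.
            L (\<phi> y) (d1 y) (\<lambda>\<alpha> \<beta>. d2 y \<alpha> \<beta>
               + ((if \<alpha> = \<mu> \<and> \<beta> = \<nu> then s / 2 else 0)
                  + (if \<alpha> = \<nu> \<and> \<beta> = \<mu> then s / 2 else 0)) *\<^sub>R w)) 0)) x))"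

text \<open>Here \<open>g\<close>, \<open>dg \<mu>\<close>, \<open>ddg \<mu> \<nu>\<close> are the metric and its first and second partial derivatives;
  \<open>dinv_metric\<close> and \<open>dchristoffel\<close> are the partial derivatives \<open>\<partial>\<^sub>\<mu> g\<^sup>\<rho>\<^sup>\<tau>\<close> and \<open>\<partial>\<^sub>\<mu> \<Gamma>\<^sup>\<rho>\<^sub>\<nu>\<^sub>\<sigma>\<close>
  expressed through them. The Riemann tensor is
  \<open>R\<^sup>\<rho>\<^sub>\<sigma>\<^sub>\<mu>\<^sub>\<nu> = \<partial>\<^sub>\<mu> \<Gamma>\<^sup>\<rho>\<^sub>\<nu>\<^sub>\<sigma> - \<partial>\<^sub>\<nu> \<Gamma>\<^sup>\<rho>\<^sub>\<mu>\<^sub>\<sigma> + \<Gamma>\<^sup>\<rho>\<^sub>\<mu>\<^sub>\<tau> \<Gamma>\<^sup>\<tau>\<^sub>\<nu>\<^sub>\<sigma> - \<Gamma>\<^sup>\<rho>\<^sub>\<nu>\<^sub>\<tau> \<Gamma>\<^sup>\<tau>\<^sub>\<mu>\<^sub>\<sigma>\<close> and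
  \<open>R\<^sub>\<sigma>\<^sub>\<nu> = R\<^sup>\<rho>\<^sub>\<sigma>\<^sub>\<rho>\<^sub>\<nu>\<close>, so that spheres have positive scalar curvature.\<close>

type_synonym 'i metric1 = "'i \<Rightarrow> real ^ 'i ^ 'i"
type_synonym 'i metric2 = "'i \<Rightarrow> 'i \<Rightarrow> real ^ 'i ^ 'i"

definition christoffel :: "real ^ 'i ^ 'i \<Rightarrow> 'i metric1 \<Rightarrow> 'i \<Rightarrow> 'i \<Rightarrow> 'i::finite \<Rightarrow> real" where
  "christoffel g dg \<rho> \<nu> \<sigma> =
     (1/2) * (\<Sum>\<tau>\<in>UNIV. matrix_inv g $ \<rho> $ \<tau> * (dg \<nu> $ \<tau> $ \<sigma> + dg \<sigma> $ \<tau> $ \<nu> - dg \<tau> $ \<nu> $ \<sigma>))"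

definition dinv_metric :: "real ^ 'i ^ 'i \<Rightarrow> 'i metric1 \<Rightarrow> 'i \<Rightarrow> 'i \<Rightarrow> 'i::finite \<Rightarrow> real" where
  "dinv_metric g dg \<mu> \<rho> \<tau> =
     - (\<Sum>\<alpha>\<in>UNIV. \<Sum>\<beta>\<in>UNIV. matrix_inv g $ \<rho> $ \<alpha> * dg \<mu> $ \<alpha> $ \<beta> * matrix_inv g $ \<beta> $ \<tau>)"

definition dchristoffel ::
  "real ^ 'i ^ 'i \<Rightarrow> 'i metric1 \<Rightarrow> 'i metric2 \<Rightarrow> 'i \<Rightarrow> 'i \<Rightarrow> 'i \<Rightarrow> 'i::finite \<Rightarrow> real" where
  "dchristoffel g dg ddg \<mu> \<rho> \<nu> \<sigma> =
     (1/2) * (\<Sum>\<tau>\<in>UNIV.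
        dinv_metric g dg \<mu> \<rho> \<tau> * (dg \<nu> $ \<tau> $ \<sigma> + dg \<sigma> $ \<tau> $ \<nu> - dg \<tau> $ \<nu> $ \<sigma>)
      + matrix_inv g $ \<rho> $ \<tau> * (ddg \<mu> \<nu> $ \<tau> $ \<sigma> + ddg \<mu> \<sigma> $ \<tau> $ \<nu> - ddg \<mu> \<tau> $ \<nu> $ \<sigma>))"

definition ricci ::
  "real ^ 'i ^ 'i \<Rightarrow> 'i metric1 \<Rightarrow> 'i metric2 \<Rightarrow> 'i \<Rightarrow> 'i::finite \<Rightarrow> real" where
  "ricci g dg ddg \<sigma> \<nu> =
     (\<Sum>\<rho>\<in>UNIV. dchristoffel g dg ddg \<rho> \<rho> \<nu> \<sigma> - dchristoffel g dg ddg \<nu> \<rho> \<rho> \<sigma>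
        + (\<Sum>\<tau>\<in>UNIV. christoffel g dg \<rho> \<rho> \<tau> * christoffel g dg \<tau> \<nu> \<sigma>
                  - christoffel g dg \<rho> \<nu> \<tau> * christoffel g dg \<tau> \<rho> \<sigma>))"

definition scalar_curvature ::
  "real ^ 'i ^ 'i \<Rightarrow> 'i::finite metric1 \<Rightarrow> 'i metric2 \<Rightarrow> real" where
  "scalar_curvature g dg ddg =
     (\<Sum>\<sigma>\<in>UNIV. \<Sum>\<nu>\<in>UNIV. matrix_inv g $ \<sigma> $ \<nu> * ricci g dg ddg \<sigma> \<nu>)"

text \<open>The fully antisymmetric array with \<open>(\<mu>, \<nu>, \<rho>)\<close> component 1 and support on the permutations
  of three distinct indices \<open>\<mu>, \<nu>, \<rho>\<close> (it is 0 if the indices are not distinct).\<close>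

definition form3 :: "'i \<Rightarrow> 'i \<Rightarrow> 'i \<Rightarrow> real ^ 'i ^ 'i ^ 'i::finite" where
  "form3 \<mu> \<nu> \<rho> = (\<chi> \<alpha> \<beta> \<gamma>.
     (let \<delta> = (\<lambda>i j. if i = j then 1 else 0) in
        \<delta> \<alpha> \<mu> * (\<delta> \<beta> \<nu> * \<delta> \<gamma> \<rho> - \<delta> \<beta> \<rho> * \<delta> \<gamma> \<nu>)
      + \<delta> \<alpha> \<nu> * (\<delta> \<beta> \<rho> * \<delta> \<gamma> \<mu> - \<delta> \<beta> \<mu> * \<delta> \<gamma> \<rho>)
      + \<delta> \<alpha> \<rho> * (\<delta> \<beta> \<mu> * \<delta> \<gamma> \<nu> - \<delta> \<beta> \<nu> * \<delta> \<gamma> \<mu>)))"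

text \<open>\<open>F\<^sub>\<mu>\<^sub>\<nu>\<^sub>\<rho>\<^sub>\<sigma> = 4 \<partial>\<^sub>[\<^sub>\<mu> A\<^sub>\<nu>\<^sub>\<rho>\<^sub>\<sigma>\<^sub>]\<close>, written out for totally antisymmetric \<open>A\<close>;
  \<open>dA \<mu>\<close> stands for \<open>\<partial>\<^sub>\<mu> A\<close>.\<close>

definition field_strength ::
  "('i \<Rightarrow> real ^ 'i ^ 'i ^ 'i) \<Rightarrow> 'i \<Rightarrow> 'i \<Rightarrow> 'i \<Rightarrow> 'i::finite \<Rightarrow> real" where
  "field_strength dA \<mu> \<nu> \<rho> \<sigma> =
     dA \<mu> $ \<nu> $ \<rho> $ \<sigma> - dA \<nu> $ \<mu> $ \<rho> $ \<sigma> + dA \<rho> $ \<mu> $ \<nu> $ \<sigma> - dA \<sigma> $ \<mu> $ \<nu> $ \<rho>"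

definition field_strength_sq ::
  "real ^ 'i ^ 'i \<Rightarrow> ('i \<Rightarrow> real ^ 'i ^ 'i ^ 'i::finite) \<Rightarrow> real" where
  "field_strength_sq g dA =
     (\<Sum>\<mu>\<in>UNIV. \<Sum>\<nu>\<in>UNIV. \<Sum>\<rho>\<in>UNIV. \<Sum>\<sigma>\<in>UNIV. \<Sum>\<alpha>\<in>UNIV. \<Sum>\<beta>\<in>UNIV. \<Sum>\<gamma>\<in>UNIV. \<Sum>\<kappa>\<in>UNIV.
        field_strength dA \<mu> \<nu> \<rho> \<sigma> * field_strength dA \<alpha> \<beta> \<gamma> \<kappa>
        * matrix_inv g $ \<mu> $ \<alpha> * matrix_inv g $ \<nu> $ \<beta> * matrix_inv g $ \<rho> $ \<gamma> * matrix_inv g $ \<sigma> $ \<kappa>)"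

text \<open>The coordinates are \<open>x $ 1, \<dots>, x $ 11\<close>. The index type \<open>11\<close> is the type of integers modulo
  11, so that \<open>11 :: 11\<close> is the same index as \<open>0 :: 11\<close>.\<close>

type_synonym point = "real ^ 11"
type_synonym metric = "real ^ 11 ^ 11"
type_synonym threeform = "real ^ 11 ^ 11 ^ 11"

text \<open>The density of \<open>A \<and> F \<and> F\<close> up to a constant factor; the sum over permutations is the
  contraction with the Levi-Civita symbol.\<close>

definition chern_simons :: "threeform \<Rightarrow> (11 \<Rightarrow> threeform) \<Rightarrow> real" where
  "chern_simons A dA =
     (\<Sum>\<pi> | \<pi> permutes (UNIV :: 11 set). of_int (sign \<pi>) * A $ \<pi> 1 $ \<pi> 2 $ \<pi> 3
        * field_strength dA (\<pi> 4) (\<pi> 5) (\<pi> 6) (\<pi> 7)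
        * field_strength dA (\<pi> 8) (\<pi> 9) (\<pi> 10) (\<pi> 11))"

text \<open>The parameter \<open>\<epsilon>\<close> is the kinetic sign and \<open>c\<close> the Chern--Simons coefficient.\<close>

definition sugra_lagrangian :: "real \<Rightarrow> real \<Rightarrow> (11, metric \<times> threeform) lagrangian" where
  "sugra_lagrangian \<epsilon> c q d dd =
     (let g = fst q; dg = (\<lambda>\<mu>. fst (d \<mu>)); ddg = (\<lambda>\<mu> \<nu>. fst (dd \<mu> \<nu>));
          A = snd q; dA = (\<lambda>\<mu>. snd (d \<mu>)) in
        sqrt \<bar>det g\<bar> * (scalar_curvature g dg ddg - \<epsilon> / (2 * fact 4) * field_strength_sq g dA)
      + c * chern_simons A dA)"

text \<open>The components \<open>g\<^sub>\<mu>\<^sub>\<nu>\<close> and \<open>g\<^sub>\<nu>\<^sub>\<mu>\<close>, and likewise the antisymmetric permutations of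
  \<open>A\<^sub>\<mu>\<^sub>\<nu>\<^sub>\<rho>\<close>, are one and the same variable, so they are varied together.\<close>

definition metric_unit :: "11 \<Rightarrow> 11 \<Rightarrow> metric" where
  "metric_unit \<mu> \<nu> = (\<chi> \<alpha> \<beta>. if {\<alpha>, \<beta>} = {\<mu>, \<nu>} then 1 else 0)"

definition bosonic_eom ::
  "real \<Rightarrow> real \<Rightarrow> point set \<Rightarrow> (point \<Rightarrow> metric) \<Rightarrow> (point \<Rightarrow> threeform) \<Rightarrow> bool" where
  "bosonic_eom \<epsilon> c D g A \<longleftrightarrow> (\<forall>x\<in>D.
     (\<forall>\<mu> \<nu>. euler (sugra_lagrangian \<epsilon> c) (\<lambda>y. (g y, A y)) (metric_unit \<mu> \<nu>, 0) x = 0) \<and>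
     (\<forall>\<mu> \<nu> \<rho>. euler (sugra_lagrangian \<epsilon> c) (\<lambda>y. (g y, A y)) (0, form3 \<mu> \<nu> \<rho>) x = 0))"

text \<open>Existence of an orthogonal basis (the columns of \<open>P\<close>) with \<open>t\<close> timelike and \<open>s\<close> spacelike
  vectors.\<close>

definition has_signature :: "nat \<Rightarrow> nat \<Rightarrow> real ^ 'i ^ 'i::finite \<Rightarrow> bool" where
  "has_signature t s g \<longleftrightarrow> (\<exists>(P :: real ^ 'i ^ 'i) d. invertible P \<and>
     transpose P ** g ** P = (\<chi> \<mu> \<nu>. if \<mu> = \<nu> then d \<mu> else 0) \<and> (\<forall>\<mu>. d \<mu> \<noteq> 0) \<and>
     card {\<mu>. d \<mu> < 0} = t \<and> card {\<mu>. d \<mu> > 0} = s)"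

definition time_coordinates :: "metric \<Rightarrow> 11 set" where
  "time_coordinates g = {\<mu>. g $ \<mu> $ \<mu> < 0}"

text \<open>\<open>(g, A)\<close> solves, on \<open>D\<close>, the bosonic equations of motion of the theory \<open>(t, s, \<epsilon>)\<close>
  with Chern--Simons coefficient \<open>c\<close>, and \<open>T\<close> is the set of time coordinates.\<close>

definition solves_theory ::
  "nat \<Rightarrow> nat \<Rightarrow> real \<Rightarrow> real \<Rightarrow> 11 set \<Rightarrow> point set \<Rightarrow> (point \<Rightarrow> metric) \<Rightarrow> (point \<Rightarrow> threeform) \<Rightarrow> bool"
  where
  "solves_theory t s \<epsilon> c T D g A \<longleftrightarrow>
     (\<forall>x\<in>D. has_signature t s (g x) \<and> time_coordinates (g x) = T) \<and> bosonic_eom \<epsilon> c D g A"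

text \<open>Functions of \<open>(x\<^sup>1, x\<^sup>2)\<close> are functions of \<open>z = x\<^sup>1 + i x\<^sup>2\<close>; the directions \<open>1\<close> and \<open>\<i>\<close> in the
  derivatives below are those of \<open>x\<^sup>1\<close> and \<open>x\<^sup>2\<close>.\<close>

definition zcoord :: "point \<Rightarrow> complex" where
  "zcoord x = Complex (x $ 1) (x $ 2)"

definition conjugate_harmonic_on :: "complex set \<Rightarrow> (complex \<Rightarrow> real) \<Rightarrow> (complex \<Rightarrow> real) \<Rightarrow> bool" where
  "conjugate_harmonic_on U H B \<longleftrightarrow> (\<forall>z\<in>U.
     H differentiable (at z) \<and> B differentiable (at z) \<and>
     frechet_derivative H (at z) 1 = frechet_derivative B (at z) \<i> \<and>
     frechet_derivative H (at z) \<i> = - frechet_derivative B (at z) 1)"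

text \<open>\<open>calE e p\<close> is the value of \<open>\<E>\<^sub>p\<close> at a point where \<open>\<E>\<^sub>1 = e\<close> (the value at \<open>p = 0\<close> is a
  dummy), and \<open>calF e n\<close> is the value of \<open>\<F>\<^sub>2\<^sub>n\<^sub>-\<^sub>1\<close>; in particular \<open>calF e 0\<close> is \<open>\<F>\<^sub>-\<^sub>1 = 1\<close>.\<close>

primrec calE :: "complex \<Rightarrow> nat \<Rightarrow> complex" where
  "calE e 0 = 0"
| "calE e (Suc p) = (if p = 0 then e else if even (Suc p) then 1 / calE e p else 2 - calE e p)"

definition calF :: "complex \<Rightarrow> nat \<Rightarrow> complex" where
  "calF e n = (\<Prod>k=1..n. calE e (2 * k - 1))"

definition brane_metric :: "complex \<Rightarrow> real \<Rightarrow> real \<Rightarrow> real \<Rightarrow> metric" where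
  "brane_metric F h a b = (\<chi> \<mu> \<nu>.
     if \<mu> \<noteq> \<nu> then 0
     else if \<mu> \<in> {1, 2} then Re (F * cnj F) * h powr (1/3)
     else if \<mu> \<in> {3, 4, 5, 6, 7, 8} then h powr (1/3)
     else if \<mu> = 9 then a * h powr (-2/3)
     else b * h powr (-2/3))"

end

theory Submission
  imports Defs "HOL-Complex_Analysis.Cauchy_Integral_Formula"
begin

text \<open>Put \<open>m = \<F> \<F>\<^sup>*\<close> and \<open>u = h\<close> to the power 1/3, where \<open>h = Re \<E>\<^sub>p\<close>. The metric is diagonal with
  entries \<open>m u\<close> (twice), \<open>u\<close> (six times) and three times \<open>1/u\<^sup>2\<close> up to sign, so that \<open>\<surd>|g| = m u\<close>.
  Holomorphy of \<open>\<F>\<close> and \<open>\<E>\<^sub>p\<close> enters only through the harmonicity of \<open>ln m\<close> and \<open>u\<^sup>3\<close>.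
  Off-diagonal metric variations, and form variations other than along \<open>A\<^sub>9\<^sub>,\<^sub>1\<^sub>0\<^sub>,\<^sub>1\<^sub>1\<close>, change sign
  under the reflection of a coordinate \<open>x\<^sup>k\<close> with \<open>k \<ge> 3\<close> (combined with a sign flip of \<open>A\<close> when
  \<open>k \<ge> 9\<close>), while the background is invariant: there the Lagrangian is even in the variation and
  its derivative vanishes. In the 2x2 block the curvature of the warp factors cancels
  the stress of the field strength, and what remains is the two-dimensional Einstein--Hilbert term, which
  has no Euler--Lagrange equation. Only the diagonal warp directions and \<open>A\<^sub>9\<^sub>,\<^sub>1\<^sub>0\<^sub>,\<^sub>1\<^sub>1\<close> itself give
  genuine equations, and these are the two harmonicity conditions. The Chern--Simons term never
  contributes, since every nonzero factor in it at the background carries the index 9.\<close>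

text \<open>\<open>euler\<close> differentiates the Lagrangian in a field, its first and its second
  derivatives as independent variables, so the curvature has to be known on perturbed jets and not
  only on the background. Hence the curvature formulas below are identities in arbitrary numbers
  \<open>g\<close>, \<open>dg\<close>, \<open>ddg\<close> subject to a sparsity pattern and
  symmetries. A second obstacle is that \<open>pdrv\<close> and \<open>deriv\<close> are total:
  evenness in a variation gives a zero derivative only once differentiability is shown, and
  derivatives along the nine other coordinates vanish because the fields are functions of z on the
  whole space. The exponents come from two balances. The logarithmic derivatives of the warp factors
  have weights 1 (six times) and -2 (three times), with sum zero, so second derivatives and
  connection terms drop out; the remaining squares add up to -9/2, which is exactly what the
  potential \<open>t / u ^ 3\<close> supplies. One sign \<open>s\<close> serves both as kinetic sign
  and as signature sign, so both levels and both parities of n are instances of one statement about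
  a pair of holomorphic functions.\<close>

section \<open>Scalar curvature of a jet that is diagonal outside one 2x2 block\<close>

lemma sum_split2:
  fixes f :: "'i::finite \<Rightarrow> 'b::comm_monoid_add"
  assumes "u \<noteq> v"
  shows "(\<Sum>\<rho>\<in>UNIV. f \<rho>) = f u + f v + (\<Sum>a\<in>-{u,v}. f a)"
proof -
  have "(\<Sum>\<rho>\<in>UNIV. f \<rho>) = (\<Sum>\<rho>\<in>{u,v}. f \<rho>) + (\<Sum>a\<in>-{u,v}. f a)"
    by (metis Compl_eq_Diff_UNIV add.commute finite sum.subset_diff top_greatest)
  then show ?thesis using assms by (simp add: add.assoc)
qed

lemma sum_C_single:
  fixes f :: "'i::finite \<Rightarrow> 'b::comm_monoid_add"
  assumes "a \<in> S" "\<And>b. b \<in> S \<Longrightarrow> b \<noteq> a \<Longrightarrow> f b = 0"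
  shows "sum f S = f a"
proof -
  have "sum f S = sum f {a}"
    by (rule sum.mono_neutral_right) (use assms in auto)
  then show ?thesis by simp
qed

text \<open>The part of the scalar curvature that involves the warp factors \<open>g\<^sub>a\<^sub>a\<close> with \<open>a\<close> outside the block
  \<open>{u, v}\<close>, before contraction with the inverse metric \<open>M\<close> of the block.\<close>

definition trace_part ::
  "('i \<Rightarrow> 'i \<Rightarrow> real) \<Rightarrow> real^'i^'i \<Rightarrow> 'i metric1 \<Rightarrow> 'i metric2 \<Rightarrow> 'i \<Rightarrow> 'i \<Rightarrow> 'i \<Rightarrow> 'i::finite \<Rightarrow> real" where
  "trace_part M g dg ddg u v i j =
   (\<Sum>a\<in>-{u,v}. - (M a a * ddg i j $ a $ a) + (3/4) * ((M a a * dg i $ a $ a) * (M a a * dg j $ a $ a)))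
   + christoffel g dg u i j * (\<Sum>a\<in>-{u,v}. M a a * dg u $ a $ a)
   + christoffel g dg v i j * (\<Sum>a\<in>-{u,v}. M a a * dg v $ a $ a)
   - (1/4) * (\<Sum>a\<in>-{u,v}. M a a * dg i $ a $ a) * (\<Sum>a\<in>-{u,v}. M a a * dg j $ a $ a)"

text \<open>The curvature depends on the metric only through its inverse, so the sparsity pattern is
  imposed on \<open>M\<close>. The conditions \<open>dC\<close>, \<open>eC\<close> and
  \<open>ec\<close> are all that is kept of \<open>dg\<close> and \<open>ddg\<close> being
  derivatives of a field of two coordinates.\<close>

context
  fixes g :: "real^'i^'i" and dg :: "'i::finite metric1" and ddg :: "'i metric2" and u v :: 'i
    and M :: "'i \<Rightarrow> 'i \<Rightarrow> real"
  assumes uv: "u \<noteq> v"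
    and M: "\<And>\<rho> \<tau>. matrix_inv g $ \<rho> $ \<tau> = M \<rho> \<tau>"
    and M0: "\<And>\<rho> \<tau>. \<rho> \<noteq> \<tau> \<Longrightarrow> {\<rho>,\<tau>} \<noteq> {u,v} \<Longrightarrow> M \<rho> \<tau> = 0"
    and Ms: "M v u = M u v"
    and d0: "\<And>\<alpha> \<rho> \<tau>. \<rho> \<noteq> \<tau> \<Longrightarrow> {\<rho>,\<tau>} \<noteq> {u,v} \<Longrightarrow> dg \<alpha> $ \<rho> $ \<tau> = 0"
    and ds: "\<And>\<alpha>. dg \<alpha> $ v $ u = dg \<alpha> $ u $ v"
    and dC: "\<And>\<alpha>. \<alpha> \<notin> {u,v} \<Longrightarrow> dg \<alpha> = 0"
    and e0: "\<And>\<alpha> \<beta> \<rho> \<tau>. \<rho> \<noteq> \<tau> \<Longrightarrow> {\<rho>,\<tau>} \<noteq> {u,v} \<Longrightarrow> ddg \<alpha> \<beta> $ \<rho> $ \<tau> = 0"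
    and es: "\<And>\<alpha> \<beta>. ddg \<alpha> \<beta> $ v $ u = ddg \<alpha> \<beta> $ u $ v"
    and eC: "\<And>\<alpha> \<beta>. \<alpha> \<notin> {u,v} \<or> \<beta> \<notin> {u,v} \<Longrightarrow> ddg \<alpha> \<beta> = 0"
    and ec: "ddg v u = ddg u v"
begin

private lemma MC: "a \<notin> {u,v} \<Longrightarrow> a \<noteq> \<tau> \<Longrightarrow> M a \<tau> = 0" "a \<notin> {u,v} \<Longrightarrow> a \<noteq> \<tau> \<Longrightarrow> M \<tau> a = 0"
  by (rule M0; auto simp: doubleton_eq_iff)+
private lemma dCC: "a \<notin> {u,v} \<Longrightarrow> a \<noteq> \<tau> \<Longrightarrow> dg \<alpha> $ a $ \<tau> = 0" "a \<notin> {u,v} \<Longrightarrow> a \<noteq> \<tau> \<Longrightarrow> dg \<alpha> $ \<tau> $ a = 0"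
  by (rule d0; auto simp: doubleton_eq_iff)+
private lemma eCC: "a \<notin> {u,v} \<Longrightarrow> a \<noteq> \<tau> \<Longrightarrow> ddg \<alpha> \<beta> $ a $ \<tau> = 0" "a \<notin> {u,v} \<Longrightarrow> a \<noteq> \<tau> \<Longrightarrow> ddg \<alpha> \<beta> $ \<tau> $ a = 0"
  by (rule e0; auto simp: doubleton_eq_iff)+

private lemma sumMC: "a \<notin> {u,v} \<Longrightarrow> (\<Sum>\<tau>\<in>UNIV. M a \<tau> * X \<tau>) = M a a * X a"
  by (rule sum_C_single) (auto simp: MC)
private lemma sumMI: "i \<in> {u,v} \<Longrightarrow> (\<Sum>\<tau>\<in>UNIV. M i \<tau> * X \<tau>) = M i u * X u + M i v * X v"
  by (subst sum_split2[OF uv]) (auto simp: MC)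

private lemma chr_C: "a \<notin> {u,v} \<Longrightarrow> christoffel g dg a \<nu> \<sigma> =
    (1/2) * (M a a * (dg \<nu> $ a $ \<sigma> + dg \<sigma> $ a $ \<nu> - dg a $ \<nu> $ \<sigma>))"
  by (simp add: christoffel_def M sumMC)
lemma christoffel_block: "i \<in> {u,v} \<Longrightarrow> christoffel g dg i \<nu> \<sigma> =
    (1/2) * (M i u * (dg \<nu> $ u $ \<sigma> + dg \<sigma> $ u $ \<nu> - dg u $ \<nu> $ \<sigma>)
           + M i v * (dg \<nu> $ v $ \<sigma> + dg \<sigma> $ v $ \<nu> - dg v $ \<nu> $ \<sigma>))"
  by (simp add: christoffel_def M sumMI)

text \<open>The derivative of the inverse is - M dg M, a product of matrices with the same block
  pattern, so it has that pattern again.\<close>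

private lemma dinv_C: "a \<notin> {u,v} \<Longrightarrow> \<tau> \<noteq> a \<Longrightarrow> dinv_metric g dg \<mu> a \<tau> = 0"
  "a \<notin> {u,v} \<Longrightarrow> dinv_metric g dg \<mu> a a = - (M a a * dg \<mu> $ a $ a * M a a)"
  "a \<notin> {u,v} \<Longrightarrow> \<tau> \<noteq> a \<Longrightarrow> dinv_metric g dg \<mu> \<tau> a = 0"
proof -
  have *: "dinv_metric g dg \<mu> \<rho> \<tau> = - (\<Sum>\<alpha>\<in>UNIV. M \<rho> \<alpha> * (\<Sum>\<beta>\<in>UNIV. dg \<mu> $ \<alpha> $ \<beta> * M \<beta> \<tau>))" for \<rho> \<tau>
    by (simp add: dinv_metric_def M sum_distrib_left mult.assoc)
  have i: "(\<Sum>\<beta>\<in>UNIV. dg \<mu> $ a $ \<beta> * M \<beta> \<tau>) = dg \<mu> $ a $ a * M a \<tau>" if "a \<notin> {u,v}" for a \<tau>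
    by (rule sum_C_single) (use that in \<open>auto simp: dCC\<close>)
  have j: "(\<Sum>\<beta>\<in>UNIV. dg \<mu> $ \<alpha> $ \<beta> * M \<beta> a) = dg \<mu> $ \<alpha> $ a * M a a" if "a \<notin> {u,v}" for a \<alpha>
    by (rule sum_C_single) (use that in \<open>auto simp: MC\<close>)
  show "a \<notin> {u,v} \<Longrightarrow> \<tau> \<noteq> a \<Longrightarrow> dinv_metric g dg \<mu> a \<tau> = 0"
    by (simp only: *, subst sumMC) (auto simp: i MC)
  show "a \<notin> {u,v} \<Longrightarrow> dinv_metric g dg \<mu> a a = - (M a a * dg \<mu> $ a $ a * M a a)"
    by (simp only: *, subst sumMC) (auto simp: i MC)
  show "a \<notin> {u,v} \<Longrightarrow> \<tau> \<noteq> a \<Longrightarrow> dinv_metric g dg \<mu> \<tau> a = 0"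
    unfolding * neg_equal_0_iff_equal
  proof (intro sum.neutral ballI)
    fix \<alpha> assume "a \<notin> {u,v}" "\<tau> \<noteq> a"
    then show "M \<tau> \<alpha> * (\<Sum>\<beta>\<in>UNIV. dg \<mu> $ \<alpha> $ \<beta> * M \<beta> a) = 0"
      by (cases "\<alpha> = a") (simp_all add: j MC dCC)
  qed
qed

private lemma dinv_I: "i \<in> {u,v} \<Longrightarrow> j \<in> {u,v} \<Longrightarrow> dinv_metric g dg \<mu> i j =
   - (M i u * dg \<mu> $ u $ u * M u j + M i u * dg \<mu> $ u $ v * M v j
      + (M i v * dg \<mu> $ u $ v * M u j + M i v * dg \<mu> $ v $ v * M v j))"
proof -
  have *: "dinv_metric g dg \<mu> \<rho> \<tau> = - (\<Sum>\<alpha>\<in>UNIV. M \<rho> \<alpha> * (\<Sum>\<beta>\<in>UNIV. dg \<mu> $ \<alpha> $ \<beta> * M \<beta> \<tau>))" for \<rho> \<tau>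
    by (simp add: dinv_metric_def M sum_distrib_left mult.assoc)
  have i: "(\<Sum>\<beta>\<in>UNIV. dg \<mu> $ i $ \<beta> * M \<beta> \<tau>) = dg \<mu> $ i $ u * M u \<tau> + dg \<mu> $ i $ v * M v \<tau>" if "i \<in> {u,v}" for i \<tau>
    by (subst sum_split2[OF uv]) (use that in \<open>auto simp: dCC\<close>)
  show "i \<in> {u,v} \<Longrightarrow> j \<in> {u,v} \<Longrightarrow> ?thesis"
    by (simp only: * sumMI i ds insert_iff simp_thms) (simp add: algebra_simps)
qed

private lemma dchr_C: "a \<notin> {u,v} \<Longrightarrow> dchristoffel g dg ddg \<mu> a \<nu> \<sigma> =
    (1/2) * (- (M a a * dg \<mu> $ a $ a * M a a) * (dg \<nu> $ a $ \<sigma> + dg \<sigma> $ a $ \<nu> - dg a $ \<nu> $ \<sigma>)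
      + M a a * (ddg \<mu> \<nu> $ a $ \<sigma> + ddg \<mu> \<sigma> $ a $ \<nu> - ddg \<mu> a $ \<nu> $ \<sigma>))"
  unfolding dchristoffel_def
  by (subst sum_C_single[of a]) (auto simp: M MC dinv_C)

private lemma dchristoffel_block: "i \<in> {u,v} \<Longrightarrow> dchristoffel g dg ddg \<mu> i \<nu> \<sigma> =
    (1/2) * (dinv_metric g dg \<mu> i u * (dg \<nu> $ u $ \<sigma> + dg \<sigma> $ u $ \<nu> - dg u $ \<nu> $ \<sigma>)
      + M i u * (ddg \<mu> \<nu> $ u $ \<sigma> + ddg \<mu> \<sigma> $ u $ \<nu> - ddg \<mu> u $ \<nu> $ \<sigma>)
      + (dinv_metric g dg \<mu> i v * (dg \<nu> $ v $ \<sigma> + dg \<sigma> $ v $ \<nu> - dg v $ \<nu> $ \<sigma>)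
      + M i v * (ddg \<mu> \<nu> $ v $ \<sigma> + ddg \<mu> \<sigma> $ v $ \<nu> - ddg \<mu> v $ \<nu> $ \<sigma>)))"
  unfolding dchristoffel_def
proof (subst sum_split2[OF uv], subst sum.neutral)
  assume i: "i \<in> {u,v}"
  show "\<forall>a\<in>-{u,v}. dinv_metric g dg \<mu> i a * (dg \<nu> $ a $ \<sigma> + dg \<sigma> $ a $ \<nu> - dg a $ \<nu> $ \<sigma>)
    + matrix_inv g $ i $ a * (ddg \<mu> \<nu> $ a $ \<sigma> + ddg \<mu> \<sigma> $ a $ \<nu> - ddg \<mu> a $ \<nu> $ \<sigma>) = 0"
  proof
    fix a assume "a \<in> -{u,v}"
    with i have "dinv_metric g dg \<mu> i a = 0" "M i a = 0"
      by (auto intro!: dinv_C(3) MC)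
    then show "dinv_metric g dg \<mu> i a * (dg \<nu> $ a $ \<sigma> + dg \<sigma> $ a $ \<nu> - dg a $ \<nu> $ \<sigma>)
    + matrix_inv g $ i $ a * (ddg \<mu> \<nu> $ a $ \<sigma> + ddg \<mu> \<sigma> $ a $ \<nu> - ddg \<mu> a $ \<nu> $ \<sigma>) = 0"
      by (simp add: M)
  qed
qed (simp add: M)

private abbreviation "\<Gamma> \<equiv> christoffel g dg"

text \<open>Nothing depends on the coordinate \<open>a\<close>, so only the divergence of
  \<open>\<Gamma> i a a\<close> with \<open>i\<close> in the block and products of connection
  coefficients remain. The divergence of the inverse block combines with the block part of the
  traced connection into \<open>\<Gamma>\<close> contracted with \<open>M\<close>; the sums over
  \<open>b\<close> are the rest of that trace.\<close>

private lemma ricci_a: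
  assumes a: "a \<notin> {u,v}"
  shows "ricci g dg ddg a a = (1/2) * (
      M u u * (- ddg u u $ a $ a + M a a * (dg u $ a $ a)^2)
      + 2 * M u v * (- ddg u v $ a $ a + M a a * dg u $ a $ a * dg v $ a $ a)
      + M v v * (- ddg v v $ a $ a + M a a * (dg v $ a $ a)^2)
      + dg u $ a $ a * (M u u * \<Gamma> u u u + 2 * M u v * \<Gamma> u u v + M v v * \<Gamma> u v v)
      + dg v $ a $ a * (M u u * \<Gamma> v u u + 2 * M u v * \<Gamma> v u v + M v v * \<Gamma> v v v))
    - (1/4) * (M u u * dg u $ a $ a * (\<Sum>b\<in>-{u,v}. M b b * dg u $ b $ b)
      + M u v * dg u $ a $ a * (\<Sum>b\<in>-{u,v}. M b b * dg v $ b $ b)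
      + M u v * dg v $ a $ a * (\<Sum>b\<in>-{u,v}. M b b * dg u $ b $ b)
      + M v v * dg v $ a $ a * (\<Sum>b\<in>-{u,v}. M b b * dg v $ b $ b))"
proof -
  have nz: "a \<noteq> u" "a \<noteq> v" using a by auto
  have *: "(\<Sum>\<rho>\<in>UNIV. f \<rho>) = f u + f v + f a" if "\<And>b. b \<notin> {u,v,a} \<Longrightarrow> f b = 0" for f :: "'i \<Rightarrow> real"
    using sum_split2[OF uv, of f] sum_C_single[of a "-{u,v}" f] a that by auto
  have A: "dchristoffel g dg ddg \<rho> \<rho> a a - dchristoffel g dg ddg a \<rho> \<rho> a = 0" if "\<rho> \<notin> {u,v}" for \<rho>
    using that a by (simp add: dchr_C dC eC)
  have T1: "(\<Sum>\<rho>\<in>UNIV. dchristoffel g dg ddg \<rho> \<rho> a a - dchristoffel g dg ddg a \<rho> \<rho> a)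
     = dchristoffel g dg ddg u u a a + dchristoffel g dg ddg v v a a"
    using a nz by (subst sum_split2[OF uv]) (simp add: A dchristoffel_block dC eC dinv_I)
  have S: "(\<Sum>b\<in>-{u,v}. \<Gamma> b b i) = (1/2) * (\<Sum>b\<in>-{u,v}. M b b * dg i $ b $ b)" if "i \<in> {u,v}" for i
    unfolding sum_distrib_left by (rule sum.cong) (use that in \<open>auto simp: chr_C dC dCC\<close>)
  \<comment> \<open>The traced connection is the logarithmic derivative of the volume element; each
    warp factor enters it with weight one half.\<close>
  have tr: "(\<Sum>\<rho>\<in>UNIV. \<Gamma> \<rho> \<rho> i) = \<Gamma> u u i + \<Gamma> v v i + (1/2) * (\<Sum>b\<in>-{u,v}. M b b * dg i $ b $ b)"
    if "i \<in> {u,v}" for i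
    by (subst sum_split2[OF uv]) (simp add: S[OF that])
  have z: "\<Gamma> b a a = 0" if "b \<notin> {u,v}" for b
    using that a by (simp add: chr_C dC)
  have T2: "(\<Sum>\<rho>\<in>UNIV. \<Sum>\<tau>\<in>UNIV. \<Gamma> \<rho> \<rho> \<tau> * \<Gamma> \<tau> a a)
     = (\<Sum>\<rho>\<in>UNIV. \<Gamma> \<rho> \<rho> u) * \<Gamma> u a a + (\<Sum>\<rho>\<in>UNIV. \<Gamma> \<rho> \<rho> v) * \<Gamma> v a a"
    by (subst sum.swap, subst sum_split2[OF uv]) (simp add: z sum_distrib_right)
  have in0: "(\<Sum>\<tau>\<in>UNIV. \<Gamma> i a \<tau> * \<Gamma> \<tau> i a) = \<Gamma> i a a * \<Gamma> a i a" if i: "i \<in> {u,v}" for i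
    by (rule sum_C_single) (use i a nz in \<open>auto simp: christoffel_block dC dCC\<close>)
  have in1: "(\<Sum>\<tau>\<in>UNIV. \<Gamma> a a \<tau> * \<Gamma> \<tau> a a) = \<Gamma> a a u * \<Gamma> u a a + \<Gamma> a a v * \<Gamma> v a a"
    using nz by (subst sum_split2[OF uv]) (auto simp: z)
  have in2: "(\<Sum>\<tau>\<in>UNIV. \<Gamma> b a \<tau> * \<Gamma> \<tau> b a) = 0" if b: "b \<notin> {u,v,a}" for b
  proof (rule sum.neutral, safe)
    fix \<tau>
    show "\<Gamma> b a \<tau> * \<Gamma> \<tau> b a = 0"
    proof (cases "\<tau> \<in> {u,v}")
      case True
      then show ?thesis using a b nz by (auto simp: christoffel_block chr_C dC dCC)
    next
      case False
      then show ?thesis using a b nz by (auto simp: chr_C dC)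
    qed
  qed
  have T3: "(\<Sum>\<rho>\<in>UNIV. \<Sum>\<tau>\<in>UNIV. \<Gamma> \<rho> a \<tau> * \<Gamma> \<tau> \<rho> a)
     = \<Gamma> u a a * \<Gamma> a u a + \<Gamma> v a a * \<Gamma> a v a + (\<Gamma> a a u * \<Gamma> u a a + \<Gamma> a a v * \<Gamma> v a a)"
    by (subst *) (auto simp: in0 in1 in2)
  have ric: "ricci g dg ddg a a = (dchristoffel g dg ddg u u a a + dchristoffel g dg ddg v v a a)
     + (((\<Sum>\<rho>\<in>UNIV. \<Gamma> \<rho> \<rho> u) * \<Gamma> u a a + (\<Sum>\<rho>\<in>UNIV. \<Gamma> \<rho> \<rho> v) * \<Gamma> v a a)
     - (\<Gamma> u a a * \<Gamma> a u a + \<Gamma> v a a * \<Gamma> a v a + (\<Gamma> a a u * \<Gamma> u a a + \<Gamma> a a v * \<Gamma> v a a)))"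
    unfolding ricci_def T1[symmetric] T2[symmetric] T3[symmetric] sum.distrib sum_subtractf by simp

  have c: "\<Gamma> u a a = - (M u u * dg u $ a $ a + M u v * dg v $ a $ a) / 2"
    "\<Gamma> v a a = - (M u v * dg u $ a $ a + M v v * dg v $ a $ a) / 2"
    "\<Gamma> a u a = M a a * dg u $ a $ a / 2" "\<Gamma> a v a = M a a * dg v $ a $ a / 2"
    "\<Gamma> a a u = M a a * dg u $ a $ a / 2" "\<Gamma> a a v = M a a * dg v $ a $ a / 2"
    using a nz by (simp_all add: christoffel_block chr_C dC dCC Ms)
  have k: "dchristoffel g dg ddg u u a a = - (dinv_metric g dg u u u * dg u $ a $ a + M u u * ddg u u $ a $ a
       + dinv_metric g dg u u v * dg v $ a $ a + M u v * ddg u v $ a $ a) / 2"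
    "dchristoffel g dg ddg v v a a = - (dinv_metric g dg v v u * dg u $ a $ a + M u v * ddg u v $ a $ a
       + dinv_metric g dg v v v * dg v $ a $ a + M v v * ddg v v $ a $ a) / 2"
    using a nz by (simp_all add: dchristoffel_block dC dCC eC eCC Ms ec)
  show ?thesis unfolding ric k c
    apply (simp only: tr c christoffel_block dinv_I Ms ds insert_iff simp_thms)
    apply (simp add: field_simps power2_eq_square)
    done
qed

text \<open>The Ricci tensor of the block as a two-dimensional metric in its own right: the sums in
  \<open>ricci\<close> with all indices restricted to \<open>u\<close> and \<open>v\<close>.\<close>

private definition "ric2 i j =
   dchristoffel g dg ddg u u j i - dchristoffel g dg ddg j u u i
   + (\<Gamma> u u u * \<Gamma> u j i - \<Gamma> u j u * \<Gamma> u u i) + (\<Gamma> u u v * \<Gamma> v j i - \<Gamma> u j v * \<Gamma> v u i)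
   + (dchristoffel g dg ddg v v j i - dchristoffel g dg ddg j v v i
   + (\<Gamma> v v u * \<Gamma> u j i - \<Gamma> v j u * \<Gamma> u v i) + (\<Gamma> v v v * \<Gamma> v j i - \<Gamma> v j v * \<Gamma> v v i))"

text \<open>Each warp direction contributes minus the covariant Hessian of f divided by f, where f
  is the square root of the absolute value of its warp factor. Written in terms of the warp factor
  itself, this gives the coefficients 1/2 and 1/4.\<close>

private lemma ricci_I:
  assumes i: "i \<in> {u,v}" and j: "j \<in> {u,v}"
  shows "ricci g dg ddg i j = ric2 i j + (1/2) * (\<Sum>a\<in>-{u,v}. - (M a a * ddg j i $ a $ a)
     + (1/2) * (M a a * dg i $ a $ a) * (M a a * dg j $ a $ a))
     + (1/2) * (\<Gamma> u j i * (\<Sum>a\<in>-{u,v}. M a a * dg u $ a $ a))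
     + (1/2) * (\<Gamma> v j i * (\<Sum>a\<in>-{u,v}. M a a * dg v $ a $ a))"
proof -
  have A: "(\<Sum>\<tau>\<in>UNIV. \<Gamma> \<rho> \<rho> \<tau> * \<Gamma> \<tau> j i - \<Gamma> \<rho> j \<tau> * \<Gamma> \<tau> \<rho> i)
     = (\<Gamma> \<rho> \<rho> u * \<Gamma> u j i - \<Gamma> \<rho> j u * \<Gamma> u \<rho> i) + (\<Gamma> \<rho> \<rho> v * \<Gamma> v j i - \<Gamma> \<rho> j v * \<Gamma> v \<rho> i)" (is "?l = ?r")
    if "\<rho> \<in> {u,v}" for \<rho>
  proof -
    have "?l = ?r + (\<Sum>\<tau>\<in>-{u,v}. \<Gamma> \<rho> \<rho> \<tau> * \<Gamma> \<tau> j i - \<Gamma> \<rho> j \<tau> * \<Gamma> \<tau> \<rho> i)"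
      by (rule sum_split2[OF uv])
    also have "(\<Sum>\<tau>\<in>-{u,v}. \<Gamma> \<rho> \<rho> \<tau> * \<Gamma> \<tau> j i - \<Gamma> \<rho> j \<tau> * \<Gamma> \<tau> \<rho> i) = 0"
      by (rule sum.neutral) (use that i j in \<open>auto simp: chr_C dC dCC\<close>)
    finally show ?thesis by simp
  qed
  have B: "dchristoffel g dg ddg a a j i - dchristoffel g dg ddg j a a i
     + (\<Sum>\<tau>\<in>UNIV. \<Gamma> a a \<tau> * \<Gamma> \<tau> j i - \<Gamma> a j \<tau> * \<Gamma> \<tau> a i)
     = (1/2) * (- (M a a * ddg j i $ a $ a)
     + (1/2) * (M a a * dg i $ a $ a) * (M a a * dg j $ a $ a)
     + \<Gamma> u j i * (M a a * dg u $ a $ a) + \<Gamma> v j i * (M a a * dg v $ a $ a))"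
    if "a \<in> -{u,v}" for a
  proof -
    have a: "a \<notin> {u,v}" "a \<noteq> u" "a \<noteq> v" using that by auto
    let ?f = "\<lambda>\<tau>. \<Gamma> a a \<tau> * \<Gamma> \<tau> j i - \<Gamma> a j \<tau> * \<Gamma> \<tau> a i"
    have s: "sum ?f (-{u,v}) = ?f a"
      by (rule sum_C_single) (use that i j in \<open>auto simp: chr_C dC dCC\<close>)
    have ia: "i \<noteq> a" "j \<noteq> a" using i j a by auto
    have z: "\<Gamma> a i u = 0" "\<Gamma> a i v = 0" "\<Gamma> a j u = 0" "\<Gamma> a j v = 0" "\<Gamma> a j i = 0" "\<Gamma> a a a = 0"
      using a ia by (auto simp: chr_C dC dCC)
    have z2: "\<Gamma> a a u = (1/2) * (M a a * dg u $ a $ a)" "\<Gamma> a a v = (1/2) * (M a a * dg v $ a $ a)"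
      "\<Gamma> a a i = (1/2) * (M a a * dg i $ a $ a)"  "\<Gamma> a j a = (1/2) * (M a a * dg j $ a $ a)"
      using a ia by (auto simp: chr_C dC dCC)
    have z3: "dchristoffel g dg ddg a a j i = 0"
        "dchristoffel g dg ddg j a a i = (1/2) * (M a a * ddg j i $ a $ a - (M a a * dg i $ a $ a) * (M a a * dg j $ a $ a))"
      using a ia by (auto simp: dchr_C dC dCC eC eCC field_simps)
    have "(\<Sum>\<tau>\<in>UNIV. ?f \<tau>) = ?f u + ?f v + ?f a"
      unfolding s[symmetric] by (rule sum_split2[OF uv])
    then show ?thesis
      by (simp add: z z2 z3 field_simps)
  qed
  have S: "(\<Sum>\<rho>\<in>-{u,v}. dchristoffel g dg ddg \<rho> \<rho> j i - dchristoffel g dg ddg j \<rho> \<rho> i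
     + (\<Sum>\<tau>\<in>UNIV. \<Gamma> \<rho> \<rho> \<tau> * \<Gamma> \<tau> j i - \<Gamma> \<rho> j \<tau> * \<Gamma> \<tau> \<rho> i))
     = (1/2) * ((\<Sum>a\<in>-{u,v}. - (M a a * ddg j i $ a $ a)
     + (1/2) * (M a a * dg i $ a $ a) * (M a a * dg j $ a $ a))
     + \<Gamma> u j i * (\<Sum>a\<in>-{u,v}. M a a * dg u $ a $ a)
     + \<Gamma> v j i * (\<Sum>a\<in>-{u,v}. M a a * dg v $ a $ a))"
    unfolding sum_distrib_left sum.distrib[symmetric] by (rule sum.cong[OF refl B])
  show ?thesis
    unfolding ricci_def sum_split2[OF uv, where f = "\<lambda>\<rho>. dchristoffel g dg ddg \<rho> \<rho> j i - dchristoffel g dg ddg j \<rho> \<rho> i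
     + (\<Sum>\<tau>\<in>UNIV. \<Gamma> \<rho> \<rho> \<tau> * \<Gamma> \<tau> j i - \<Gamma> \<rho> j \<tau> * \<Gamma> \<tau> \<rho> i)"] S
    by (simp only: A insert_iff simp_thms ric2_def) (simp add: algebra_simps)
qed

text \<open>In two dimensions the curvature has one independent component. The large bracket is
  R_uvuv with the Christoffel symbols of the first kind written out, and the scalar curvature is
  twice that component times the determinant of the inverse metric.\<close>

private lemma ric2_trace:
  "M u u * ric2 u u + M u v * ric2 u v + M u v * ric2 v u + M v v * ric2 v v
   = 2 * (M u u * M v v - (M u v)\<^sup>2) * (ddg u v $ u $ v - ddg u u $ v $ v / 2 - ddg v v $ u $ u / 2
      + M u u * ((dg v $ u $ u)\<^sup>2 / 4 - dg u $ u $ u / 2 * (dg v $ u $ v - dg u $ v $ v / 2))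
      + M v v * ((dg u $ v $ v)\<^sup>2 / 4 - dg v $ v $ v / 2 * (dg u $ u $ v - dg v $ u $ u / 2))
      + M u v * (dg v $ u $ u * dg u $ v $ v / 2 - dg u $ u $ u * dg v $ v $ v / 4
          - (dg v $ u $ v - dg u $ v $ v / 2) * (dg u $ u $ v - dg v $ u $ u / 2)))"
  unfolding ric2_def
  apply (simp only: christoffel_block dchristoffel_block dinv_I Ms ds ec es insert_iff simp_thms)
  apply (simp add: field_simps power2_eq_square)
  done

private abbreviation "tp \<equiv> trace_part M g dg ddg u v"

text \<open>The Hessian terms occur twice, in the block components and in the warp components of the
  Ricci tensor. Adding them gives the coefficients of \<open>trace_part\<close>: 1/2 + 1/2 for the
  second derivatives and connection terms, 1/4 + 1/2 for the squares.\<close>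

private lemma sc1:
  "scalar_curvature g dg ddg =
     (M u u * ric2 u u + M u v * ric2 u v + M u v * ric2 v u + M v v * ric2 v v)
   + (M u u * tp u u + 2 * M u v * tp u v + M v v * tp v v)"
proof -
  have A: "(\<Sum>\<nu>\<in>UNIV. M i \<nu> * X \<nu>) = M i u * X u + M i v * X v" if "i \<in> {u,v}" for i X
    by (rule sumMI[OF that])
  have B: "(\<Sum>a\<in>-{u,v}. \<Sum>\<nu>\<in>UNIV. M a \<nu> * ricci g dg ddg a \<nu>) = (\<Sum>a\<in>-{u,v}. M a a * ricci g dg ddg a a)"
    by (rule sum.cong) (simp_all add: sumMC)
  have G: "\<Gamma> k v u = \<Gamma> k u v" if "k \<in> {u,v}" for k
    using that by (simp add: christoffel_block ds)
  define y where "y i a = M a a * dg i $ a $ a" for i a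
  define Z where "Z i j = (\<Sum>a\<in>-{u,v}. M a a * ddg i j $ a $ a)" for i j
  define W where "W i j = (\<Sum>a\<in>-{u,v}. y i a * y j a)" for i j
  define Y where "Y i = (\<Sum>a\<in>-{u,v}. y i a)" for i
  have Ws: "W v u = W u v" by (simp add: W_def mult.commute)
  have Zs: "Z v u = Z u v" by (simp add: Z_def ec)
  have T: "tp i j = - Z i j + (3/4) * W i j + \<Gamma> u i j * Y u + \<Gamma> v i j * Y v - (1/4) * Y i * Y j" for i j
    unfolding trace_part_def y_def[symmetric] Y_def Z_def W_def sum.distrib sum_negf sum_distrib_left[symmetric] ..
  have I: "ricci g dg ddg i j = ric2 i j + (1/2) * (- Z j i + (1/2) * W i j)
      + (1/2) * (\<Gamma> u j i * Y u) + (1/2) * (\<Gamma> v j i * Y v)" if "i \<in> {u,v}" "j \<in> {u,v}" for i j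
    unfolding ricci_I[OF that] Z_def W_def Y_def y_def
    by (simp add: sum.distrib sum_negf sum_subtractf sum_distrib_left mult.assoc)
  have C: "M a a * ricci g dg ddg a a = (1/2) * (
      M u u * (- (M a a * ddg u u $ a $ a) + y u a * y u a)
      + 2 * M u v * (- (M a a * ddg u v $ a $ a) + y u a * y v a)
      + M v v * (- (M a a * ddg v v $ a $ a) + y v a * y v a)
      + y u a * (M u u * \<Gamma> u u u + 2 * M u v * \<Gamma> u u v + M v v * \<Gamma> u v v)
      + y v a * (M u u * \<Gamma> v u u + 2 * M u v * \<Gamma> v u v + M v v * \<Gamma> v v v))
    - (1/4) * (M u u * (y u a * Y u) + M u v * (y u a * Y v)
      + M u v * (y v a * Y u) + M v v * (y v a * Y v))" if "a \<in> -{u,v}" for a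
    using that by (subst ricci_a) (simp_all add: y_def Y_def power2_eq_square algebra_simps)
  have D: "(\<Sum>a\<in>-{u,v}. M a a * ricci g dg ddg a a) = (1/2) * (
      M u u * (- Z u u + W u u)
      + 2 * M u v * (- Z u v + W u v)
      + M v v * (- Z v v + W v v)
      + Y u * (M u u * \<Gamma> u u u + 2 * M u v * \<Gamma> u u v + M v v * \<Gamma> u v v)
      + Y v * (M u u * \<Gamma> v u u + 2 * M u v * \<Gamma> v u v + M v v * \<Gamma> v v v))
    - (1/4) * (M u u * (Y u * Y u) + M u v * (Y u * Y v)
      + M u v * (Y v * Y u) + M v v * (Y v * Y v))"
    by (simp add: C sum.distrib sum_subtractf sum_negf sum_distrib_left[symmetric] sum_distrib_right[symmetric]
        sum_divide_distrib[symmetric] Z_def[symmetric] W_def[symmetric] Y_def[symmetric])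
  show ?thesis
    unfolding scalar_curvature_def M
    by (subst sum_split2[OF uv]) (simp add: A B D T I G Ws Zs Ms field_simps)
qed

lemma scalar_curvature_block:
  "scalar_curvature g dg ddg = 2 * (M u u * M v v - (M u v)\<^sup>2) * (ddg u v $ u $ v - ddg u u $ v $ v / 2 - ddg v v $ u $ u / 2
      + M u u * ((dg v $ u $ u)\<^sup>2 / 4 - dg u $ u $ u / 2 * (dg v $ u $ v - dg u $ v $ v / 2))
      + M v v * ((dg u $ v $ v)\<^sup>2 / 4 - dg v $ v $ v / 2 * (dg u $ u $ v - dg v $ u $ u / 2))
      + M u v * (dg v $ u $ u * dg u $ v $ v / 2 - dg u $ u $ u * dg v $ v $ v / 4
          - (dg v $ u $ v - dg u $ v $ v / 2) * (dg u $ u $ v - dg v $ u $ u / 2)))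
     + (M u u * tp u u + 2 * M u v * tp u v + M v v * tp v v)"
  unfolding sc1 ric2_trace ..

end

subsection \<open>Fields that depend on two coordinates only\<close>

lemma zcoord_shift:
  "zcoord (x + t *\<^sub>R axis 1 1) = zcoord x + of_real t"
  "zcoord (x + t *\<^sub>R axis 2 1) = zcoord x + of_real t * \<i>"
  "\<mu> \<notin> {1,2} \<Longrightarrow> zcoord (x + t *\<^sub>R axis \<mu> 1) = zcoord x"
  by (auto simp: zcoord_def complex_eq_iff axis_def)

text \<open>Required on the whole space, not just on \<open>D\<close>: it then passes to
  \<open>pdrv \<mu> f\<close> without any differentiability, because both sides are the same
  \<open>vector_derivative\<close> of the same function.\<close>

definition zdep :: "(point \<Rightarrow> 'a) \<Rightarrow> bool" where
  "zdep f \<longleftrightarrow> (\<forall>x y. zcoord x = zcoord y \<longrightarrow> f x = f y)"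

lemma zcoord_shift_cong:
  "zcoord x = zcoord y \<Longrightarrow> zcoord (x + t *\<^sub>R axis \<mu> 1) = zcoord (y + t *\<^sub>R axis \<mu> 1)"
  by (simp add: zcoord_def complex_eq_iff)

lemma zdep_pdrv: "zdep f \<Longrightarrow> zdep (pdrv \<mu> f)"
  unfolding zdep_def pdrv_def
proof (intro allI impI)
  fix x y assume z: "\<forall>x y. zcoord x = zcoord y \<longrightarrow> f x = f y" "zcoord x = zcoord y"
  have "f (x + t *\<^sub>R axis \<mu> 1) = f (y + t *\<^sub>R axis \<mu> 1)" for t
    using z(1) zcoord_shift_cong[OF z(2)] by blast
  then show "vector_derivative (\<lambda>t. f (x + t *\<^sub>R axis \<mu> 1)) (at 0)
    = vector_derivative (\<lambda>t. f (y + t *\<^sub>R axis \<mu> 1)) (at 0)" by simp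
qed

lemma pdrv_zdep_0:
  assumes "zdep f" "\<mu> \<notin> {1,2}"
  shows "pdrv \<mu> f x = 0"
proof -
  have "(\<lambda>t. f (x + t *\<^sub>R axis \<mu> 1)) = (\<lambda>t. f x)"
    using assms(1) zcoord_shift(3)[OF assms(2)] unfolding zdep_def by (intro ext) blast
  then show ?thesis unfolding pdrv_def by simp
qed

text \<open>A relational form of \<open>pdrv\<close> that also records existence of the derivative.
  Only the values of \<open>f'\<close> on \<open>D\<close> matter, so by openness a field may be
  replaced by an explicit formula valid on \<open>D\<close>.\<close>

definition pd :: "point set \<Rightarrow> 11 \<Rightarrow> (point \<Rightarrow> 'v::real_normed_vector) \<Rightarrow> (point \<Rightarrow> 'v) \<Rightarrow> bool" where
  "pd D \<mu> f f' \<longleftrightarrow> (\<forall>x\<in>D. ((\<lambda>t. f (x + t *\<^sub>R axis \<mu> 1)) has_vector_derivative f' x) (at 0))"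

lemma pdrv_pd: "pd D \<mu> f f' \<Longrightarrow> x \<in> D \<Longrightarrow> pdrv \<mu> f x = f' x"
  unfolding pd_def pdrv_def by (simp add: vector_derivative_at)

lemma eventually_shift:
  fixes D :: "point set"
  assumes "open D" "x \<in> D"
  shows "eventually (\<lambda>t::real. x + t *\<^sub>R axis \<mu> 1 \<in> D) (nhds 0)"
proof -
  have "((\<lambda>t::real. x + t *\<^sub>R axis \<mu> 1) \<longlongrightarrow> x + 0 *\<^sub>R axis \<mu> 1) (at 0)"
    by (rule tendsto_add[OF tendsto_const tendsto_scaleR[OF tendsto_ident_at tendsto_const]])
  then have "eventually (\<lambda>t::real. x + t *\<^sub>R axis \<mu> 1 \<in> D) (at 0)"
    using assms topological_tendstoD by fastforce
  then show ?thesis using assms by (simp add: eventually_nhds_conv_at)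
qed

lemma pd_cong:
  assumes "open D" "pd D \<mu> g g'" "\<And>y. y \<in> D \<Longrightarrow> f y = g y" "\<And>y. y \<in> D \<Longrightarrow> f' y = g' y"
  shows "pd D \<mu> f f'"
  unfolding pd_def
proof
  fix x assume x: "x \<in> D"
  have "((\<lambda>t. g (x + t *\<^sub>R axis \<mu> 1)) has_vector_derivative g' x) (at 0)"
    using assms x by (auto simp: pd_def)
  moreover obtain d where d: "d > 0" "\<And>t::real. dist t 0 < d \<Longrightarrow> x + t *\<^sub>R axis \<mu> 1 \<in> D"
    using eventually_shift[OF assms(1) x, of \<mu>] unfolding eventually_nhds_metric by blast
  ultimately have "((\<lambda>t. f (x + t *\<^sub>R axis \<mu> 1)) has_vector_derivative g' x) (at 0)"
    using has_vector_derivative_transform_within[OF _ d(1), of "\<lambda>t. g (x + t *\<^sub>R axis \<mu> 1)" "g' x" 0 UNIV "\<lambda>t. f (x + t *\<^sub>R axis \<mu> 1)"]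
      assms(3) by simp
  then show "((\<lambda>t. f (x + t *\<^sub>R axis \<mu> 1)) has_vector_derivative f' x) (at 0)"
    by (simp add: assms(4) x)
qed

lemma pdrv_eq:
  assumes "open D" "pd D \<mu> g g'" "\<And>y. y \<in> D \<Longrightarrow> f y = g y" "x \<in> D"
  shows "pdrv \<mu> f x = g' x"
  using pdrv_pd[OF pd_cong[OF assms(1,2,3)]] assms by blast

lemma pdrv_pdrv_eq:
  assumes "open D" "pd D \<nu> g g'" "pd D \<mu> g' g''" "\<And>y. y \<in> D \<Longrightarrow> f y = g y" "x \<in> D"
  shows "pdrv \<mu> (pdrv \<nu> f) x = g'' x"
  using pdrv_eq[OF assms(1) assms(3), of "pdrv \<nu> f"] pdrv_eq[OF assms(1,2)] assms by blast

lemma sum_11_12: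
  fixes f :: "11 \<Rightarrow> real"
  assumes "\<And>\<mu>. \<mu> \<notin> {1,2} \<Longrightarrow> f \<mu> = 0"
  shows "sum f UNIV = f 1 + f 2"
proof -
  have "sum f UNIV = sum f {1,2}"
    by (rule sum.mono_neutral_right) (use assms in auto)
  then show ?thesis by simp
qed

text \<open>The partial derivatives of the Lagrangian along the jet are again functions of z alone.
  Those carrying an index outside {1,2} need not be computed: they may be nonzero, but the
  derivative that \<open>euler\<close> applies to them vanishes.\<close>

lemma euler_eval:
  fixes \<phi> :: "point \<Rightarrow> 'v::real_normed_vector"
  assumes D: "open D" "x \<in> D" and z: "zdep \<phi>"
    and J1: "\<And>y \<alpha>. y \<in> D \<Longrightarrow> pdrv \<alpha> \<phi> y = J1 y \<alpha>"
    and J2: "\<And>y \<alpha> \<beta>. y \<in> D \<Longrightarrow> pdrv \<alpha> (pdrv \<beta> \<phi>) y = J2 y \<alpha> \<beta>"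
    and P0: "deriv (\<lambda>s. L (\<phi> x + s *\<^sub>R w) (J1 x) (J2 x)) 0 = P0"
    and P1: "\<And>y \<mu>. y \<in> D \<Longrightarrow> \<mu> \<in> {1,2} \<Longrightarrow>
        deriv (\<lambda>s. L (\<phi> y) (\<lambda>\<alpha>. J1 y \<alpha> + (if \<alpha> = \<mu> then s else 0) *\<^sub>R w) (J2 y)) 0 = P1 \<mu> y"
    and P2: "\<And>y \<mu> \<nu>. y \<in> D \<Longrightarrow> \<mu> \<in> {1,2} \<Longrightarrow> \<nu> \<in> {1,2} \<Longrightarrow>
        deriv (\<lambda>s. L (\<phi> y) (J1 y) (\<lambda>\<alpha> \<beta>. J2 y \<alpha> \<beta>
               + ((if \<alpha> = \<mu> \<and> \<beta> = \<nu> then s / 2 else 0)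
                  + (if \<alpha> = \<nu> \<and> \<beta> = \<mu> then s / 2 else 0)) *\<^sub>R w)) 0 = P2 \<mu> \<nu> y"
    and dP1: "\<And>\<mu>. \<mu> \<in> {1,2} \<Longrightarrow> pd D \<mu> (P1 \<mu>) (Q1 \<mu>)"
    and dP2: "\<And>\<mu> \<nu>. \<mu> \<in> {1,2} \<Longrightarrow> \<nu> \<in> {1,2} \<Longrightarrow> pd D \<nu> (P2 \<mu> \<nu>) (Q2 \<mu> \<nu>)"
    and ddP2: "\<And>\<mu> \<nu>. \<mu> \<in> {1,2} \<Longrightarrow> \<nu> \<in> {1,2} \<Longrightarrow> pd D \<mu> (Q2 \<mu> \<nu>) (R2 \<mu> \<nu>)"
  shows "euler L \<phi> w x = P0 - (Q1 1 x + Q1 2 x) + (R2 1 1 x + R2 1 2 x + (R2 2 1 x + R2 2 2 x))"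
proof -
  define d1 where "d1 = (\<lambda>y \<alpha>. pdrv \<alpha> \<phi> y)"
  define d2 where "d2 = (\<lambda>y \<alpha> \<beta>. pdrv \<alpha> (pdrv \<beta> \<phi>) y)"
  have zc: "d1 y = d1 y'" "d2 y = d2 y'" "\<phi> y = \<phi> y'" if "zcoord y = zcoord y'" for y y'
    using that z zdep_pdrv[OF z] zdep_pdrv[OF zdep_pdrv[OF z]]
    unfolding d1_def d2_def zdep_def by blast+
  have d1: "d1 y = J1 y" and d2: "d2 y = J2 y" if "y \<in> D" for y
    using J1 J2 that by (auto simp: d1_def d2_def fun_eq_iff)
  define p1 where "p1 \<mu> y = deriv (\<lambda>s. L (\<phi> y) (\<lambda>\<alpha>. d1 y \<alpha> + (if \<alpha> = \<mu> then s else 0) *\<^sub>R w) (d2 y)) 0" for \<mu> y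
  define p2 where "p2 \<mu> \<nu> y = deriv (\<lambda>s. L (\<phi> y) (d1 y) (\<lambda>\<alpha> \<beta>. d2 y \<alpha> \<beta>
               + ((if \<alpha> = \<mu> \<and> \<beta> = \<nu> then s / 2 else 0)
                  + (if \<alpha> = \<nu> \<and> \<beta> = \<mu> then s / 2 else 0)) *\<^sub>R w)) 0" for \<mu> \<nu> y
  have z1: "zdep (p1 \<mu>)" for \<mu>
    unfolding zdep_def p1_def
  proof (intro allI impI)
    fix y y' :: point assume "zcoord y = zcoord y'"
    note e = zc[OF this]
    show "deriv (\<lambda>s. L (\<phi> y) (\<lambda>\<alpha>. d1 y \<alpha> + (if \<alpha> = \<mu> then s else 0) *\<^sub>R w) (d2 y)) 0
      = deriv (\<lambda>s. L (\<phi> y') (\<lambda>\<alpha>. d1 y' \<alpha> + (if \<alpha> = \<mu> then s else 0) *\<^sub>R w) (d2 y')) 0"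
      unfolding e ..
  qed
  have z2: "zdep (p2 \<mu> \<nu>)" for \<mu> \<nu>
    unfolding zdep_def p2_def
  proof (intro allI impI)
    fix y y' :: point assume "zcoord y = zcoord y'"
    note e = zc[OF this]
    show "deriv (\<lambda>s. L (\<phi> y) (d1 y) (\<lambda>\<alpha> \<beta>. d2 y \<alpha> \<beta>
               + ((if \<alpha> = \<mu> \<and> \<beta> = \<nu> then s / 2 else 0)
                  + (if \<alpha> = \<nu> \<and> \<beta> = \<mu> then s / 2 else 0)) *\<^sub>R w)) 0
      = deriv (\<lambda>s. L (\<phi> y') (d1 y') (\<lambda>\<alpha> \<beta>. d2 y' \<alpha> \<beta>
               + ((if \<alpha> = \<mu> \<and> \<beta> = \<nu> then s / 2 else 0)
                  + (if \<alpha> = \<nu> \<and> \<beta> = \<mu> then s / 2 else 0)) *\<^sub>R w)) 0"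
      unfolding e ..
  qed
  have s1: "(\<Sum>\<mu>\<in>UNIV. pdrv \<mu> (p1 \<mu>) x) = Q1 1 x + Q1 2 x"
  proof (subst sum_11_12)
    have "pdrv \<mu> (p1 \<mu>) x = Q1 \<mu> x" if "\<mu> \<in> {1,2}" for \<mu>
      by (rule pdrv_eq[OF D(1) dP1 _ D(2)]) (use that P1 in \<open>auto simp: p1_def d1 d2\<close>)
    then show "pdrv 1 (p1 1) x + pdrv 2 (p1 2) x = Q1 1 x + Q1 2 x" by simp
  qed (simp add: pdrv_zdep_0 z1)
  \<comment> \<open>If the inner index is bad, the inner derivative is the zero function on the
    whole space; if the outer one is bad, \<open>zdep\<close> of the inner derivative
    suffices.\<close>
  have q0: "pdrv \<mu> (pdrv \<nu> (p2 \<mu> \<nu>)) x = 0" if "\<mu> \<notin> {1,2} \<or> \<nu> \<notin> {1,2}" for \<mu> \<nu>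
  proof (cases "\<nu> \<in> {1,2}")
    case True
    then show ?thesis using that by (intro pdrv_zdep_0 zdep_pdrv z2) auto
  next
    case False
    then have "pdrv \<nu> (p2 \<mu> \<nu>) = (\<lambda>_. 0)" by (simp add: pdrv_zdep_0 z2 fun_eq_iff)
    then show ?thesis by (simp add: pdrv_def)
  qed
  have q: "pdrv \<mu> (pdrv \<nu> (p2 \<mu> \<nu>)) x = R2 \<mu> \<nu> x" if "\<mu> \<in> {1,2}" "\<nu> \<in> {1,2}" for \<mu> \<nu>
    by (rule pdrv_pdrv_eq[OF D(1) dP2 ddP2 _ D(2)]) (use that P2 in \<open>auto simp: p2_def d1 d2\<close>)
  have s2: "(\<Sum>\<mu>\<in>UNIV. \<Sum>\<nu>\<in>UNIV. pdrv \<mu> (pdrv \<nu> (p2 \<mu> \<nu>)) x) = R2 1 1 x + R2 1 2 x + (R2 2 1 x + R2 2 2 x)"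
    by (subst sum_11_12, simp add: q0, subst (1 2) sum_11_12) (simp_all add: q q0)
  have e: "euler L \<phi> w x = deriv (\<lambda>s. L (\<phi> x + s *\<^sub>R w) (d1 x) (d2 x)) 0
      - (\<Sum>\<mu>\<in>UNIV. pdrv \<mu> (p1 \<mu>) x) + (\<Sum>\<mu>\<in>UNIV. \<Sum>\<nu>\<in>UNIV. pdrv \<mu> (pdrv \<nu> (p2 \<mu> \<nu>)) x)"
    unfolding euler_def Let_def p1_def p2_def d1_def d2_def ..
  show ?thesis
    unfolding e s1 s2 d1[OF D(2)] d2[OF D(2)] P0 ..
qed

subsection \<open>Reflections\<close>

text \<open>\<open>deriv\<close> is defined by choice, so evenness says nothing about it until the
  derivative is known to exist; hence the first assumption.\<close>

lemma deriv_even_0: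
  fixes f :: "real \<Rightarrow> real"
  assumes "f differentiable (at 0)" "eventually (\<lambda>s. f (- s) = f s) (nhds 0)"
  shows "deriv f 0 = 0"
proof -
  obtain d where d: "DERIV f 0 :> d" using assms(1) by (auto simp: real_differentiable_def)
  have "((\<lambda>s::real. - s) has_real_derivative -1) (at 0)" by (auto intro!: derivative_eq_intros)
  then have "DERIV (\<lambda>s. f (- s)) 0 :> - d"
    using DERIV_chain2[of f d "\<lambda>s. - s" 0 "-1" UNIV] d
    by simp
  then have "DERIV f 0 :> - d"
    using assms(2) by (simp add: DERIV_cong_ev)
  then have "d = - d" using d DERIV_unique by blast
  then show ?thesis using DERIV_imp_deriv[OF d] by simp
qed

lemma matrix_inv_unique:
  fixes A B :: "real^'n^'n"
  assumes "A ** B = mat 1"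
  shows "matrix_inv A = B"
proof -
  have BA: "B ** A = mat 1" using assms matrix_left_right_inverse by blast
  have "A ** matrix_inv A = mat 1 \<and> matrix_inv A ** A = mat 1"
    unfolding matrix_inv_def by (rule someI) (use assms BA in blast)
  then show ?thesis by (metis BA matrix_mul_assoc matrix_mul_lid matrix_mul_rid)
qed

lemma differentiable_scalar_curvature:
  fixes g :: "real \<Rightarrow> real^'i^'i" and dg :: "real \<Rightarrow> 'i::finite metric1" and ddg :: "real \<Rightarrow> 'i metric2"
  assumes M: "\<And>a b. (\<lambda>s. matrix_inv (g s) $ a $ b) differentiable (at 0)"
    and d: "\<And>\<alpha> a b. (\<lambda>s. dg s \<alpha> $ a $ b) differentiable (at 0)"
    and e: "\<And>\<alpha> \<beta> a b. (\<lambda>s. ddg s \<alpha> \<beta> $ a $ b) differentiable (at 0)"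
  shows "(\<lambda>s. scalar_curvature (g s) (dg s) (ddg s)) differentiable (at 0)"
  unfolding scalar_curvature_def ricci_def christoffel_def dchristoffel_def dinv_metric_def
  by (intro differentiable_sum differentiable_mult differentiable_add differentiable_diff
      differentiable_minus differentiable_const M d e ballI finite)

lemma differentiable_field_strength_sq:
  fixes g :: "real \<Rightarrow> real^'i^'i" and dA :: "real \<Rightarrow> 'i::finite \<Rightarrow> real^'i^'i^'i"
  assumes M: "\<And>a b. (\<lambda>s. matrix_inv (g s) $ a $ b) differentiable (at 0)"
    and d: "\<And>\<alpha> a b c. (\<lambda>s. dA s \<alpha> $ a $ b $ c) differentiable (at 0)"
  shows "(\<lambda>s. field_strength_sq (g s) (dA s)) differentiable (at 0)"
  unfolding field_strength_sq_def field_strength_def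
  by (intro differentiable_sum differentiable_mult differentiable_add differentiable_diff
      differentiable_minus differentiable_const M d ballI finite)

text \<open>The signs \<open>e a\<close> are the diagonal of the Jacobian of a reflection of some of
  the coordinates.\<close>

context
  fixes e :: "'i::finite \<Rightarrow> real"
  assumes e: "\<And>a. e a * e a = 1"
begin

private lemma ee: "e a * (e a * x) = x"
  using e[of a] by (simp add: mult.assoc[symmetric])

text \<open>Every summed index occurs in two factors, so its sign squares away. Each tensor keeps
  only the signs of its free indices, and a scalar has none.\<close>

lemma scalar_curvature_reflect:
  fixes g g' :: "real^'i^'i" and dg dg' :: "'i::finite metric1" and ddg ddg' :: "'i metric2"
  assumes M: "\<And>a b. matrix_inv g' $ a $ b = e a * e b * matrix_inv g $ a $ b"
    and d: "\<And>\<alpha> a b. dg' \<alpha> $ a $ b = e \<alpha> * e a * e b * dg \<alpha> $ a $ b"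
    and dd: "\<And>\<alpha> \<beta> a b. ddg' \<alpha> \<beta> $ a $ b = e \<alpha> * e \<beta> * e a * e b * ddg \<alpha> \<beta> $ a $ b"
  shows "scalar_curvature g' dg' ddg' = scalar_curvature g dg ddg"
proof -
  have c: "christoffel g' dg' \<rho> \<nu> \<sigma> = e \<rho> * e \<nu> * e \<sigma> * christoffel g dg \<rho> \<nu> \<sigma>" for \<rho> \<nu> \<sigma>
    unfolding christoffel_def M d sum_distrib_left
    by (rule sum.cong[OF refl]) (simp add: algebra_simps ee)
  have i: "dinv_metric g' dg' \<mu> \<rho> \<tau> = e \<mu> * e \<rho> * e \<tau> * dinv_metric g dg \<mu> \<rho> \<tau>" for \<mu> \<rho> \<tau>
    unfolding dinv_metric_def M d sum_distrib_left sum_negf[symmetric]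
    by (intro sum.cong[OF refl]) (simp add: algebra_simps ee)
  have dc: "dchristoffel g' dg' ddg' \<mu> \<rho> \<nu> \<sigma> = e \<mu> * e \<rho> * e \<nu> * e \<sigma> * dchristoffel g dg ddg \<mu> \<rho> \<nu> \<sigma>" for \<mu> \<rho> \<nu> \<sigma>
    unfolding dchristoffel_def i M d dd sum_distrib_left
    by (intro sum.cong[OF refl]) (simp add: algebra_simps ee)
  have r: "ricci g' dg' ddg' \<sigma> \<nu> = e \<sigma> * e \<nu> * ricci g dg ddg \<sigma> \<nu>" for \<sigma> \<nu>
  proof -
    have "(\<Sum>\<tau>\<in>UNIV. christoffel g' dg' \<rho> \<rho> \<tau> * christoffel g' dg' \<tau> \<nu> \<sigma>
                  - christoffel g' dg' \<rho> \<nu> \<tau> * christoffel g' dg' \<tau> \<rho> \<sigma>) = e \<sigma> * e \<nu> *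
          (\<Sum>\<tau>\<in>UNIV. christoffel g dg \<rho> \<rho> \<tau> * christoffel g dg \<tau> \<nu> \<sigma>
                  - christoffel g dg \<rho> \<nu> \<tau> * christoffel g dg \<tau> \<rho> \<sigma>)" for \<rho>
      unfolding sum_distrib_left c by (intro sum.cong[OF refl]) (simp add: algebra_simps ee)
    then show ?thesis
      unfolding ricci_def dc
      by (simp add: sum_distrib_left) (intro sum.cong[OF refl], simp add: algebra_simps ee sum_distrib_left)
  qed
  show ?thesis unfolding scalar_curvature_def r M
    by (intro sum.cong[OF refl]) (simp add: algebra_simps ee)
qed

text \<open>The extra sign \<open>\<zeta>\<close> lets the 3-form be flipped together with the
  reflection, which is harmless since F enters quadratically.\<close>

lemma field_strength_sq_reflect:
  fixes g g' :: "real^'i^'i" and dA dA' :: "'i \<Rightarrow> real^'i^'i^'i"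
  assumes M: "\<And>a b. matrix_inv g' $ a $ b = e a * e b * matrix_inv g $ a $ b"
    and d: "\<And>\<alpha> a b c. dA' \<alpha> $ a $ b $ c = \<zeta> * (e \<alpha> * e a * e b * e c * dA \<alpha> $ a $ b $ c)"
    and c: "\<zeta> * \<zeta> = 1"
  shows "field_strength_sq g' dA' = field_strength_sq g dA"
proof -
  have F: "field_strength dA' \<mu> \<nu> \<rho> \<sigma> = \<zeta> * (e \<mu> * e \<nu> * e \<rho> * e \<sigma> * field_strength dA \<mu> \<nu> \<rho> \<sigma>)" for \<mu> \<nu> \<rho> \<sigma>
    unfolding field_strength_def d by (simp add: algebra_simps)
  have cc: "\<zeta> * (\<zeta> * x) = x" for x using c by (simp add: mult.assoc[symmetric])
  show ?thesis
    unfolding field_strength_sq_def F M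
    by (intro sum.cong[OF refl]) (simp add: ac_simps ee cc)
qed

lemma form3_reflect: "e a * e b * e c * form3 \<mu> \<nu> \<rho> $ a $ b $ c = e \<mu> * e \<nu> * e \<rho> * form3 \<mu> \<nu> \<rho> $ a $ b $ c"
  unfolding form3_def Let_def by (simp add: algebra_simps)

end

subsection \<open>Curvature and field strength of a diagonal metric with one off-diagonal pair\<close>

text \<open>One shape for two purposes: a diagonal metric varied along an arbitrary off-diagonal
  pair, and a general metric in the block of coordinates 1 and 2.\<close>

definition pairmat :: "'i::finite \<Rightarrow> 'i \<Rightarrow> real \<Rightarrow> ('i \<Rightarrow> real) \<Rightarrow> real^'i^'i" where
  "pairmat \<mu> \<nu> q G = (\<chi> a b. if {a,b} = {\<mu>,\<nu>} then q else if a = b then G a else 0)"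

lemma matrix_inv_pairmat:
  assumes n: "\<mu> \<noteq> \<nu>" and G: "\<And>a. G a \<noteq> 0" and D: "G \<mu> * G \<nu> - q^2 \<noteq> 0"
  shows "matrix_inv (pairmat \<mu> \<nu> q G) = pairmat \<mu> \<nu> (- q / (G \<mu> * G \<nu> - q^2))
     (\<lambda>a. if a = \<mu> then G \<nu> / (G \<mu> * G \<nu> - q^2) else if a = \<nu> then G \<mu> / (G \<mu> * G \<nu> - q^2) else 1 / G a)"
    (is "_ = ?B")
proof (rule matrix_inv_unique)
  define E where "E = G \<mu> * G \<nu> - q^2"
  have E: "E \<noteq> 0" using D by (simp add: E_def)
  have "(\<Sum>k\<in>UNIV. pairmat \<mu> \<nu> q G $ i $ k * ?B $ k $ j) = (if i = j then 1 else 0)" for i j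
  proof -
    have z: "pairmat \<mu> \<nu> q G $ i $ k = 0" if "k \<noteq> i" "{i,k} \<noteq> {\<mu>,\<nu>}" for k
      using that by (simp add: pairmat_def)
    show ?thesis
    proof (cases "i \<in> {\<mu>,\<nu>}")
      case True
      have "(\<Sum>k\<in>UNIV. pairmat \<mu> \<nu> q G $ i $ k * ?B $ k $ j) = (\<Sum>k\<in>{\<mu>,\<nu>}. pairmat \<mu> \<nu> q G $ i $ k * ?B $ k $ j)"
        by (rule sum.mono_neutral_right) (use True z n in \<open>auto simp: doubleton_eq_iff\<close>)
      also have "\<dots> = (if i = j then 1 else 0)"
        unfolding E_def[symmetric] using True n E
        by (auto simp: pairmat_def doubleton_eq_iff) (auto simp: field_simps, simp_all add: E_def power2_eq_square algebra_simps)
      finally show ?thesis .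
    next
      case False
      have "(\<Sum>k\<in>UNIV. pairmat \<mu> \<nu> q G $ i $ k * ?B $ k $ j) = (\<Sum>k\<in>{i}. pairmat \<mu> \<nu> q G $ i $ k * ?B $ k $ j)"
        by (rule sum.mono_neutral_right) (use False z in \<open>auto simp: doubleton_eq_iff\<close>)
      then show ?thesis using False G n by (auto simp: pairmat_def doubleton_eq_iff)
    qed
  qed
  then show "pairmat \<mu> \<nu> q G ** ?B = mat 1"
    unfolding matrix_matrix_mult_def mat_def by (simp add: vec_eq_iff)
qed

text \<open>Symmetric elimination: adding \<open>k\<close> times row \<nu> to row \<mu>, and then
  the same for columns by way of the transpose, removes both entries \<open>q\<close> and leaves a
  diagonal matrix.\<close>

lemma det_pairmat:
  assumes n: "\<mu> \<noteq> \<nu>" and G: "G \<nu> \<noteq> 0"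
  shows "det (pairmat \<mu> \<nu> q G) = (G \<mu> * G \<nu> - q^2) * (\<Prod>a\<in>-{\<mu>,\<nu>}. G a)"
proof -
  define k where "k = - q / G \<nu>"
  let ?A = "pairmat \<mu> \<nu> q G"
  let ?B = "\<chi> i. if i = \<mu> then row \<mu> ?A + k *s row \<nu> ?A else row i ?A"
  let ?B' = "transpose ?B"
  let ?C = "\<chi> i. if i = \<mu> then row \<mu> ?B' + k *s row \<nu> ?B' else row i ?B'"
  have 1: "det ?A = det ?B" by (rule det_row_operation[symmetric, OF n])
  define Cm where "Cm = ?C"
  have 2: "det ?B' = det Cm" unfolding Cm_def by (rule det_row_operation[symmetric, OF n])
  have C: "Cm $ i $ j = (if i = j then if i = \<mu> then G \<mu> - q^2 / G \<nu> else G i else 0)" for i j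
    unfolding Cm_def using n G by (auto simp: row_def transpose_def pairmat_def k_def doubleton_eq_iff power2_eq_square field_simps)
  have "det ?A = (\<Prod>i\<in>UNIV. if i = \<mu> then G \<mu> - q^2 / G \<nu> else G i)"
    unfolding 1 det_transpose[of ?B, symmetric] 2 by (subst det_diagonal) (simp_all add: C)
  also have "\<dots> = (\<Prod>i\<in>{\<mu>,\<nu>}. if i = \<mu> then G \<mu> - q^2 / G \<nu> else G i) * (\<Prod>i\<in>-{\<mu>,\<nu>}. if i = \<mu> then G \<mu> - q^2 / G \<nu> else G i)"
    by (subst prod.union_disjoint[symmetric]) (auto intro!: prod.cong)
  also have "(\<Prod>i\<in>-{\<mu>,\<nu>}. if i = \<mu> then G \<mu> - q^2 / G \<nu> else G i) = (\<Prod>i\<in>-{\<mu>,\<nu>}. G i)"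
    by (rule prod.cong) auto
  finally have "det ?A = ((G \<mu> - q^2 / G \<nu>) * G \<nu>) * (\<Prod>i\<in>-{\<mu>,\<nu>}. G i)" using n by simp
  also have "(G \<mu> - q^2 / G \<nu>) * G \<nu> = G \<mu> * G \<nu> - q^2" using G by (simp add: field_simps)
  finally show ?thesis .
qed

lemma sum_form3:
  fixes f :: "'i::finite \<Rightarrow> 'i \<Rightarrow> 'i \<Rightarrow> real"
  shows "(\<Sum>a\<in>UNIV. \<Sum>b\<in>UNIV. \<Sum>c\<in>UNIV. form3 p q r $ a $ b $ c * f a b c) =
    f p q r - f p r q + f q r p - f q p r + f r p q - f r q p"
proof -
  have 1: "(\<Sum>a\<in>UNIV. \<Sum>b\<in>UNIV. \<Sum>c\<in>UNIV. (if a = x then if b = y then if c = z then f a b c else 0 else 0 else 0)) = f x y z"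
    for x y z :: 'i
  proof -
    have c: "(\<Sum>c\<in>UNIV. (if a = x then if b = y then if c = z then f a b c else 0 else 0 else 0))
        = (if a = x then if b = y then f a b z else 0 else 0)" for a b by auto
    have b: "(\<Sum>b\<in>UNIV. (if a = x then if b = y then f a b z else 0 else 0)) = (if a = x then f a y z else 0)" for a
      by auto
    show ?thesis unfolding c b by simp
  qed
  have 2: "form3 p q r $ a $ b $ c * f a b c =
      (if a = p then if b = q then if c = r then f a b c else 0 else 0 else 0)
    - (if a = p then if b = r then if c = q then f a b c else 0 else 0 else 0)
    + (if a = q then if b = r then if c = p then f a b c else 0 else 0 else 0)
    - (if a = q then if b = p then if c = r then f a b c else 0 else 0 else 0)
    + (if a = r then if b = p then if c = q then f a b c else 0 else 0 else 0)
    - (if a = r then if b = q then if c = p then f a b c else 0 else 0 else 0)" for a b c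
    unfolding form3_def Let_def by (auto simp: algebra_simps)
  show ?thesis unfolding 2 sum.distrib sum_subtractf 1 ..
qed

lemma form3_nonzero: "form3 p q r $ a $ b $ c \<noteq> 0 \<Longrightarrow> {p,q,r} = {a,b,c}"
  unfolding form3_def Let_def by (auto split: if_splits)

text \<open>Here F is the wedge of the covector \<open>v\<close> with a decomposable 3-form whose
  three directions are neither in the support of \<open>v\<close> nor coupled to others by the
  inverse metric. The factor 24 is 4 * 6: four slots for the index of \<open>v\<close> and the 3!
  orderings of \<open>p\<close>, \<open>q\<close>, \<open>r\<close>.\<close>

lemma field_strength_sq_form3:
  fixes g :: "real^'i^'i" and v :: "'i::finite \<Rightarrow> real"
  assumes pqr: "p \<noteq> q" "p \<noteq> r" "q \<noteq> r"
    and v: "\<And>a. a \<in> {p,q,r} \<Longrightarrow> v a = 0"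
    and M: "\<And>a b. a \<in> {p,q,r} \<Longrightarrow> a \<noteq> b \<Longrightarrow> matrix_inv g $ b $ a = 0"
  shows "field_strength_sq g (\<lambda>\<alpha>. v \<alpha> *\<^sub>R form3 p q r) =
    24 * (matrix_inv g $ p $ p * matrix_inv g $ q $ q * matrix_inv g $ r $ r) *
    (\<Sum>\<mu>\<in>UNIV. \<Sum>\<alpha>\<in>UNIV. v \<mu> * (matrix_inv g $ \<mu> $ \<alpha> * v \<alpha>))"
proof -
  define w where "w a b c = form3 p q r $ a $ b $ c" for a b c
  define k where "k = matrix_inv g $ p $ p * matrix_inv g $ q $ q * matrix_inv g $ r $ r"
  define V where "V \<mu> = (\<Sum>\<alpha>\<in>UNIV. matrix_inv g $ \<mu> $ \<alpha> * v \<alpha>)" for \<mu>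
  define N where "N a b = matrix_inv g $ a $ b" for a b
  let ?F = "field_strength (\<lambda>\<alpha>. v \<alpha> *\<^sub>R form3 p q r)"
  have F: "?F a b c d = v a * w b c d - v b * w a c d + v c * w a b d - v d * w a b c" for a b c d
    by (simp add: field_strength_def w_def)
  have vw: "v a * w a b c = 0" "v b * w a b c = 0" "v c * w a b c = 0" for a b c
    using form3_nonzero[of p q r a b c] v[of a] v[of b] v[of c] unfolding w_def by (metis insertCI mult_eq_0_iff)+
  have Nd: "N b p = (if b = p then N p p else 0)" "N b q = (if b = q then N q q else 0)"
     "N b r = (if b = r then N r r else 0)" for b
    using M unfolding N_def by auto
  have kw: "(\<Sum>a\<in>UNIV. \<Sum>b\<in>UNIV. \<Sum>c\<in>UNIV. w a b c * (N a' a * N b' b * N c' c)) = k * w a' b' c'" for a' b' c'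
    unfolding w_def sum_form3 k_def N_def[symmetric]
    unfolding Nd[of a'] Nd[of b'] Nd[of c'] form3_def Let_def using pqr by (simp add: algebra_simps)
  \<comment> \<open>Raising indices turns \<open>v\<close> into \<open>V\<close> and multiplies the
    3-form by \<open>k\<close>, separately in each of the four terms of F.\<close>
  have up: "(\<Sum>\<alpha>\<in>UNIV. \<Sum>\<beta>\<in>UNIV. \<Sum>\<gamma>\<in>UNIV. \<Sum>\<kappa>\<in>UNIV. ?F \<alpha> \<beta> \<gamma> \<kappa> * (N \<mu> \<alpha> * N \<nu> \<beta> * N \<rho> \<gamma> * N \<sigma> \<kappa>))
     = k * (V \<mu> * w \<nu> \<rho> \<sigma> - V \<nu> * w \<mu> \<rho> \<sigma> + V \<rho> * w \<mu> \<nu> \<sigma> - V \<sigma> * w \<mu> \<nu> \<rho>)" for \<mu> \<nu> \<rho> \<sigma>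
  proof -
    have A: "(\<Sum>\<alpha>\<in>UNIV. \<Sum>\<beta>\<in>UNIV. \<Sum>\<gamma>\<in>UNIV. \<Sum>\<kappa>\<in>UNIV. N a' \<alpha> * v \<alpha> * (w \<beta> \<gamma> \<kappa> * (N b' \<beta> * N c' \<gamma> * N d' \<kappa>)))
       = V a' * (k * w b' c' d')" for a' b' c' d'
      unfolding sum_distrib_left[symmetric] kw unfolding sum_distrib_right[symmetric] V_def N_def ..
    have t1: "(\<Sum>\<alpha>\<in>UNIV. \<Sum>\<beta>\<in>UNIV. \<Sum>\<gamma>\<in>UNIV. \<Sum>\<kappa>\<in>UNIV. v \<alpha> * w \<beta> \<gamma> \<kappa> * (N \<mu> \<alpha> * N \<nu> \<beta> * N \<rho> \<gamma> * N \<sigma> \<kappa>))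
       = V \<mu> * (k * w \<nu> \<rho> \<sigma>)"
      by (subst A[symmetric]) (intro sum.cong refl, simp)
    have t2: "(\<Sum>\<alpha>\<in>UNIV. \<Sum>\<beta>\<in>UNIV. \<Sum>\<gamma>\<in>UNIV. \<Sum>\<kappa>\<in>UNIV. v \<beta> * w \<alpha> \<gamma> \<kappa> * (N \<mu> \<alpha> * N \<nu> \<beta> * N \<rho> \<gamma> * N \<sigma> \<kappa>))
       = V \<nu> * (k * w \<mu> \<rho> \<sigma>)"
      by (subst A[symmetric], subst sum.swap) (intro sum.cong refl, simp)
    have t3: "(\<Sum>\<alpha>\<in>UNIV. \<Sum>\<beta>\<in>UNIV. \<Sum>\<gamma>\<in>UNIV. \<Sum>\<kappa>\<in>UNIV. v \<gamma> * w \<alpha> \<beta> \<kappa> * (N \<mu> \<alpha> * N \<nu> \<beta> * N \<rho> \<gamma> * N \<sigma> \<kappa>))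
       = V \<rho> * (k * w \<mu> \<nu> \<sigma>)"
      by (subst A[symmetric], subst (2) sum.swap, subst sum.swap) (intro sum.cong refl, simp)
    have t4: "(\<Sum>\<alpha>\<in>UNIV. \<Sum>\<beta>\<in>UNIV. \<Sum>\<gamma>\<in>UNIV. \<Sum>\<kappa>\<in>UNIV. v \<kappa> * w \<alpha> \<beta> \<gamma> * (N \<mu> \<alpha> * N \<nu> \<beta> * N \<rho> \<gamma> * N \<sigma> \<kappa>))
       = V \<sigma> * (k * w \<mu> \<nu> \<rho>)"
      by (subst A[symmetric], subst (3) sum.swap, subst (2) sum.swap, subst sum.swap) (intro sum.cong refl, simp)
    show ?thesis
      unfolding F left_diff_distrib distrib_right sum_subtractf sum.distrib t1 t2 t3 t4
      by (simp add: algebra_simps)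
  qed
  \<comment> \<open>Mixed products vanish: in each of them an index of \<open>v\<close> also sits in
    a factor \<open>w\<close>, which forces it into {p,q,r}, where \<open>v\<close> is zero.\<close>
  have sq: "?F a b c d * (V a * w b c d - V b * w a c d + V c * w a b d - V d * w a b c)
     = v a * V a * (w b c d * w b c d) + v b * V b * (w a c d * w a c d) + v c * V c * (w a b d * w a b d) + v d * V d * (w a b c * w a b c)" for a b c d
  proof -
    have [simp]: "v a * (w a x y * z) = 0" "v a * (w x a y * z) = 0" "v a * (w x y a * z) = 0" for a x y z
      using vw[of a x y] vw[of x a y] vw[of x y a] by auto
    have [simp]: "v a * (z * w a x y) = 0" "v a * (z * w x a y) = 0" "v a * (z * w x y a) = 0" for a x y z
      using vw[of a x y] vw[of x a y] vw[of x y a] by auto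
    have [simp]: "v a * (z' * (z * w a x y)) = 0" "v a * (z' * (z * w x a y)) = 0" "v a * (z' * (z * w x y a)) = 0" for a x y z z'
      using vw[of a x y] vw[of x a y] vw[of x y a] by auto
    show ?thesis unfolding F
      by (simp add: left_diff_distrib right_diff_distrib distrib_left distrib_right mult.assoc mult.left_commute)
  qed
  have six: "(\<Sum>a\<in>UNIV. \<Sum>b\<in>UNIV. \<Sum>c\<in>UNIV. w a b c * w a b c) = 6"
    unfolding w_def sum_form3 using pqr by (simp add: form3_def Let_def)
  have S: "(\<Sum>a\<in>UNIV. \<Sum>b\<in>UNIV. \<Sum>c\<in>UNIV. \<Sum>d\<in>UNIV. v a * V a * (w b c d * w b c d)) = (\<Sum>a\<in>UNIV. v a * V a) * 6"
    unfolding sum_distrib_left[symmetric] six unfolding sum_distrib_right[symmetric] ..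
  have S2: "(\<Sum>a\<in>UNIV. \<Sum>b\<in>UNIV. \<Sum>c\<in>UNIV. \<Sum>d\<in>UNIV. v b * V b * (w a c d * w a c d)) = (\<Sum>a\<in>UNIV. v a * V a) * 6"
    by (subst sum.swap, rule S)
  have S3: "(\<Sum>a\<in>UNIV. \<Sum>b\<in>UNIV. \<Sum>c\<in>UNIV. \<Sum>d\<in>UNIV. v c * V c * (w a b d * w a b d)) = (\<Sum>a\<in>UNIV. v a * V a) * 6"
    by (subst (2) sum.swap, rule S2)
  have S4: "(\<Sum>a\<in>UNIV. \<Sum>b\<in>UNIV. \<Sum>c\<in>UNIV. \<Sum>d\<in>UNIV. v d * V d * (w a b c * w a b c)) = (\<Sum>a\<in>UNIV. v a * V a) * 6"
    by (rule trans[OF _ S3], rule sum.cong[OF refl], rule sum.cong[OF refl], rule sum.swap)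
  have pull: "(\<Sum>\<mu>\<in>UNIV. \<Sum>\<nu>\<in>UNIV. \<Sum>\<rho>\<in>UNIV. \<Sum>\<sigma>\<in>UNIV. k * X \<mu> \<nu> \<rho> \<sigma>)
      = k * (\<Sum>\<mu>\<in>UNIV. \<Sum>\<nu>\<in>UNIV. \<Sum>\<rho>\<in>UNIV. \<Sum>\<sigma>\<in>UNIV. X \<mu> \<nu> \<rho> \<sigma>)" for X :: "'i \<Rightarrow> 'i \<Rightarrow> 'i \<Rightarrow> 'i \<Rightarrow> real"
    by (simp only: sum_distrib_left)
  have "field_strength_sq g (\<lambda>\<alpha>. v \<alpha> *\<^sub>R form3 p q r) =
     (\<Sum>\<mu>\<in>UNIV. \<Sum>\<nu>\<in>UNIV. \<Sum>\<rho>\<in>UNIV. \<Sum>\<sigma>\<in>UNIV. ?F \<mu> \<nu> \<rho> \<sigma> *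
        (\<Sum>\<alpha>\<in>UNIV. \<Sum>\<beta>\<in>UNIV. \<Sum>\<gamma>\<in>UNIV. \<Sum>\<kappa>\<in>UNIV. ?F \<alpha> \<beta> \<gamma> \<kappa> * (N \<mu> \<alpha> * N \<nu> \<beta> * N \<rho> \<gamma> * N \<sigma> \<kappa>)))"
    unfolding field_strength_sq_def N_def sum_distrib_left
    by (intro sum.cong refl) (simp add: mult.assoc)
  also have "\<dots> = (\<Sum>\<mu>\<in>UNIV. \<Sum>\<nu>\<in>UNIV. \<Sum>\<rho>\<in>UNIV. \<Sum>\<sigma>\<in>UNIV. k * (?F \<mu> \<nu> \<rho> \<sigma> *
        (V \<mu> * w \<nu> \<rho> \<sigma> - V \<nu> * w \<mu> \<rho> \<sigma> + V \<rho> * w \<mu> \<nu> \<sigma> - V \<sigma> * w \<mu> \<nu> \<rho>)))"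
    unfolding up by (intro sum.cong refl) simp
  also have "\<dots> = k * (24 * (\<Sum>a\<in>UNIV. v a * V a))"
    unfolding pull sq sum.distrib S S2 S3 S4 by simp
  finally show ?thesis unfolding k_def V_def sum_distrib_left by (simp add: mult_ac)
qed

section \<open>The Chern-Simons density\<close>

text \<open>A permutation puts the index \<open>p\<close> into one slot only, so at least one of the
  two factors F lacks it and vanishes.\<close>

lemma chern_simons_0:
  assumes "\<And>\<mu> \<nu> \<rho> \<sigma>. p \<notin> {\<mu>,\<nu>,\<rho>,\<sigma>} \<Longrightarrow> field_strength dA \<mu> \<nu> \<rho> \<sigma> = 0"
  shows "chern_simons A dA = 0"
  unfolding chern_simons_def
proof (intro sum.neutral ballI)
  fix \<pi> :: "11 \<Rightarrow> 11" assume "\<pi> \<in> {\<pi>. \<pi> permutes UNIV}"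
  then have i: "\<pi> a = \<pi> b \<longleftrightarrow> a = b" for a b by (simp add: permutes_inj inj_eq)
  have "field_strength dA (\<pi> 4) (\<pi> 5) (\<pi> 6) (\<pi> 7) = 0 \<or> field_strength dA (\<pi> 8) (\<pi> 9) (\<pi> 10) (\<pi> 11) = 0"
    using assms[of "\<pi> 4" "\<pi> 5" "\<pi> 6" "\<pi> 7"] assms[of "\<pi> 8" "\<pi> 9" "\<pi> 10" "\<pi> 11"]
    by (cases "p \<in> {\<pi> 4, \<pi> 5, \<pi> 6, \<pi> 7}") (auto simp: i)
  then show "of_int (sign \<pi>) * A $ \<pi> 1 $ \<pi> 2 $ \<pi> 3
        * field_strength dA (\<pi> 4) (\<pi> 5) (\<pi> 6) (\<pi> 7)
        * field_strength dA (\<pi> 8) (\<pi> 9) (\<pi> 10) (\<pi> 11) = 0" by auto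
qed

lemma field_strength_add:
  "field_strength (\<lambda>\<alpha>. X \<alpha> + k *\<^sub>R Y \<alpha>) \<mu> \<nu> \<rho> \<sigma> = field_strength X \<mu> \<nu> \<rho> \<sigma> + k * field_strength Y \<mu> \<nu> \<rho> \<sigma>"
  by (simp add: field_strength_def algebra_simps)

text \<open>For each permutation either \<open>p\<close> is in a slot of \<open>A\<close>, and then
  neither factor F sees \<open>X\<close>, or it is not, and then \<open>A\<close> vanishes. What
  survives is of second order in \<open>k\<close>, hence invisible to a first variation.\<close>

lemma chern_simons_quadratic:
  assumes A: "\<And>\<mu> \<nu> \<rho>. p \<notin> {\<mu>,\<nu>,\<rho>} \<Longrightarrow> A $ \<mu> $ \<nu> $ \<rho> = 0"
    and X: "\<And>\<mu> \<nu> \<rho> \<sigma>. p \<notin> {\<mu>,\<nu>,\<rho>,\<sigma>} \<Longrightarrow> field_strength X \<mu> \<nu> \<rho> \<sigma> = 0"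
  shows "chern_simons A (\<lambda>\<alpha>. X \<alpha> + k *\<^sub>R Y \<alpha>) = k^2 * chern_simons A Y"
  unfolding chern_simons_def sum_distrib_left
proof (intro sum.cong refl)
  fix \<pi> :: "11 \<Rightarrow> 11" assume "\<pi> \<in> {\<pi>. \<pi> permutes UNIV}"
  then have i: "\<pi> a = \<pi> b \<longleftrightarrow> a = b" for a b by (simp add: permutes_inj inj_eq)
  have "A $ \<pi> 1 $ \<pi> 2 $ \<pi> 3 = 0 \<or>
    field_strength X (\<pi> 4) (\<pi> 5) (\<pi> 6) (\<pi> 7) = 0 \<and> field_strength X (\<pi> 8) (\<pi> 9) (\<pi> 10) (\<pi> 11) = 0"
    using A[of "\<pi> 1" "\<pi> 2" "\<pi> 3"] X[of "\<pi> 4" "\<pi> 5" "\<pi> 6" "\<pi> 7"] X[of "\<pi> 8" "\<pi> 9" "\<pi> 10" "\<pi> 11"]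
    by (cases "p \<in> {\<pi> 1, \<pi> 2, \<pi> 3}") (auto simp: i)
  then show "of_int (sign \<pi>) * A $ \<pi> 1 $ \<pi> 2 $ \<pi> 3
        * field_strength (\<lambda>\<alpha>. X \<alpha> + k *\<^sub>R Y \<alpha>) (\<pi> 4) (\<pi> 5) (\<pi> 6) (\<pi> 7)
        * field_strength (\<lambda>\<alpha>. X \<alpha> + k *\<^sub>R Y \<alpha>) (\<pi> 8) (\<pi> 9) (\<pi> 10) (\<pi> 11) =
     k^2 * (of_int (sign \<pi>) * A $ \<pi> 1 $ \<pi> 2 $ \<pi> 3
        * field_strength Y (\<pi> 4) (\<pi> 5) (\<pi> 6) (\<pi> 7)
        * field_strength Y (\<pi> 8) (\<pi> 9) (\<pi> 10) (\<pi> 11))"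
    unfolding field_strength_add by (auto simp: power2_eq_square)
qed

lemma UNIV_11: "(UNIV :: 11 set) = {1,2,3,4,5,6,7,8,9,10,11}"
  by (rule card_subset_eq[symmetric]) auto

text \<open>The weight with which \<open>euler\<close> varies the second derivatives; for equal
  directions the two halves add up to \<open>s\<close>.\<close>

definition half_pair :: "11 \<Rightarrow> 11 \<Rightarrow> real \<Rightarrow> 11 \<Rightarrow> 11 \<Rightarrow> real" where
  "half_pair \<kappa> \<kappa>' s \<alpha> \<beta> = (if \<alpha> = \<kappa> \<and> \<beta> = \<kappa>' then s / 2 else 0) + (if \<alpha> = \<kappa>' \<and> \<beta> = \<kappa> then s / 2 else 0)"

lemma half_pair_scale: "half_pair \<kappa> \<kappa>' s \<alpha> \<beta> = s * half_pair \<kappa> \<kappa>' 1 \<alpha> \<beta>"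
proof -
  have "(if P then s / 2 else 0) + (if Q then s / 2 else 0) = s * ((if P then 1 / 2 else 0) + (if Q then 1 / 2 else 0))" for P Q
    by simp
  then show ?thesis unfolding half_pair_def .
qed

lemma half_pair_swap: "\<kappa> \<in> {1,2} \<Longrightarrow> \<kappa>' \<in> {1,2} \<Longrightarrow> half_pair \<kappa> \<kappa>' s 2 1 = half_pair \<kappa> \<kappa>' s 1 2"
  by (elim insertE emptyE) (simp_all add: half_pair_def)

lemma half_pair_0:
  "\<kappa> \<in> {1,2} \<Longrightarrow> \<kappa>' \<in> {1,2} \<Longrightarrow> \<alpha> \<noteq> 1 \<and> \<alpha> \<noteq> 2 \<or> \<beta> \<noteq> 1 \<and> \<beta> \<noteq> 2 \<Longrightarrow> half_pair \<kappa> \<kappa>' s \<alpha> \<beta> = 0"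
  by (elim insertE emptyE) (auto simp: half_pair_def)

lemmas half_pair = half_pair_swap half_pair_0

text \<open>The Chern-Simons term is split off because it depends on the potential itself; it is
  handled by counting indices, while \<open>Lg\<close> is handled by reflections and explicit
  formulas.\<close>

definition Lg :: "real \<Rightarrow> metric \<Rightarrow> 11 metric1 \<Rightarrow> 11 metric2 \<Rightarrow> (11 \<Rightarrow> threeform) \<Rightarrow> real" where
  "Lg \<epsilon> g dg ddg dA = sqrt \<bar>det g\<bar> * (scalar_curvature g dg ddg - \<epsilon> / (2 * fact 4) * field_strength_sq g dA)"

definition diagm :: "('i::finite \<Rightarrow> real) \<Rightarrow> real^'i^'i" where
  "diagm G = (\<chi> a b. if a = b then G a else 0)"

lemma diagm_pairmat: "\<mu> \<noteq> \<nu> \<Longrightarrow> diagm G = pairmat \<mu> \<nu> 0 G"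
  by (auto simp: diagm_def pairmat_def vec_eq_iff doubleton_eq_iff)

lemma diagm_add_unit: "\<mu> \<noteq> \<nu> \<Longrightarrow> diagm G + t *\<^sub>R metric_unit \<mu> \<nu> = pairmat \<mu> \<nu> t G"
  by (auto simp: diagm_def pairmat_def metric_unit_def vec_eq_iff doubleton_eq_iff)

lemma diagm_add_unit_diag: "diagm G + t *\<^sub>R metric_unit a a = diagm (G(a := G a + t))"
  by (auto simp: diagm_def metric_unit_def vec_eq_iff)

lemma diagm_nth: "diagm G $ a $ b = (if a = b then G a else 0)"
  by (simp add: diagm_def)

lemma matrix_inv_diagm:
  assumes "\<And>a. G a \<noteq> 0"
  shows "matrix_inv (diagm G) = diagm (\<lambda>a. 1 / G a)"
  by (rule matrix_inv_unique)
    (use assms in \<open>auto simp: matrix_matrix_mult_def diagm_def mat_def vec_eq_iff mult_delta_left sum.delta\<close>)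

lemma det_diagm: "det (diagm G) = (\<Prod>a\<in>UNIV. G a)"
  by (subst det_diagonal) (auto simp: diagm_def)

text \<open>Writing the absolute value as the square root of the square avoids a case split on the
  sign of \<open>f 0\<close>.\<close>

lemma differentiable_sqrt_abs:
  fixes f :: "real \<Rightarrow> real"
  assumes "f differentiable (at 0)" "f 0 \<noteq> 0"
  shows "(\<lambda>s. sqrt \<bar>f s\<bar>) differentiable (at 0)"
proof -
  obtain d where d: "DERIV f 0 :> d" using assms(1) by (auto simp: real_differentiable_def)
  have "\<exists>D. DERIV (\<lambda>y. sqrt (sqrt y)) ((f 0)\<^sup>2) :> D"
    using assms(2) by (intro exI) (auto intro!: derivative_eq_intros)
  then obtain D where D: "DERIV (\<lambda>y. sqrt (sqrt y)) ((f 0)\<^sup>2) :> D" by blast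
  have "DERIV (\<lambda>s. (f s)\<^sup>2) 0 :> 2 * f 0 * d" by (auto intro!: derivative_eq_intros d)
  from DERIV_chain2[OF D this] show ?thesis by (auto simp: real_differentiable_def)
qed

text \<open>The reflected jet at \<open>s\<close> is the jet at \<open>-s\<close>, so invariance
  makes the Lagrangian even in \<open>s\<close>. The condition on the inverse is only required near
  0, since explicit inverses are available only where the determinant does not vanish.\<close>

lemma deriv_Lg_reflect:
  assumes e: "\<And>a. e a * e a = 1" and z: "\<zeta> * \<zeta> = 1"
    and M: "\<And>a b. (\<lambda>s. matrix_inv (g s) $ a $ b) differentiable (at 0)"
    and det: "(\<lambda>s. det (g s)) differentiable (at 0)" "det (g 0) \<noteq> 0" "\<And>s. det (g (- s)) = det (g s)"
    and d: "\<And>\<alpha> a b. (\<lambda>s. dg s \<alpha> $ a $ b) differentiable (at 0)"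
    and dd: "\<And>\<alpha> \<beta> a b. (\<lambda>s. ddg s \<alpha> \<beta> $ a $ b) differentiable (at 0)"
    and A: "\<And>\<alpha> a b c. (\<lambda>s. dA s \<alpha> $ a $ b $ c) differentiable (at 0)"
    and rM: "eventually (\<lambda>s. \<forall>a b. matrix_inv (g (-s)) $ a $ b = e a * e b * matrix_inv (g s) $ a $ b) (nhds 0)"
    and rd: "\<And>s \<alpha> a b. dg (- s) \<alpha> $ a $ b = e \<alpha> * e a * e b * dg s \<alpha> $ a $ b"
    and rdd: "\<And>s \<alpha> \<beta> a b. ddg (- s) \<alpha> \<beta> $ a $ b = e \<alpha> * e \<beta> * e a * e b * ddg s \<alpha> \<beta> $ a $ b"
    and rA: "\<And>s \<alpha> a b c. dA (- s) \<alpha> $ a $ b $ c = \<zeta> * (e \<alpha> * e a * e b * e c * dA s \<alpha> $ a $ b $ c)"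
  shows "(\<lambda>s. Lg \<epsilon> (g s) (dg s) (ddg s) (dA s)) differentiable (at 0)"
    "deriv (\<lambda>s. Lg \<epsilon> (g s) (dg s) (ddg s) (dA s)) 0 = 0"
proof -
  show df: "(\<lambda>s. Lg \<epsilon> (g s) (dg s) (ddg s) (dA s)) differentiable (at 0)"
    unfolding Lg_def
    by (intro differentiable_mult differentiable_diff differentiable_const differentiable_sqrt_abs det
       differentiable_scalar_curvature differentiable_field_strength_sq M d dd A)
  show "deriv (\<lambda>s. Lg \<epsilon> (g s) (dg s) (ddg s) (dA s)) 0 = 0"
  proof (rule deriv_even_0[OF df])
    show "eventually (\<lambda>s. Lg \<epsilon> (g (- s)) (dg (- s)) (ddg (- s)) (dA (- s)) = Lg \<epsilon> (g s) (dg s) (ddg s) (dA s)) (nhds 0)"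
      using rM
    proof (rule eventually_mono)
      fix s assume "\<forall>a b. matrix_inv (g (-s)) $ a $ b = e a * e b * matrix_inv (g s) $ a $ b"
      then have m: "matrix_inv (g (-s)) $ a $ b = e a * e b * matrix_inv (g s) $ a $ b" for a b by blast
      show "Lg \<epsilon> (g (- s)) (dg (- s)) (ddg (- s)) (dA (- s)) = Lg \<epsilon> (g s) (dg s) (ddg s) (dA s)"
        unfolding Lg_def det(3)
        using scalar_curvature_reflect[where e = e and g' = "g (-s)" and g = "g s" and dg' = "dg (-s)" and dg = "dg s"
            and ddg' = "ddg (-s)" and ddg = "ddg s", OF e m rd rdd]
          field_strength_sq_reflect[where e = e and g' = "g (-s)" and g = "g s" and dA' = "dA (-s)" and \<zeta> = \<zeta> and dA = "dA s", OF e m rA z]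
        by simp
    qed
  qed
qed

section \<open>Variations that vanish by reflection\<close>

abbreviation (input) \<omega> :: threeform where "\<omega> \<equiv> form3 9 10 11"

text \<open>The jet of a diagonal metric and of a multiple of \<omega> at one point, as unrelated
  numbers. The value and the second derivatives of the potential are absent because
  \<open>Lg\<close> does not see them.\<close>

locale diag_jet =
  fixes G :: "11 \<Rightarrow> real" and G1 :: "11 \<Rightarrow> 11 \<Rightarrow> real" and G2 :: "11 \<Rightarrow> 11 \<Rightarrow> 11 \<Rightarrow> real" and A1 :: "11 \<Rightarrow> real"
  assumes G: "\<And>a. G a \<noteq> 0"
    and G1: "\<And>\<alpha> a. \<alpha> \<notin> {1,2} \<Longrightarrow> G1 \<alpha> a = 0"
    and G2: "\<And>\<alpha> \<beta> a. \<alpha> \<notin> {1,2} \<or> \<beta> \<notin> {1,2} \<Longrightarrow> G2 \<alpha> \<beta> a = 0"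
    and A1: "\<And>\<alpha>. \<alpha> \<notin> {1,2} \<Longrightarrow> A1 \<alpha> = 0"
begin

definition rf :: "11 \<Rightarrow> 11 \<Rightarrow> real" where "rf k a = (if a = k then -1 else 1)"

lemma rf: "rf k a * rf k a = 1" by (simp add: rf_def)

lemma r3: "rf k a * rf k b * rf k c * form3 \<mu> \<nu> \<rho> $ a $ b $ c = rf k \<mu> * rf k \<nu> * rf k \<rho> * form3 \<mu> \<nu> \<rho> $ a $ b $ c"
  by (rule form3_reflect) (rule rf)

lemma rd: "k \<notin> {1,2} \<Longrightarrow> rf k \<alpha> * rf k a * rf k b * diagm (G1 \<alpha>) $ a $ b = diagm (G1 \<alpha>) $ a $ b"
  using G1[of \<alpha>] by (auto simp: rf_def diagm_nth)
lemma rdd: "k \<notin> {1,2} \<Longrightarrow> rf k \<alpha> * rf k \<beta> * rf k a * rf k b * diagm (G2 \<alpha> \<beta>) $ a $ b = diagm (G2 \<alpha> \<beta>) $ a $ b"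
  using G2[of \<alpha> \<beta>] by (auto simp: rf_def diagm_nth)
text \<open>The prefactor is the compensating flip of the 3-form: it is -1 exactly when the
  reflected direction \<open>k\<close> is one of 9, 10, 11, where \<omega> itself changes
  sign.\<close>

lemma rA: "k \<notin> {1,2} \<Longrightarrow> rf k 9 * rf k 10 * rf k 11 * (rf k \<alpha> * rf k a * rf k b * rf k c * (A1 \<alpha> *\<^sub>R \<omega>) $ a $ b $ c) = (A1 \<alpha> *\<^sub>R \<omega>) $ a $ b $ c"
proof -
  assume k: "k \<notin> {1,2}"
  have "rf k 9 * rf k 10 * rf k 11 * (rf k \<alpha> * rf k a * rf k b * rf k c * (A1 \<alpha> *\<^sub>R \<omega>) $ a $ b $ c) =
     rf k \<alpha> * A1 \<alpha> * (rf k 9 * rf k 10 * rf k 11 * (rf k a * rf k b * rf k c * \<omega> $ a $ b $ c))" by simp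
  also have "\<dots> = rf k \<alpha> * A1 \<alpha> * ((rf k 9 * rf k 9) * (rf k 10 * rf k 10) * (rf k 11 * rf k 11) * \<omega> $ a $ b $ c)"
    unfolding r3[of k a b c 9 10 11] by (simp only: mult_ac)
  also have "\<dots> = rf k \<alpha> * A1 \<alpha> * \<omega> $ a $ b $ c" unfolding rf by simp
  also have "rf k \<alpha> * A1 \<alpha> = A1 \<alpha>" using k A1[of \<alpha>] by (auto simp: rf_def)
  finally show ?thesis by simp
qed

lemma rzz: "(rf k 9 * rf k 10 * rf k 11) * (rf k 9 * rf k 10 * rf k 11) = 1"
  by (simp add: rf_def)

lemma Mc: "matrix_inv (diagm G) $ a $ b = rf k a * rf k b * matrix_inv (diagm G) $ a $ b"
  by (simp add: matrix_inv_diagm G diagm_nth rf_def)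

lemma Mev: "eventually (\<lambda>s::real. \<forall>a b. matrix_inv (diagm G) $ a $ b = rf k a * rf k b * matrix_inv (diagm G) $ a $ b) (nhds 0)"
  by (intro always_eventually allI Mc)

lemma detc: "det (diagm G) \<noteq> 0" by (simp add: det_diagm G)

lemma diff_lin:
  "(\<lambda>s. (X + (if P then s else 0) *\<^sub>R w) $ a $ b) differentiable (at (0::real))"
  for X w :: "real^'a^'b"
  by (cases P) (auto intro!: derivative_intros)

lemma diff_lin2:
  "(\<lambda>s. (X + half_pair \<kappa> \<kappa>' s \<alpha> \<beta> *\<^sub>R w) $ a $ b) differentiable (at (0::real))"
  for X w :: "real^'a^'b"
proof -
  obtain k where "\<And>s. half_pair \<kappa> \<kappa>' s \<alpha> \<beta> = s * k" using half_pair_scale by blast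
  then show ?thesis by (auto intro!: derivative_intros)
qed

lemma diff_lin3:
  "(\<lambda>s. (X + (if P then s else 0) *\<^sub>R w) $ a $ b $ c) differentiable (at (0::real))"
  for X w :: "real^'a^'b^'c"
  by (cases P) (auto intro!: derivative_intros)

lemma rw: "rf k a * rf k b * metric_unit \<mu> \<nu> $ a $ b = rf k \<mu> * rf k \<nu> * metric_unit \<mu> \<nu> $ a $ b"
  by (auto simp: metric_unit_def rf_def doubleton_eq_iff)

context
  fixes \<mu> \<nu> :: 11
  assumes mn: "\<mu> \<noteq> \<nu>" "{\<mu>,\<nu>} \<noteq> {1,2}"
begin

text \<open>At least one of the two distinct indices lies outside the block. Reflecting that one and
  not the other flips \<open>metric_unit \<mu> \<nu>\<close>.\<close>

private lemma obtain_k: obtains k where "k \<notin> {1,2}" "rf k \<mu> * rf k \<nu> = -1"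
proof -
  have "\<mu> \<notin> {1,2} \<or> \<nu> \<notin> {1,2}" using mn by auto
  then show thesis using that[of \<mu>] that[of \<nu>] mn by (auto simp: rf_def)
qed

text \<open>Varying the metric itself is the only case that changes its inverse and determinant. In
  closed form the off-diagonal entry of the inverse is odd in \<open>s\<close>, while everything
  else, including the determinant, depends on the square of \<open>s\<close>.\<close>

lemma Lg_offdiag_0:
  "deriv (\<lambda>s. Lg \<epsilon> (diagm G + s *\<^sub>R metric_unit \<mu> \<nu>) (\<lambda>\<alpha>. diagm (G1 \<alpha>)) (\<lambda>\<alpha> \<beta>. diagm (G2 \<alpha> \<beta>)) (\<lambda>\<alpha>. A1 \<alpha> *\<^sub>R \<omega>)) 0 = 0"
proof -
  let ?I = "\<lambda>s. pairmat \<mu> \<nu> (- s / (G \<mu> * G \<nu> - s^2))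
     (\<lambda>a. if a = \<mu> then G \<nu> / (G \<mu> * G \<nu> - s^2) else if a = \<nu> then G \<mu> / (G \<mu> * G \<nu> - s^2) else 1 / G a)"
  obtain k where k: "k \<notin> {1,2}" "rf k \<mu> * rf k \<nu> = -1" by (rule obtain_k)
  have "eventually (\<lambda>s::real. G \<mu> * G \<nu> - s^2 \<noteq> 0) (nhds 0)"
  proof -
    have "((\<lambda>s::real. G \<mu> * G \<nu> - s^2) \<longlongrightarrow> G \<mu> * G \<nu> - 0^2) (at 0)" by (intro tendsto_intros)
    then have "eventually (\<lambda>s::real. G \<mu> * G \<nu> - s^2 \<noteq> 0) (at 0)"
      by (rule tendsto_imp_eventually_ne) (simp add: G)
    then show ?thesis by (simp add: eventually_nhds_conv_at G)
  qed
  then have ev: "eventually (\<lambda>s. matrix_inv (pairmat \<mu> \<nu> s G) = ?I s) (nhds 0)"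
    by (rule eventually_mono) (simp add: matrix_inv_pairmat mn G)
  show ?thesis
    unfolding diagm_add_unit[OF mn(1)]
  proof (rule deriv_Lg_reflect(2)[OF rf[of k] rzz[of k]])
    fix a b
    have di: "(\<lambda>s. if P then f s else h s) differentiable (at 0)"
      if "f differentiable (at 0)" "h differentiable (at 0)" for P and f h :: "real \<Rightarrow> real"
      using that by (cases P) auto
    have q: "(\<lambda>s. - s / (G \<mu> * G \<nu> - s\<^sup>2)) differentiable (at 0)" "(\<lambda>s. c / (G \<mu> * G \<nu> - s\<^sup>2)) differentiable (at 0)" for c
      using G by (auto intro!: derivative_intros)
    have "(\<lambda>s. ?I s $ a $ b) differentiable (at 0)"
      unfolding pairmat_def vec_lambda_beta by (intro di q differentiable_const)
    moreover have ev': "eventually (\<lambda>s. matrix_inv (pairmat \<mu> \<nu> s G) $ a $ b = ?I s $ a $ b) (nhds 0)"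
      using ev by (rule eventually_mono) simp
    ultimately show "(\<lambda>s. matrix_inv (pairmat \<mu> \<nu> s G) $ a $ b) differentiable (at 0)"
      unfolding real_differentiable_def DERIV_cong_ev[OF refl ev' refl] by blast
  next
    show "(\<lambda>s. det (pairmat \<mu> \<nu> s G)) differentiable (at 0)"
      using mn G by (simp add: det_pairmat)
    show "det (pairmat \<mu> \<nu> 0 G) \<noteq> 0" "det (pairmat \<mu> \<nu> (- s) G) = det (pairmat \<mu> \<nu> s G)" for s
      using mn G by (simp_all add: det_pairmat)
  next
    show "eventually (\<lambda>s. \<forall>a b. matrix_inv (pairmat \<mu> \<nu> (- s) G) $ a $ b = rf k a * rf k b * matrix_inv (pairmat \<mu> \<nu> s G) $ a $ b) (nhds 0)"
    proof -
      have "eventually (\<lambda>s::real. G \<mu> * G \<nu> - s^2 \<noteq> 0) (nhds 0)" by fact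
      then show ?thesis
      proof (rule eventually_mono)
        fix s assume s: "G \<mu> * G \<nu> - s^2 \<noteq> 0"
        have "matrix_inv (pairmat \<mu> \<nu> (-s) G) = ?I (- s)"
          using matrix_inv_pairmat[of \<mu> \<nu> G "-s", OF mn(1) G] s by simp
        moreover have "matrix_inv (pairmat \<mu> \<nu> s G) = ?I s"
          using matrix_inv_pairmat[of \<mu> \<nu> G "s", OF mn(1) G] s by simp
        ultimately show "\<forall>a b. matrix_inv (pairmat \<mu> \<nu> (- s) G) $ a $ b = rf k a * rf k b * matrix_inv (pairmat \<mu> \<nu> s G) $ a $ b"
          using k(2) by (auto simp: pairmat_def doubleton_eq_iff rf_def)
      qed
    qed
  qed (rule rd[OF k(1), symmetric] rdd[OF k(1), symmetric] rA[OF k(1), symmetric] differentiable_const)+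
qed

lemma Lg_offdiag_1:
  assumes \<kappa>: "\<kappa> \<in> {1,2}"
  shows "deriv (\<lambda>s. Lg \<epsilon> (diagm G) (\<lambda>\<alpha>. diagm (G1 \<alpha>) + (if \<alpha> = \<kappa> then s else 0) *\<^sub>R metric_unit \<mu> \<nu>)
    (\<lambda>\<alpha> \<beta>. diagm (G2 \<alpha> \<beta>)) (\<lambda>\<alpha>. A1 \<alpha> *\<^sub>R \<omega>)) 0 = 0"
proof -
  obtain k where k: "k \<notin> {1,2}" "rf k \<mu> * rf k \<nu> = -1" by (rule obtain_k)
  \<comment> \<open>The derivative slot \<kappa> is fixed by the reflection, so the sign of the
    variation comes from the metric indices alone.\<close>
  have e: "rf k \<kappa> = 1" using k \<kappa> by (auto simp: rf_def)
  show ?thesis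
  proof (rule deriv_Lg_reflect(2)[OF rf[of k] rzz[of k]])
    fix s \<alpha> a b
    have "rf k \<alpha> * rf k a * rf k b * (diagm (G1 \<alpha>) + (if \<alpha> = \<kappa> then s else 0) *\<^sub>R metric_unit \<mu> \<nu>) $ a $ b
      = rf k \<alpha> * rf k a * rf k b * diagm (G1 \<alpha>) $ a $ b + rf k \<alpha> * (if \<alpha> = \<kappa> then s else 0) * (rf k a * rf k b * metric_unit \<mu> \<nu> $ a $ b)"
      by (simp add: algebra_simps)
    also have "\<dots> = (diagm (G1 \<alpha>) + (if \<alpha> = \<kappa> then - s else 0) *\<^sub>R metric_unit \<mu> \<nu>) $ a $ b"
      unfolding rd[OF k(1)] rw k(2) using e by auto
    finally show "(diagm (G1 \<alpha>) + (if \<alpha> = \<kappa> then - s else 0) *\<^sub>R metric_unit \<mu> \<nu>) $ a $ b =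
       rf k \<alpha> * rf k a * rf k b * (diagm (G1 \<alpha>) + (if \<alpha> = \<kappa> then s else 0) *\<^sub>R metric_unit \<mu> \<nu>) $ a $ b" ..
  qed (rule diff_lin | rule Mev rd[OF k(1), symmetric] rdd[OF k(1), symmetric] rA[OF k(1), symmetric] differentiable_const | simp add: detc)+
qed

lemma Lg_offdiag_2:
  assumes \<kappa>: "\<kappa> \<in> {1,2}" "\<kappa>' \<in> {1,2}"
  shows "deriv (\<lambda>s. Lg \<epsilon> (diagm G) (\<lambda>\<alpha>. diagm (G1 \<alpha>))
    (\<lambda>\<alpha> \<beta>. diagm (G2 \<alpha> \<beta>) + half_pair \<kappa> \<kappa>' s \<alpha> \<beta> *\<^sub>R metric_unit \<mu> \<nu>) (\<lambda>\<alpha>. A1 \<alpha> *\<^sub>R \<omega>)) 0 = 0"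
proof -
  obtain k where k: "k \<notin> {1,2}" "rf k \<mu> * rf k \<nu> = -1" by (rule obtain_k)
  have e: "rf k \<kappa> = 1" "rf k \<kappa>' = 1" using k \<kappa> by (auto simp: rf_def)
  show ?thesis
  proof (rule deriv_Lg_reflect(2)[OF rf[of k] rzz[of k]])
    fix s \<alpha> \<beta> a b
    let ?f = "\<lambda>s. half_pair \<kappa> \<kappa>' s \<alpha> \<beta>"
    have h: "rf k \<alpha> * rf k \<beta> * ?f s = ?f s"
    proof -
      have z: "z * ((if P then r else 0) + (if Q then r else 0)) = (if P then r else 0) + (if Q then r else 0)"
        if "P \<Longrightarrow> z = 1" "Q \<Longrightarrow> z = 1" for P Q and z r :: real using that by simp
      show ?thesis unfolding half_pair_def by (rule z) (use e in auto)
    qed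
    have "rf k \<alpha> * rf k \<beta> * rf k a * rf k b * (diagm (G2 \<alpha> \<beta>) + ?f s *\<^sub>R metric_unit \<mu> \<nu>) $ a $ b
      = rf k \<alpha> * rf k \<beta> * rf k a * rf k b * diagm (G2 \<alpha> \<beta>) $ a $ b + rf k \<alpha> * rf k \<beta> * ?f s * (rf k a * rf k b * metric_unit \<mu> \<nu> $ a $ b)"
      by (simp add: algebra_simps)
    also have "\<dots> = (diagm (G2 \<alpha> \<beta>) + ?f (-s) *\<^sub>R metric_unit \<mu> \<nu>) $ a $ b"
      unfolding rdd[OF k(1)] rw k(2) h by (simp add: half_pair_scale[of _ _ s] half_pair_scale[of _ _ "- s"])
    finally show "(diagm (G2 \<alpha> \<beta>) + ?f (-s) *\<^sub>R metric_unit \<mu> \<nu>) $ a $ b =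
       rf k \<alpha> * rf k \<beta> * rf k a * rf k b * (diagm (G2 \<alpha> \<beta>) + ?f s *\<^sub>R metric_unit \<mu> \<nu>) $ a $ b" ..
  qed (rule diff_lin2 | rule Mev rd[OF k(1), symmetric] rdd[OF k(1), symmetric] rA[OF k(1), symmetric] differentiable_const | simp add: detc)+
qed

end

text \<open>Some \<open>k\<close> among 9, 10, 11 is missing from the varied component. Reflecting
  it and flipping the 3-form preserves the background, but reverses the variation, which the
  reflection alone leaves unchanged. Differentiability is stated as well because the Chern-Simons
  part is added afterwards.\<close>

lemma Lg_form:
  assumes \<kappa>: "\<kappa> \<in> {1,2}" and n: "{\<mu>,\<nu>,\<rho>} \<noteq> {9,10,11}"
  shows "(\<lambda>s. Lg \<epsilon> (diagm G) (\<lambda>\<alpha>. diagm (G1 \<alpha>)) (\<lambda>\<alpha> \<beta>. diagm (G2 \<alpha> \<beta>))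
      (\<lambda>\<alpha>. A1 \<alpha> *\<^sub>R \<omega> + (if \<alpha> = \<kappa> then s else 0) *\<^sub>R form3 \<mu> \<nu> \<rho>)) differentiable (at 0)" (is ?A)
    and "deriv (\<lambda>s. Lg \<epsilon> (diagm G) (\<lambda>\<alpha>. diagm (G1 \<alpha>)) (\<lambda>\<alpha> \<beta>. diagm (G2 \<alpha> \<beta>))
      (\<lambda>\<alpha>. A1 \<alpha> *\<^sub>R \<omega> + (if \<alpha> = \<kappa> then s else 0) *\<^sub>R form3 \<mu> \<nu> \<rho>)) 0 = 0" (is ?B)
proof -
  have "\<exists>k\<in>{9,10,11}. k \<notin> {\<mu>,\<nu>,\<rho>}"
  proof (rule ccontr)
    assume "\<not> ?thesis"
    then have s: "{9,10,11} \<subseteq> {\<mu>,\<nu>,\<rho>}" by blast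
    have "card {\<mu>,\<nu>,\<rho>} \<le> card {9,10,11::11}"
      by (rule order_trans[of _ 3]) (auto intro: order_trans[OF card_insert_le_m1] simp: card_insert_if)
    then have "{9,10,11} = {\<mu>,\<nu>,\<rho>}" using s by (intro card_seteq) auto
    then show False using n by simp
  qed
  then obtain k where k: "k \<in> {9,10,11}" "k \<notin> {\<mu>,\<nu>,\<rho>}" by blast
  then have k1: "k \<notin> {1,2}" by auto
  have e: "rf k \<kappa> = 1" using k1 \<kappa> by (auto simp: rf_def)
  have z: "rf k 9 * rf k 10 * rf k 11 = -1" using k(1) by (auto simp: rf_def)
  have f: "rf k \<mu> * rf k \<nu> * rf k \<rho> = 1" using k(2) by (auto simp: rf_def)
  have *: "rf k a * rf k b * rf k c * form3 \<mu> \<nu> \<rho> $ a $ b $ c = form3 \<mu> \<nu> \<rho> $ a $ b $ c" for a b c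
    unfolding r3[of k a b c \<mu> \<nu> \<rho>] f by simp
  have r: "(A1 \<alpha> *\<^sub>R \<omega> + (if \<alpha> = \<kappa> then - s else 0) *\<^sub>R form3 \<mu> \<nu> \<rho>) $ a $ b $ c =
       (rf k 9 * rf k 10 * rf k 11) * (rf k \<alpha> * rf k a * rf k b * rf k c * (A1 \<alpha> *\<^sub>R \<omega> + (if \<alpha> = \<kappa> then s else 0) *\<^sub>R form3 \<mu> \<nu> \<rho>) $ a $ b $ c)" for s \<alpha> a b c
  proof -
    have "(rf k 9 * rf k 10 * rf k 11) * (rf k \<alpha> * rf k a * rf k b * rf k c * (A1 \<alpha> *\<^sub>R \<omega> + (if \<alpha> = \<kappa> then s else 0) *\<^sub>R form3 \<mu> \<nu> \<rho>) $ a $ b $ c)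
      = rf k 9 * rf k 10 * rf k 11 * (rf k \<alpha> * rf k a * rf k b * rf k c * (A1 \<alpha> *\<^sub>R \<omega>) $ a $ b $ c)
       + rf k 9 * rf k 10 * rf k 11 * (rf k \<alpha> * (if \<alpha> = \<kappa> then s else 0) * (rf k a * rf k b * rf k c * form3 \<mu> \<nu> \<rho> $ a $ b $ c))"
      by (simp add: algebra_simps)
    also have "\<dots> = (A1 \<alpha> *\<^sub>R \<omega>) $ a $ b $ c + - (rf k \<alpha> * (if \<alpha> = \<kappa> then s else 0) * form3 \<mu> \<nu> \<rho> $ a $ b $ c)"
      unfolding rA[OF k1] unfolding z * by simp
    finally show ?thesis using e by simp
  qed
  show ?A
    by (rule deriv_Lg_reflect(1)[OF rf[of k] rzz[of k]])
     (rule diff_lin3 | rule Mev rd[OF k1, symmetric] rdd[OF k1, symmetric] rA[OF k1, symmetric] r differentiable_const | simp add: detc)+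
  show ?B
    by (rule deriv_Lg_reflect(2)[OF rf[of k] rzz[of k]])
     (rule diff_lin3 | rule Mev rd[OF k1, symmetric] rdd[OF k1, symmetric] rA[OF k1, symmetric] r differentiable_const | simp add: detc)+
qed

end

section \<open>Curvature and kinetic term with coordinates 1 and 2 as the block\<close>

lemma pairmat_nth:
  "\<mu> \<noteq> \<nu> \<Longrightarrow> pairmat \<mu> \<nu> q G $ a $ b = (if a = \<mu> \<and> b = \<nu> \<or> a = \<nu> \<and> b = \<mu> then q else if a = b then G a else 0)"
  by (auto simp: pairmat_def doubleton_eq_iff)

text \<open>The part of \<open>trace_part\<close> that needs no connection of the block: second
  derivatives and squares of first derivatives of the warp factors.\<close>

definition wsum :: "(11 \<Rightarrow> real) \<Rightarrow> (11 \<Rightarrow> 11 \<Rightarrow> real) \<Rightarrow> (11 \<Rightarrow> 11 \<Rightarrow> 11 \<Rightarrow> real) \<Rightarrow> 11 \<Rightarrow> 11 \<Rightarrow> real" where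
  "wsum G d dd i j = (\<Sum>a\<in>-{1,2}. - (dd i j a / G a) + (3/4) * ((d i a / G a) * (d j a / G a)))"

text \<open>The logarithmic derivative of the product of the warp factors.\<close>

definition ysum :: "(11 \<Rightarrow> real) \<Rightarrow> (11 \<Rightarrow> 11 \<Rightarrow> real) \<Rightarrow> 11 \<Rightarrow> real" where
  "ysum G d i = (\<Sum>a\<in>-{1,2}. d i a / G a)"

context
  fixes q :: real and G :: "11 \<Rightarrow> real" and dq :: "11 \<Rightarrow> real" and d :: "11 \<Rightarrow> 11 \<Rightarrow> real"
    and ddq :: "11 \<Rightarrow> 11 \<Rightarrow> real" and dd :: "11 \<Rightarrow> 11 \<Rightarrow> 11 \<Rightarrow> real" and D :: real
  assumes G: "\<And>a. G a \<noteq> 0" and D: "D = G 1 * G 2 - q^2" "D \<noteq> 0"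
    and d0: "\<And>\<alpha>. \<alpha> \<notin> {1,2} \<Longrightarrow> dq \<alpha> = 0" "\<And>\<alpha> a. \<alpha> \<notin> {1,2} \<Longrightarrow> d \<alpha> a = 0"
    and dd0: "\<And>\<alpha> \<beta>. \<alpha> \<notin> {1,2} \<or> \<beta> \<notin> {1,2} \<Longrightarrow> ddq \<alpha> \<beta> = 0" "\<And>\<alpha> \<beta> a. \<alpha> \<notin> {1,2} \<or> \<beta> \<notin> {1,2} \<Longrightarrow> dd \<alpha> \<beta> a = 0"
    and sy: "ddq 2 1 = ddq 1 2" "dd 2 1 = dd 1 2"
begin

private abbreviation "g \<equiv> pairmat 1 2 q G"
private abbreviation "dg \<equiv> \<lambda>\<alpha>. pairmat 1 2 (dq \<alpha>) (d \<alpha>)"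
private abbreviation "ddg \<equiv> \<lambda>\<alpha> \<beta>. pairmat 1 2 (ddq \<alpha> \<beta>) (dd \<alpha> \<beta>)"
private abbreviation "W \<equiv> wsum G d dd"
private abbreviation "Y \<equiv> ysum G d"
private definition "M = (\<lambda>a b. pairmat 1 2 (- q / D) (\<lambda>a. if a = 1 then G 2 / D else if a = 2 then G 1 / D else 1 / G a) $ a $ b)"

private lemma M: "matrix_inv g $ a $ b = M a b"
  using matrix_inv_pairmat[of 1 2 G q, OF _ G, folded D(1)] D(2) by (simp add: M_def)

private lemma Mv: "M 1 1 = G 2 / D" "M 2 2 = G 1 / D" "M 1 2 = - q / D" "M 2 1 = - q / D"
  "a \<notin> {1,2} \<Longrightarrow> M a a = 1 / G a" "a \<notin> {1,2} \<Longrightarrow> a \<noteq> b \<Longrightarrow> M a b = 0" "b \<notin> {1,2} \<Longrightarrow> a \<noteq> b \<Longrightarrow> M a b = 0"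
  by (auto simp: M_def pairmat_nth)

private lemma dg0: "\<alpha> \<notin> {1,2} \<Longrightarrow> dg \<alpha> = 0" "\<alpha> \<notin> {1,2} \<or> \<beta> \<notin> {1,2} \<Longrightarrow> ddg \<alpha> \<beta> = 0"
  using d0 dd0 by (auto simp: pairmat_def vec_eq_iff)

private lemma prems:
  "(1::11) \<noteq> 2" "\<rho> \<noteq> \<tau> \<Longrightarrow> {\<rho>,\<tau>} \<noteq> {1,2} \<Longrightarrow> M \<rho> \<tau> = 0" "M 2 1 = M 1 2"
  "\<rho> \<noteq> \<tau> \<Longrightarrow> {\<rho>,\<tau>} \<noteq> {1,2} \<Longrightarrow> dg \<alpha> $ \<rho> $ \<tau> = 0" "dg \<alpha> $ 2 $ 1 = dg \<alpha> $ 1 $ 2"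
  "\<rho> \<noteq> \<tau> \<Longrightarrow> {\<rho>,\<tau>} \<noteq> {1,2} \<Longrightarrow> ddg \<alpha> \<beta> $ \<rho> $ \<tau> = 0" "ddg \<alpha> \<beta> $ 2 $ 1 = ddg \<alpha> \<beta> $ 1 $ 2"
  "ddg 2 1 = ddg 1 2"
  using sy by (auto simp: M_def pairmat_def)

private lemma ys: "(\<Sum>a\<in>-{1,2}. M a a * dg i $ a $ a) = Y i"
  unfolding ysum_def by (rule sum.cong) (auto simp: Mv pairmat_nth)

private lemma tp: "trace_part M g dg ddg 1 2 i j = W i j + christoffel g dg 1 i j * Y 1
   + christoffel g dg 2 i j * Y 2 - (1/4) * Y i * Y j"
proof -
  have "(\<Sum>a\<in>-{1,2}. - (M a a * ddg i j $ a $ a) + (3/4) * ((M a a * dg i $ a $ a) * (M a a * dg j $ a $ a))) = W i j"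
    unfolding wsum_def by (rule sum.cong) (auto simp: Mv pairmat_nth)
  then show ?thesis unfolding trace_part_def ys by simp
qed

lemma scalar_curvature_pairmat:
  "scalar_curvature g dg ddg =
    (2 / D) * (ddq 1 2 - dd 1 1 2 / 2 - dd 2 2 1 / 2
      + G 2 / D * ((d 2 1)\<^sup>2 / 4 - d 1 1 / 2 * (dq 2 - d 1 2 / 2))
      + G 1 / D * ((d 1 2)\<^sup>2 / 4 - d 2 2 / 2 * (dq 1 - d 2 1 / 2))
      - q / D * (d 2 1 * d 1 2 / 2 - d 1 1 * d 2 2 / 4 - (dq 2 - d 1 2 / 2) * (dq 1 - d 2 1 / 2)))
    + (G 2 / D * W 1 1 - 2 * q / D * W 1 2 + G 1 / D * W 2 2)
    - (1/4) * (G 2 / D * (Y 1)\<^sup>2 - 2 * q / D * Y 1 * Y 2 + G 1 / D * (Y 2)\<^sup>2)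
    + (G 2 / D * christoffel g dg 1 1 1 - 2 * q / D * christoffel g dg 1 1 2 + G 1 / D * christoffel g dg 1 2 2) * Y 1
    + (G 2 / D * christoffel g dg 2 1 1 - 2 * q / D * christoffel g dg 2 1 2 + G 1 / D * christoffel g dg 2 2 2) * Y 2"
proof -
  have *: "M 1 1 * M 2 2 - (M 1 2)\<^sup>2 = 1 / D"
  proof -
    have "M 1 1 * M 2 2 - (M 1 2)\<^sup>2 = (G 1 * G 2 - q^2) / D^2"
      unfolding Mv by (simp add: diff_divide_distrib power2_eq_square)
    then show ?thesis unfolding D(1)[symmetric] using D(2) by (simp add: power2_eq_square)
  qed
  show ?thesis
    apply (rule trans[OF scalar_curvature_block[of 1 2 g M dg ddg]])
    apply (rule prems(1))
    apply (rule M)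
    apply (erule (1) prems(2))
    apply (rule prems(3))
    apply (erule (1) prems(4))
    apply (rule prems(5))
    apply (erule dg0(1))
    apply (erule (1) prems(6))
    apply (rule prems(7))
    apply (erule dg0(2))
    apply (rule prems(8))
    unfolding * tp
    \<comment> \<open>The block determinant stays an atom and occurs only through its inverse, so
      that what remains is a polynomial identity.\<close>
    unfolding Mv divide_inverse[where b = D] minus_mult_left[symmetric]
    apply (simp add: pairmat_nth)
    apply (simp add: algebra_simps add_divide_distrib diff_divide_distrib power2_eq_square)
    done
qed

private lemma ch:
  assumes i: "i \<in> {1,2}"
  shows "christoffel g dg i \<nu> \<sigma> = (1/2) * (M i 1 * (dg \<nu> $ 1 $ \<sigma> + dg \<sigma> $ 1 $ \<nu> - dg 1 $ \<nu> $ \<sigma>)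
           + M i 2 * (dg \<nu> $ 2 $ \<sigma> + dg \<sigma> $ 2 $ \<nu> - dg 2 $ \<nu> $ \<sigma>))"
  apply (rule christoffel_block[of 1 2 g M dg ddg])
  apply (rule prems(1))
  apply (rule M)
  apply (erule (1) prems(2))
  apply (rule prems(3))
  apply (erule (1) prems(4))
  apply (rule prems(5))
  apply (erule dg0(1))
  apply (erule (1) prems(6))
  apply (rule prems(7))
  apply (erule dg0(2))
  apply (rule prems(8))
  apply (rule i)
  done

text \<open>Only symbols with equal lower indices are needed: in the curvature formula the mixed
  ones carry a factor \<open>q\<close>.\<close>

lemma christoffel_pairmat:
  assumes "q = 0" "\<And>i. dq i = 0"
  shows "christoffel g dg 1 1 1 = d 1 1 / (2 * G 1)" "christoffel g dg 1 2 2 = - d 1 2 / (2 * G 1)"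
    "christoffel g dg 2 1 1 = - d 2 1 / (2 * G 2)" "christoffel g dg 2 2 2 = d 2 2 / (2 * G 2)"
proof -
  have D': "D = G 1 * G 2" using D(1) assms by simp
  show "christoffel g dg 1 1 1 = d 1 1 / (2 * G 1)" "christoffel g dg 1 2 2 = - d 1 2 / (2 * G 1)"
    "christoffel g dg 2 1 1 = - d 2 1 / (2 * G 2)" "christoffel g dg 2 2 2 = d 2 2 / (2 * G 2)"
    using D(2) by (subst ch, simp, unfold Mv(1-4), simp add: pairmat_nth assms D' field_simps)+
qed

lemma field_strength_sq_pairmat:
  assumes v: "\<And>a. a \<notin> {1,2} \<Longrightarrow> v a = 0"
  shows "field_strength_sq g (\<lambda>\<alpha>. v \<alpha> *\<^sub>R \<omega>) = 24 / (G 9 * G 10 * G 11) *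
    (G 2 / D * (v 1)\<^sup>2 - 2 * q / D * v 1 * v 2 + G 1 / D * (v 2)\<^sup>2)"
proof -
  have 1: "field_strength_sq g (\<lambda>\<alpha>. v \<alpha> *\<^sub>R \<omega>) = 24 * (M 9 9 * M 10 10 * M 11 11) *
    (\<Sum>\<mu>\<in>UNIV. \<Sum>\<alpha>\<in>UNIV. v \<mu> * (M \<mu> \<alpha> * v \<alpha>))"
    unfolding M[symmetric]
    by (rule field_strength_sq_form3) (use v Mv in \<open>auto simp: M\<close>)
  have 2: "(\<Sum>\<mu>\<in>UNIV. \<Sum>\<alpha>\<in>UNIV. v \<mu> * (M \<mu> \<alpha> * v \<alpha>)) =
    (v 1 * (M 1 1 * v 1) + v 1 * (M 1 2 * v 2)) + (v 2 * (M 2 1 * v 1) + v 2 * (M 2 2 * v 2))"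
    by (subst sum_11_12, simp add: v, subst (1 2) sum_11_12) (simp_all add: v)
  show ?thesis unfolding 1 2 by (simp add: Mv) (simp add: algebra_simps power2_eq_square)
qed

lemma det_pairmat_12: "det g = D * (\<Prod>a\<in>-{1,2}. G a)"
  using det_pairmat[of 1 2 G q] G D by simp

end

lemma wsum_cong:
  "(\<And>a. a \<notin> {1,2} \<Longrightarrow> G a = G' a) \<Longrightarrow> (\<And>\<alpha> a. a \<notin> {1,2} \<Longrightarrow> d \<alpha> a = d' \<alpha> a) \<Longrightarrow>
   (\<And>\<alpha> \<beta> a. a \<notin> {1,2} \<Longrightarrow> dd \<alpha> \<beta> a = dd' \<alpha> \<beta> a) \<Longrightarrow> wsum G d dd i j = wsum G' d' dd' i j"
  unfolding wsum_def by (rule sum.cong) auto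

lemma ysum_cong:
  "(\<And>a. a \<notin> {1,2} \<Longrightarrow> G a = G' a) \<Longrightarrow> (\<And>\<alpha> a. a \<notin> {1,2} \<Longrightarrow> d \<alpha> a = d' \<alpha> a) \<Longrightarrow> ysum G d i = ysum G' d' i"
  unfolding ysum_def by (rule sum.cong) auto

lemma wsum_upd:
  assumes "a \<notin> {1,2}"
  shows "wsum (G(a := x)) (\<lambda>\<alpha>. (d \<alpha>)(a := x1 \<alpha>)) (\<lambda>\<alpha> \<beta>. (dd \<alpha> \<beta>)(a := x2 \<alpha> \<beta>)) i j
    = wsum G d dd i j - (- (dd i j a / G a) + (3/4) * ((d i a / G a) * (d j a / G a)))
      + (- (x2 i j / x) + (3/4) * ((x1 i / x) * (x1 j / x)))"
proof -
  have a: "a \<in> -{1,2}" using assms by auto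
  show ?thesis unfolding wsum_def by (subst (1 2) sum.remove[OF finite a]) (auto intro!: sum.cong)
qed

lemma ysum_upd:
  assumes "a \<notin> {1,2}"
  shows "ysum (G(a := x)) (\<lambda>\<alpha>. (d \<alpha>)(a := x1 \<alpha>)) i = ysum G d i - d i a / G a + x1 i / x"
proof -
  have a: "a \<in> -{1,2}" using assms by auto
  show ?thesis unfolding ysum_def by (subst (1 2) sum.remove[OF finite a]) (auto intro!: sum.cong)
qed

text \<open>The trivial updates are kept on purpose: in this form every varied jet matches the left
  side of \<open>Lg_block\<close>.\<close>

lemma diagm_unit_12:
  "diagm F + t *\<^sub>R metric_unit 1 1 = pairmat 1 2 0 (F(1 := F 1 + t, 2 := F 2))"
  "diagm F + t *\<^sub>R metric_unit 2 2 = pairmat 1 2 0 (F(1 := F 1, 2 := F 2 + t))"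
  "diagm F + t *\<^sub>R metric_unit 1 2 = pairmat 1 2 t (F(1 := F 1, 2 := F 2))"
  "diagm F = pairmat 1 2 0 (F(1 := F 1, 2 := F 2))"
  by (auto simp: diagm_def pairmat_def metric_unit_def vec_eq_iff doubleton_eq_iff)

subsection \<open>Derivatives of the Lagrangian at the brane background\<close>

text \<open>The functions \<open>mom0\<close>, \<open>mom1\<close> and \<open>mom2\<close> are the
  partial derivatives of the Lagrangian, along a metric direction \<open>w\<close>, in the metric
  and in its first and second derivatives.\<close>

definition mom0 where
  "mom0 \<epsilon> G G1 G2 A1 w = deriv (\<lambda>s. Lg \<epsilon> (diagm G + s *\<^sub>R w) (\<lambda>\<alpha>. diagm (G1 \<alpha>)) (\<lambda>\<alpha> \<beta>. diagm (G2 \<alpha> \<beta>)) (\<lambda>\<alpha>. A1 \<alpha> *\<^sub>R \<omega>)) 0"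

definition mom1 where
  "mom1 \<epsilon> G G1 G2 A1 w \<kappa> = deriv (\<lambda>s. Lg \<epsilon> (diagm G) (\<lambda>\<alpha>. diagm (G1 \<alpha>) + (if \<alpha> = \<kappa> then s else 0) *\<^sub>R w)
     (\<lambda>\<alpha> \<beta>. diagm (G2 \<alpha> \<beta>)) (\<lambda>\<alpha>. A1 \<alpha> *\<^sub>R \<omega>)) 0"

definition mom2 where
  "mom2 \<epsilon> G G1 G2 A1 w \<kappa> \<kappa>' = deriv (\<lambda>s. Lg \<epsilon> (diagm G) (\<lambda>\<alpha>. diagm (G1 \<alpha>))
     (\<lambda>\<alpha> \<beta>. diagm (G2 \<alpha> \<beta>) + half_pair \<kappa> \<kappa>' s \<alpha> \<beta> *\<^sub>R w)
     (\<lambda>\<alpha>. A1 \<alpha> *\<^sub>R \<omega>)) 0"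

text \<open>Agreement near 0 is all that can be had: the absolute value under the root is resolved
  and the divisions are legitimate only for small variations.\<close>

lemma deriv_eqI:
  fixes f h :: "real \<Rightarrow> real"
  assumes "DERIV h 0 :> d" "e > 0" "\<And>s. \<bar>s\<bar> < e \<Longrightarrow> f s = h s"
  shows "deriv f 0 = d"
proof -
  have "eventually (\<lambda>s::real. \<bar>s\<bar> < e) (nhds 0)"
    unfolding eventually_nhds_metric using assms(2) by (auto simp: dist_real_def)
  then have "eventually (\<lambda>s. f s = h s) (nhds 0)" by (rule eventually_mono) (rule assms(3))
  then show ?thesis using assms(1) DERIV_cong_ev[OF refl _ refl] DERIV_imp_deriv by metis
qed

text \<open>At \<open>s = 0\<close> every term in the bracket except \<open>\<rho>\<close> vanishes,
  so the product rule gives \<open>\<rho>\<close> times the derivative of the root plus the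
  derivatives of the remaining terms.\<close>

lemma DERIV_warp:
  fixes g \<rho> A B A' B' e k :: real
  assumes g: "g \<noteq> 0"
  shows "DERIV (\<lambda>s. sqrt ((g + s) / g) * (\<rho>
     + (- (A / (g + s)) + (3/4) * (B / (g + s))\<^sup>2 - (- (A / g) + (3/4) * (B / g)\<^sup>2) - (1/4) * (B / (g + s) - B / g)\<^sup>2)
     + (- (A' / (g + s)) + (3/4) * (B' / (g + s))\<^sup>2 - (- (A' / g) + (3/4) * (B' / g)\<^sup>2) - (1/4) * (B' / (g + s) - B' / g)\<^sup>2)
     + e * (k * (s / (g + s))))) 0 :>
     \<rho> / (2 * g) + (A / g\<^sup>2 - (3/2) * B\<^sup>2 / g ^ 3) + (A' / g\<^sup>2 - (3/2) * B'\<^sup>2 / g ^ 3) + e * k / g"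
proof -
  have 1: "DERIV (\<lambda>s. sqrt ((g + s) / g)) 0 :> 1 / (2 * g)"
    using g by (auto intro!: derivative_eq_intros simp: field_simps)
  have 2: "DERIV (\<lambda>s. - (A / (g + s)) + (3/4) * (B / (g + s))\<^sup>2 - (- (A / g) + (3/4) * (B / g)\<^sup>2) - (1/4) * (B / (g + s) - B / g)\<^sup>2) 0 :>
     A / g\<^sup>2 - (3/2) * B\<^sup>2 / g ^ 3" for A B
    using g by (auto intro!: derivative_eq_intros simp: field_simps power2_eq_square power3_eq_cube)
  have 3: "DERIV (\<lambda>s. e * (k * (s / (g + s)))) 0 :> e * k / g"
    using g by (auto intro!: derivative_eq_intros simp: field_simps)
  show ?thesis
    by (rule DERIV_cong[OF DERIV_mult[OF 1 DERIV_add[OF DERIV_add[OF DERIV_add[OF DERIV_const 2] 2] 3]]]) (use g in simp)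
qed

text \<open>The equations \<open>Y0\<close> and \<open>S\<close> say that the warp factors have constant product and that their second
  order contribution to the curvature equals the kinetic term of the 3-form.\<close>

locale brane_jet = diag_jet +
  fixes \<epsilon> lam :: real
  assumes lam: "G 1 = lam" "G 2 = lam" "lam > 0"
    and l1: "\<And>i. G1 i 2 = G1 i 1"
    and l2: "\<And>i j. G2 i j 2 = G2 i j 1"
    and sy: "G2 2 1 = G2 1 2"
    and prodC: "\<bar>\<Prod>a\<in>-{1,2}. G a\<bar> = 1"
    and Y0: "\<And>i. i \<in> {1,2} \<Longrightarrow> ysum G G1 i = 0"
    and S: "\<And>i j. i \<in> {1,2} \<Longrightarrow> j \<in> {1,2} \<Longrightarrow> wsum G G1 G2 i j = \<epsilon> / 2 * (A1 i * A1 j / (G 9 * G 10 * G 11))"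
begin

text \<open>\<open>S\<close> is an equation for each pair of block indices, and both sides are
  contracted with the same inverse block. The warp curvature therefore cancels the kinetic term for
  every block metric, before any derivative is taken; \<open>Y0\<close> removes the connection
  terms.\<close>

lemma Lg_block:
  fixes q p r :: real and dq dp dr :: "11 \<Rightarrow> real" and ddq ddp ddr :: "11 \<Rightarrow> 11 \<Rightarrow> real"
  assumes pr: "p \<noteq> 0" "r \<noteq> 0" and D: "D = p * r - q^2" "D \<noteq> 0"
    and d: "\<And>\<alpha>. \<alpha> \<notin> {1,2} \<Longrightarrow> dq \<alpha> = 0 \<and> dp \<alpha> = 0 \<and> dr \<alpha> = 0"
    and dd: "\<And>\<alpha> \<beta>. \<alpha> \<notin> {1,2} \<or> \<beta> \<notin> {1,2} \<Longrightarrow> ddq \<alpha> \<beta> = 0 \<and> ddp \<alpha> \<beta> = 0 \<and> ddr \<alpha> \<beta> = 0"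
    and s: "ddq 2 1 = ddq 1 2" "ddp 2 1 = ddp 1 2" "ddr 2 1 = ddr 1 2"
  shows "Lg \<epsilon> (pairmat 1 2 q (G(1 := p, 2 := r))) (\<lambda>\<alpha>. pairmat 1 2 (dq \<alpha>) ((G1 \<alpha>)(1 := dp \<alpha>, 2 := dr \<alpha>)))
     (\<lambda>\<alpha> \<beta>. pairmat 1 2 (ddq \<alpha> \<beta>) ((G2 \<alpha> \<beta>)(1 := ddp \<alpha> \<beta>, 2 := ddr \<alpha> \<beta>))) (\<lambda>\<alpha>. A1 \<alpha> *\<^sub>R \<omega>) =
   sqrt \<bar>D\<bar> * ((2 / D) * (ddq 1 2 - ddr 1 1 / 2 - ddp 2 2 / 2
      + r / D * ((dp 2)\<^sup>2 / 4 - dp 1 / 2 * (dq 2 - dr 1 / 2))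
      + p / D * ((dr 1)\<^sup>2 / 4 - dr 2 / 2 * (dq 1 - dp 2 / 2))
      - q / D * (dp 2 * dr 1 / 2 - dp 1 * dr 2 / 4 - (dq 2 - dr 1 / 2) * (dq 1 - dp 2 / 2))))"
proof -
  let ?G = "G(1 := p, 2 := r)" and ?d = "\<lambda>\<alpha>. (G1 \<alpha>)(1 := dp \<alpha>, 2 := dr \<alpha>)"
    and ?dd = "\<lambda>\<alpha> \<beta>. (G2 \<alpha> \<beta>)(1 := ddp \<alpha> \<beta>, 2 := ddr \<alpha> \<beta>)"
  have G': "?G a \<noteq> 0" for a using G pr by auto
  have D': "D = ?G 1 * ?G 2 - q^2" using D by simp
  have w: "wsum ?G ?d ?dd i j = wsum G G1 G2 i j" for i j by (rule wsum_cong) auto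
  have y: "ysum ?G ?d i = ysum G G1 i" for i by (rule ysum_cong) auto
  have d': "\<And>\<alpha>. \<alpha> \<notin> {1,2} \<Longrightarrow> dq \<alpha> = 0" "\<And>\<alpha> a. \<alpha> \<notin> {1,2} \<Longrightarrow> ?d \<alpha> a = 0"
    using d G1 by auto
  have dd': "\<And>\<alpha> \<beta>. \<alpha> \<notin> {1,2} \<or> \<beta> \<notin> {1,2} \<Longrightarrow> ddq \<alpha> \<beta> = 0" "\<And>\<alpha> \<beta> a. \<alpha> \<notin> {1,2} \<or> \<beta> \<notin> {1,2} \<Longrightarrow> ?dd \<alpha> \<beta> a = 0"
    using dd G2 by (blast, simp)
  have s': "?dd 2 1 = ?dd 1 2" using s sy by simp
  have pc: "(\<Prod>a\<in>-{1,2}. ?G a) = (\<Prod>a\<in>-{1,2}. G a)" by (rule prod.cong) auto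
  have det: "sqrt \<bar>det (pairmat 1 2 q ?G)\<bar> = sqrt \<bar>D\<bar>"
  proof -
    have "det (pairmat 1 2 q ?G) = D * (\<Prod>b\<in>-{1,2}. ?G b)"
      by (rule det_pairmat_12[of ?G D q dq ?d ddq ?dd]) (rule G' D' D(2) d' dd' s(1) s'; assumption?)+
    then show ?thesis unfolding pc by (simp only: abs_mult prodC mult_1_right)
  qed
  have F: "field_strength_sq (pairmat 1 2 q ?G) (\<lambda>\<alpha>. A1 \<alpha> *\<^sub>R \<omega>) = 24 / (?G 9 * ?G 10 * ?G 11) *
    (?G 2 / D * (A1 1)\<^sup>2 - 2 * q / D * A1 1 * A1 2 + ?G 1 / D * (A1 2)\<^sup>2)"
    by (rule field_strength_sq_pairmat[of ?G D q dq ?d ddq ?dd]) (rule G' D' D(2) d' dd' s(1) s' A1; assumption?)+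
  have R: "scalar_curvature (pairmat 1 2 q ?G) (\<lambda>\<alpha>. pairmat 1 2 (dq \<alpha>) (?d \<alpha>)) (\<lambda>\<alpha> \<beta>. pairmat 1 2 (ddq \<alpha> \<beta>) (?dd \<alpha> \<beta>)) =
    (2 / D) * (ddq 1 2 - ddr 1 1 / 2 - ddp 2 2 / 2
      + r / D * ((dp 2)\<^sup>2 / 4 - dp 1 / 2 * (dq 2 - dr 1 / 2))
      + p / D * ((dr 1)\<^sup>2 / 4 - dr 2 / 2 * (dq 1 - dp 2 / 2))
      - q / D * (dp 2 * dr 1 / 2 - dp 1 * dr 2 / 4 - (dq 2 - dr 1 / 2) * (dq 1 - dp 2 / 2)))
    + (r / D * wsum G G1 G2 1 1 - 2 * q / D * wsum G G1 G2 1 2 + p / D * wsum G G1 G2 2 2)"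
    by (subst scalar_curvature_pairmat[of ?G D q dq ?d ddq ?dd])
      ((rule G' D' D(2) d' dd' s(1) s'; assumption?)+, simp add: w y Y0)
  \<comment> \<open>The factor 24 of \<open>field_strength_sq\<close> over 2 * 4! is the 1/2 in
    \<open>S\<close>.\<close>
  have c: "r / D * wsum G G1 G2 1 1 - 2 * q / D * wsum G G1 G2 1 2 + p / D * wsum G G1 G2 2 2
    = \<epsilon> / (2 * fact 4) * field_strength_sq (pairmat 1 2 q ?G) (\<lambda>\<alpha>. A1 \<alpha> *\<^sub>R \<omega>)"
    unfolding F using S[of 1 1] S[of 1 2] S[of 2 2]
    by (simp add: fact_numeral power2_eq_square algebra_simps add_divide_distrib diff_divide_distrib)
  show ?thesis unfolding Lg_def det R c by simp
qed

text \<open>The root of the determinant is \<open>lam\<close> times the root of the ratio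
  \<open>x / G a\<close>, and that \<open>lam\<close> cancels the 1/lam in the curvature and in the
  kinetic term. The unvaried part of \<open>wsum\<close> is traded by \<open>S\<close> for a kinetic
  term, whence the difference of the two inverse products; by \<open>Y0\<close>, \<open>ysum\<close>
  reduces to the change in the entry \<open>a\<close>.\<close>

lemma Lg_warp:
  fixes x :: real and x1 :: "11 \<Rightarrow> real" and x2 :: "11 \<Rightarrow> 11 \<Rightarrow> real"
  assumes a: "a \<notin> {1,2}" and x: "x \<noteq> 0"
    and d: "\<And>\<alpha>. \<alpha> \<notin> {1,2} \<Longrightarrow> x1 \<alpha> = 0"
    and dd: "\<And>\<alpha> \<beta>. \<alpha> \<notin> {1,2} \<or> \<beta> \<notin> {1,2} \<Longrightarrow> x2 \<alpha> \<beta> = 0"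
    and s: "x2 2 1 = x2 1 2"
  defines "G' \<equiv> G(a := x)"
  shows "Lg \<epsilon> (diagm G') (\<lambda>\<alpha>. diagm ((G1 \<alpha>)(a := x1 \<alpha>)))
     (\<lambda>\<alpha> \<beta>. diagm ((G2 \<alpha> \<beta>)(a := x2 \<alpha> \<beta>))) (\<lambda>\<alpha>. A1 \<alpha> *\<^sub>R \<omega>) =
   sqrt \<bar>x / G a\<bar> * (- (G2 1 1 1 + G2 2 2 1) / lam + ((G1 1 1)\<^sup>2 + (G1 2 1)\<^sup>2) / lam\<^sup>2
     + (- (x2 1 1 / x) + (3/4) * (x1 1 / x)\<^sup>2 - (- (G2 1 1 a / G a) + (3/4) * (G1 1 a / G a)\<^sup>2) - (1/4) * (x1 1 / x - G1 1 a / G a)\<^sup>2)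
     + (- (x2 2 2 / x) + (3/4) * (x1 2 / x)\<^sup>2 - (- (G2 2 2 a / G a) + (3/4) * (G1 2 a / G a)\<^sup>2) - (1/4) * (x1 2 / x - G1 2 a / G a)\<^sup>2)
     + \<epsilon> / 2 * ((A1 1)\<^sup>2 + (A1 2)\<^sup>2) * (1 / (G 9 * G 10 * G 11) - 1 / (G' 9 * G' 10 * G' 11)))"
proof -
  let ?d = "\<lambda>\<alpha>. (G1 \<alpha>)(a := x1 \<alpha>)" and ?dd = "\<lambda>\<alpha> \<beta>. (G2 \<alpha> \<beta>)(a := x2 \<alpha> \<beta>)"
  define D where "D = lam\<^sup>2"
  have a': "a \<noteq> 1" "a \<noteq> 2" "1 \<noteq> a" "2 \<noteq> a" using a by auto
  have Gn: "G' b \<noteq> 0" for b using G x by (simp add: G'_def)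
  have G12: "G' 1 = lam" "G' 2 = lam" using lam a' by (simp_all add: G'_def)
  have D': "D = G' 1 * G' 2 - 0^2" "D \<noteq> 0" using lam by (simp_all add: D_def G12 power2_eq_square)
  have d': "\<And>\<alpha> b. \<alpha> \<notin> {1,2} \<Longrightarrow> ?d \<alpha> b = 0"
    using d G1 by auto
  have dd': "\<And>\<alpha> \<beta> b. \<alpha> \<notin> {1,2} \<or> \<beta> \<notin> {1,2} \<Longrightarrow> ?dd \<alpha> \<beta> b = 0"
    using dd G2 by auto
  have s': "?dd 2 1 = ?dd 1 2" using s sy by simp
  have p: "diagm F = pairmat 1 2 0 F" for F :: "11 \<Rightarrow> real" by (rule diagm_pairmat) simp
  have pc: "(\<Prod>b\<in>-{1,2}. G' b) = x / G a * (\<Prod>b\<in>-{1,2}. G b)"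
  proof -
    have aa: "a \<in> -{1,2}" using a by auto
    have "(\<Prod>b\<in>-{1,2}-{a}. G' b) = (\<Prod>b\<in>-{1,2}-{a}. G b)" by (rule prod.cong) (auto simp: G'_def)
    then show ?thesis using G[of a] by (simp add: prod.remove[OF finite aa] G'_def)
  qed
  have det: "sqrt \<bar>det (pairmat 1 2 0 G')\<bar> = lam * sqrt \<bar>x / G a\<bar>"
  proof -
    have "det (pairmat 1 2 0 G') = D * (\<Prod>b\<in>-{1,2}. G' b)"
      by (rule det_pairmat_12[of G' D 0 "\<lambda>_. 0" ?d "\<lambda>_ _. 0" ?dd]) (rule Gn D' d' dd' refl s'; assumption?)+
    then have "\<bar>det (pairmat 1 2 0 G')\<bar> = lam\<^sup>2 * \<bar>x / G a\<bar>"
      using prodC by (simp add: pc D_def abs_mult)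
    then show ?thesis by (simp only: real_sqrt_mult real_sqrt_abs abs_of_pos[OF lam(3)])
  qed
  have F: "field_strength_sq (pairmat 1 2 0 G') (\<lambda>\<alpha>. A1 \<alpha> *\<^sub>R \<omega>) = 24 / (G' 9 * G' 10 * G' 11) *
    (G' 2 / D * (A1 1)\<^sup>2 - 2 * 0 / D * A1 1 * A1 2 + G' 1 / D * (A1 2)\<^sup>2)"
    by (rule field_strength_sq_pairmat[of G' D 0 "\<lambda>_. 0" ?d "\<lambda>_ _. 0" ?dd]) (rule Gn D' d' dd' refl s' A1; assumption?)+
  have F': "field_strength_sq (pairmat 1 2 0 G') (\<lambda>\<alpha>. A1 \<alpha> *\<^sub>R \<omega>) = 24 / (G' 9 * G' 10 * G' 11) * (((A1 1)\<^sup>2 + (A1 2)\<^sup>2) / lam)"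
    unfolding F G12 D_def using lam by (simp add: power2_eq_square add_divide_distrib)
  have ch: "christoffel (pairmat 1 2 0 G') (\<lambda>\<alpha>. pairmat 1 2 0 (?d \<alpha>)) 1 1 1 = ?d 1 1 / (2 * G' 1)"
    "christoffel (pairmat 1 2 0 G') (\<lambda>\<alpha>. pairmat 1 2 0 (?d \<alpha>)) 1 2 2 = - ?d 1 2 / (2 * G' 1)"
    "christoffel (pairmat 1 2 0 G') (\<lambda>\<alpha>. pairmat 1 2 0 (?d \<alpha>)) 2 1 1 = - ?d 2 1 / (2 * G' 2)"
    "christoffel (pairmat 1 2 0 G') (\<lambda>\<alpha>. pairmat 1 2 0 (?d \<alpha>)) 2 2 2 = ?d 2 2 / (2 * G' 2)"
    by (rule christoffel_pairmat[of G' D 0 "\<lambda>_. 0" ?d "\<lambda>_ _. 0" ?dd]; (rule Gn D' d' dd' refl s'; assumption?))+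
  \<comment> \<open>The connection terms multiplying \<open>ysum\<close> cancel because isothermal
    coordinates are harmonic: the conformal block has
    \<open>\<Gamma> k 1 1 + \<Gamma> k 2 2 = 0\<close>.\<close>
  have R: "scalar_curvature (pairmat 1 2 0 G') (\<lambda>\<alpha>. pairmat 1 2 0 (?d \<alpha>)) (\<lambda>\<alpha> \<beta>. pairmat 1 2 0 (?dd \<alpha> \<beta>)) =
    (1 / lam) * (- (G2 1 1 1 + G2 2 2 1) / lam + ((G1 1 1)\<^sup>2 + (G1 2 1)\<^sup>2) / lam\<^sup>2
     + wsum G' ?d ?dd 1 1 + wsum G' ?d ?dd 2 2 - (1/4) * ((ysum G' ?d 1)\<^sup>2 + (ysum G' ?d 2)\<^sup>2))"
    apply (subst scalar_curvature_pairmat[of G' D 0 "\<lambda>_. 0" ?d "\<lambda>_ _. 0" ?dd])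
    apply (rule Gn D' d' dd' refl s'; assumption?)+
    unfolding ch G12 D_def
    using lam(3) apply (simp add: a' l1 l2 fun_upd_other)
    apply (simp add: field_simps power2_eq_square)
    done
  have w: "wsum G' ?d ?dd i j = wsum G G1 G2 i j - (- (G2 i j a / G a) + (3/4) * ((G1 i a / G a) * (G1 j a / G a)))
      + (- (x2 i j / x) + (3/4) * ((x1 i / x) * (x1 j / x)))" for i j
    unfolding G'_def by (rule wsum_upd[OF a])
  have y: "ysum G' ?d i = ysum G G1 i - G1 i a / G a + x1 i / x" for i
    unfolding G'_def by (rule ysum_upd[OF a])
  have alg: "lam * sq * ((1 / lam) * X - \<epsilon> / (2 * fact 4) * (24 / K * (V / lam))) = sq * (X - \<epsilon> / 2 * V / K)" for X V K sq
    using lam(3) by (cases "K = 0") (simp_all add: fact_numeral field_simps)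
  show ?thesis
    unfolding Lg_def p det R F' alg
    unfolding w y S[OF insertI1 insertI1] S[of 2 2, simplified] Y0[OF insertI1] Y0[of 2, simplified]
    by (simp add: power2_eq_square algebra_simps add_divide_distrib diff_divide_distrib)
qed

text \<open>\<open>Q\<close> and \<open>Lap\<close> are the squared gradient and the Laplacian of
  the conformal factor \<open>lam\<close>; \<open>curv\<close> is the bracket of
  \<open>Lg_block\<close> with the first derivatives left at the background.\<close>

abbreviation "Q \<equiv> (G1 1 1)\<^sup>2 + (G1 2 1)\<^sup>2"
abbreviation "Lap \<equiv> G2 1 1 1 + G2 2 2 1"
abbreviation "curv D q p r b e1 e2 \<equiv> b - e1 / 2 - e2 / 2
   + r / D * ((G1 2 1)\<^sup>2 / 4 - G1 1 1 / 2 * (0 - G1 1 1 / 2))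
   + p / D * ((G1 1 1)\<^sup>2 / 4 - G1 2 1 / 2 * (0 - G1 2 1 / 2))
   - q / D * (G1 2 1 * G1 1 1 / 2 - G1 1 1 * G1 2 1 / 4 - (0 - G1 1 1 / 2) * (0 - G1 2 1 / 2))"
abbreviation "jet0 w \<equiv> \<lambda>s. Lg \<epsilon> (diagm G + s *\<^sub>R w) (\<lambda>\<alpha>. diagm (G1 \<alpha>)) (\<lambda>\<alpha> \<beta>. diagm (G2 \<alpha> \<beta>)) (\<lambda>\<alpha>. A1 \<alpha> *\<^sub>R \<omega>)"
abbreviation "jet1 w \<kappa> \<equiv> \<lambda>s. Lg \<epsilon> (diagm G) (\<lambda>\<alpha>. diagm (G1 \<alpha>) + (if \<alpha> = \<kappa> then s else 0) *\<^sub>R w)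
  (\<lambda>\<alpha> \<beta>. diagm (G2 \<alpha> \<beta>)) (\<lambda>\<alpha>. A1 \<alpha> *\<^sub>R \<omega>)"
abbreviation "jet2 w P \<equiv> Lg \<epsilon> (diagm G) (\<lambda>\<alpha>. diagm (G1 \<alpha>)) (\<lambda>\<alpha> \<beta>. diagm (G2 \<alpha> \<beta>) + P \<alpha> \<beta> *\<^sub>R w) (\<lambda>\<alpha>. A1 \<alpha> *\<^sub>R \<omega>)"

lemma curv: "curv D q p r b e1 e2 = b - (e1 + e2) / 2 + r / D * (Q / 4) + p / D * (Q / 4)"
  by (simp add: algebra_simps power2_eq_square add_divide_distrib diff_divide_distrib)

text \<open>Not zero by itself: in \<open>eom_11\<close> it is cancelled by the total derivatives of
  \<open>mom1_11\<close> and \<open>mom2_11\<close>, as befits the two-dimensional Einstein-Hilbert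
  density.\<close>

lemma mom0_11: "mom0 \<epsilon> G G1 G2 A1 (metric_unit 1 1) = Lap / (2 * lam\<^sup>2) - Q / lam ^ 3"
proof -
  let ?h = "\<lambda>s. sqrt ((lam + s) * lam) * ((2 / ((lam + s) * lam)) * (0 - Lap / 2 + lam / ((lam + s) * lam) * (Q / 4) + 1 / lam * (Q / 4)))"
  have "DERIV (\<lambda>s. sqrt ((lam + s) * lam)) 0 :> 1 / 2"
    using lam(3) by (auto intro!: derivative_eq_intros simp: field_simps)
  then have h: "DERIV ?h 0 :> Lap / (2 * lam\<^sup>2) - Q / lam ^ 3"
    using lam(3) by (auto intro!: derivative_eq_intros) (simp add: field_simps power2_eq_square power3_eq_cube)
  have "jet0 (metric_unit 1 1) s = ?h s" if s: "\<bar>s\<bar> < lam" for s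
  proof -
    have p: "(lam + s) * lam > 0" using s lam(3) by simp
    have r: "(lam + s) / ((lam + s) * lam) = 1 / lam" using s by simp
    have "jet0 (metric_unit 1 1) s = sqrt \<bar>(lam + s) * lam\<bar> * ((2 / ((lam + s) * lam)) *
       curv ((lam + s) * lam) 0 (lam + s) lam 0 (G2 1 1 1) (G2 2 2 1))"
      unfolding diagm_unit_12(1)[of G] diagm_unit_12(4)[of "G1 _"] diagm_unit_12(4)[of "G2 _ _"]
      by (subst Lg_block[of _ _ "(lam + s) * lam"]) (use p lam(3) s in \<open>simp_all add: lam(1,2) G1 G2 l1 l2 sy\<close>)
    then show ?thesis unfolding curv unfolding r using p by simp
  qed
  then show ?thesis unfolding mom0_def by (rule deriv_eqI[OF h lam(3)])
qed

lemma mom0_22: "mom0 \<epsilon> G G1 G2 A1 (metric_unit 2 2) = Lap / (2 * lam\<^sup>2) - Q / lam ^ 3"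
proof -
  let ?h = "\<lambda>s. sqrt (lam * (lam + s)) * ((2 / (lam * (lam + s))) * (0 - Lap / 2 + 1 / lam * (Q / 4) + lam / (lam * (lam + s)) * (Q / 4)))"
  have "DERIV (\<lambda>s. sqrt (lam * (lam + s))) 0 :> 1 / 2"
    using lam(3) by (auto intro!: derivative_eq_intros simp: field_simps)
  then have h: "DERIV ?h 0 :> Lap / (2 * lam\<^sup>2) - Q / lam ^ 3"
    using lam(3) by (auto intro!: derivative_eq_intros) (simp add: field_simps power2_eq_square power3_eq_cube)
  have "jet0 (metric_unit 2 2) s = ?h s" if s: "\<bar>s\<bar> < lam" for s
  proof -
    have p: "lam * (lam + s) > 0" using s lam(3) by simp
    have r: "(lam + s) / (lam * (lam + s)) = 1 / lam" using s by simp
    have "jet0 (metric_unit 2 2) s = sqrt \<bar>lam * (lam + s)\<bar> * ((2 / (lam * (lam + s))) *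
       curv (lam * (lam + s)) 0 lam (lam + s) 0 (G2 1 1 1) (G2 2 2 1))"
      unfolding diagm_unit_12(2)[of G] diagm_unit_12(4)[of "G1 _"] diagm_unit_12(4)[of "G2 _ _"]
      by (subst Lg_block[of _ _ "lam * (lam + s)"]) (use p lam(3) s in \<open>simp_all add: lam(1,2) G1 G2 l1 l2 sy\<close>)
    then show ?thesis unfolding curv unfolding r using p by simp
  qed
  then show ?thesis unfolding mom0_def by (rule deriv_eqI[OF h lam(3)])
qed

text \<open>The block determinant is \<open>lam * lam - s\<^sup>2\<close> and the mixed term of the
  bracket vanishes at the background derivatives, so the function is even in
  \<open>s\<close>.\<close>

lemma mom0_12: "mom0 \<epsilon> G G1 G2 A1 (metric_unit 1 2) = 0"
proof -
  let ?h = "\<lambda>s. sqrt (lam * lam - s\<^sup>2) * ((2 / (lam * lam - s\<^sup>2)) * (0 - Lap / 2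
      + lam / (lam * lam - s\<^sup>2) * (Q / 4) + lam / (lam * lam - s\<^sup>2) * (Q / 4)))"
  have "DERIV (\<lambda>s. sqrt (lam * lam - s\<^sup>2)) 0 :> 0"
    using lam(3) by (auto intro!: derivative_eq_intros simp: field_simps)
  then have h: "DERIV ?h 0 :> 0" using lam(3) by (auto intro!: derivative_eq_intros)
  have "jet0 (metric_unit 1 2) s = ?h s" if s: "\<bar>s\<bar> < lam" for s
  proof -
    have "s\<^sup>2 < lam\<^sup>2" using power_strict_mono[of "\<bar>s\<bar>" lam 2] s by simp
    then have p: "lam * lam - s\<^sup>2 > 0" by (simp add: power2_eq_square)
    have "jet0 (metric_unit 1 2) s = sqrt \<bar>lam * lam - s\<^sup>2\<bar> * ((2 / (lam * lam - s\<^sup>2)) *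
       curv (lam * lam - s\<^sup>2) s lam lam 0 (G2 1 1 1) (G2 2 2 1))"
      unfolding diagm_unit_12(3)[of G] diagm_unit_12(4)[of "G1 _"] diagm_unit_12(4)[of "G2 _ _"]
      by (subst Lg_block[of _ _ "lam * lam - s\<^sup>2"]) (use p lam(3) s in \<open>simp_all add: lam(1,2) G1 G2 l1 l2 sy\<close>)
    then show ?thesis unfolding curv using p by simp
  qed
  then show ?thesis unfolding mom0_def by (rule deriv_eqI[OF h lam(3)])
qed

lemma sqrt_lam: "sqrt \<bar>lam * lam\<bar> = lam" using lam(3) by (simp add: abs_mult)

text \<open>In the bracket the derivative of g_11 along 1 occurs only linearly, with weight 1/4,
  while the one along 2 also occurs squared, with total weight 3/4 at the background. Both are
  doubled by the prefactor.\<close>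

lemma mom1_11:
  assumes "\<kappa> \<in> {1,2}"
  shows "mom1 \<epsilon> G G1 G2 A1 (metric_unit 1 1) \<kappa> = (if \<kappa> = 1 then 1/2 else 3/2) * G1 \<kappa> 1 / lam\<^sup>2"
proof -
  let ?h = "\<lambda>s. lam * ((2 / (lam * lam)) * (- Lap / 2
      + lam / (lam * lam) * ((G1 2 1 + (if \<kappa> = 2 then s else 0))\<^sup>2 / 4 + (G1 1 1 + (if \<kappa> = 1 then s else 0)) / 4 * G1 1 1)
      + lam / (lam * lam) * ((G1 1 1)\<^sup>2 / 4 + G1 2 1 / 4 * (G1 2 1 + (if \<kappa> = 2 then s else 0)))))"
  have h: "DERIV ?h 0 :> (if \<kappa> = 1 then 1/2 else 3/2) * G1 \<kappa> 1 / lam\<^sup>2"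
    using lam(3) assms by (auto intro!: derivative_eq_intros simp: field_simps power2_eq_square)
  have "jet1 (metric_unit 1 1) \<kappa> s = ?h s" for s
    unfolding diagm_unit_12(4)[of G] diagm_unit_12(1)[of "G1 _"] diagm_unit_12(4)[of "G2 _ _"]
    apply (subst Lg_block[of _ _ "lam * lam"])
    using lam G1 G2 l1 l2 sy assms by (auto simp: algebra_simps add_divide_distrib diff_divide_distrib power2_eq_square sqrt_lam)
  then show ?thesis unfolding mom1_def by (rule deriv_eqI[OF h zero_less_one])
qed

lemma mom1_22:
  assumes "\<kappa> \<in> {1,2}"
  shows "mom1 \<epsilon> G G1 G2 A1 (metric_unit 2 2) \<kappa> = (if \<kappa> = 2 then 1/2 else 3/2) * G1 \<kappa> 1 / lam\<^sup>2"
proof -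
  let ?h = "\<lambda>s. lam * ((2 / (lam * lam)) * (- Lap / 2
      + lam / (lam * lam) * ((G1 2 1)\<^sup>2 / 4 + G1 1 1 / 4 * (G1 1 1 + (if \<kappa> = 1 then s else 0)))
      + lam / (lam * lam) * ((G1 1 1 + (if \<kappa> = 1 then s else 0))\<^sup>2 / 4 + (G1 2 1 + (if \<kappa> = 2 then s else 0)) / 4 * G1 2 1)))"
  have h: "DERIV ?h 0 :> (if \<kappa> = 2 then 1/2 else 3/2) * G1 \<kappa> 1 / lam\<^sup>2"
    using lam(3) assms by (auto intro!: derivative_eq_intros simp: field_simps power2_eq_square)
  have "jet1 (metric_unit 2 2) \<kappa> s = ?h s" for s
    unfolding diagm_unit_12(4)[of G] diagm_unit_12(2)[of "G1 _"] diagm_unit_12(4)[of "G2 _ _"]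
    apply (subst Lg_block[of _ _ "lam * lam"])
    using lam G1 G2 l1 l2 sy assms by (auto simp: algebra_simps add_divide_distrib diff_divide_distrib power2_eq_square sqrt_lam)
  then show ?thesis unfolding mom1_def by (rule deriv_eqI[OF h zero_less_one])
qed

text \<open>In the bracket the derivative of g_12 along one block direction multiplies the
  derivative of the conformal factor along the other, which explains the exchanged index.\<close>

lemma mom1_12:
  assumes "\<kappa> \<in> {1,2}"
  shows "mom1 \<epsilon> G G1 G2 A1 (metric_unit 1 2) \<kappa> = - 1 * G1 (if \<kappa> = 1 then 2 else 1) 1 / lam\<^sup>2"
proof -
  let ?h = "\<lambda>s. lam * ((2 / (lam * lam)) * (- Lap / 2
      + lam / (lam * lam) * ((G1 2 1)\<^sup>2 / 4 - G1 1 1 / 2 * ((if \<kappa> = 2 then s else 0) - G1 1 1 / 2))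
      + lam / (lam * lam) * ((G1 1 1)\<^sup>2 / 4 - G1 2 1 / 2 * ((if \<kappa> = 1 then s else 0) - G1 2 1 / 2))))"
  have h: "DERIV ?h 0 :> - 1 * G1 (if \<kappa> = 1 then 2 else 1) 1 / lam\<^sup>2"
    using lam(3) assms by (auto intro!: derivative_eq_intros simp: field_simps power2_eq_square)
  have "jet1 (metric_unit 1 2) \<kappa> s = ?h s" for s
    unfolding diagm_unit_12(4)[of G] diagm_unit_12(3)[of "G1 _"] diagm_unit_12(4)[of "G2 _ _"]
    apply (subst Lg_block[of _ _ "lam * lam"])
    using lam G1 G2 l1 l2 sy assms by (auto simp: algebra_simps add_divide_distrib diff_divide_distrib power2_eq_square sqrt_lam)
  then show ?thesis unfolding mom1_def by (rule deriv_eqI[OF h zero_less_one])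
qed

text \<open>At the background block the curvature is affine in the second derivatives, and their
  coefficients here are the values of \<open>mom2\<close>.\<close>

lemma curv_flat: "sqrt \<bar>lam * lam\<bar> * ((2 / (lam * lam)) * curv (lam * lam) 0 lam lam b e1 e2) = (2 * b - e1 - e2) / lam + Q / lam\<^sup>2"
  unfolding curv sqrt_lam using lam(3) by (simp add: field_simps power2_eq_square)

lemma mom2_11:
  assumes k: "\<kappa> \<in> {1,2}" "\<kappa>' \<in> {1,2}"
  shows "mom2 \<epsilon> G G1 G2 A1 (metric_unit 1 1) \<kappa> \<kappa>' = (if \<kappa> = 2 \<and> \<kappa>' = 2 then - 1 else 0) / lam"
proof -
  have h: "DERIV (\<lambda>s. (2 * 0 - G2 1 1 1 - (G2 2 2 1 + half_pair \<kappa> \<kappa>' s 2 2)) / lam + Q / lam\<^sup>2) 0 :>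
     (if \<kappa> = 2 \<and> \<kappa>' = 2 then - 1 else 0) / lam"
    unfolding half_pair_def using lam(3) k by (auto intro!: derivative_eq_intros)
  have "jet2 (metric_unit 1 1) (half_pair \<kappa> \<kappa>' s) = sqrt \<bar>lam * lam\<bar> * ((2 / (lam * lam)) *
     curv (lam * lam) 0 lam lam 0 (G2 1 1 1) (G2 2 2 1 + half_pair \<kappa> \<kappa>' s 2 2))" for s
    unfolding diagm_unit_12(4)[of G] diagm_unit_12(4)[of "G1 _"] diagm_unit_12(1)[of "G2 _ _"]
    by (subst Lg_block[of _ _ "lam * lam"]) (use lam(3) in \<open>simp_all add: lam(1,2) G1 G2 l1 l2 sy half_pair[OF k]\<close>)
  then show ?thesis unfolding mom2_def curv_flat by (rule deriv_eqI[OF h zero_less_one])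
qed

lemma mom2_22:
  assumes k: "\<kappa> \<in> {1,2}" "\<kappa>' \<in> {1,2}"
  shows "mom2 \<epsilon> G G1 G2 A1 (metric_unit 2 2) \<kappa> \<kappa>' = (if \<kappa> = 1 \<and> \<kappa>' = 1 then - 1 else 0) / lam"
proof -
  have h: "DERIV (\<lambda>s. (2 * 0 - (G2 1 1 1 + half_pair \<kappa> \<kappa>' s 1 1) - G2 2 2 1) / lam + Q / lam\<^sup>2) 0 :>
     (if \<kappa> = 1 \<and> \<kappa>' = 1 then - 1 else 0) / lam"
    unfolding half_pair_def using lam(3) k by (auto intro!: derivative_eq_intros)
  have "jet2 (metric_unit 2 2) (half_pair \<kappa> \<kappa>' s) = sqrt \<bar>lam * lam\<bar> * ((2 / (lam * lam)) *
     curv (lam * lam) 0 lam lam 0 (G2 1 1 1 + half_pair \<kappa> \<kappa>' s 1 1) (G2 2 2 1))" for s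
    unfolding diagm_unit_12(4)[of G] diagm_unit_12(4)[of "G1 _"] diagm_unit_12(2)[of "G2 _ _"]
    by (subst Lg_block[of _ _ "lam * lam"]) (use lam(3) in \<open>simp_all add: lam(1,2) G1 G2 l1 l2 sy half_pair[OF k]\<close>)
  then show ?thesis unfolding mom2_def curv_flat by (rule deriv_eqI[OF h zero_less_one])
qed

lemma mom2_12:
  assumes k: "\<kappa> \<in> {1,2}" "\<kappa>' \<in> {1,2}"
  shows "mom2 \<epsilon> G G1 G2 A1 (metric_unit 1 2) \<kappa> \<kappa>' = (if \<kappa> \<noteq> \<kappa>' then 1 else 0) / lam"
proof -
  have h: "DERIV (\<lambda>s. (2 * half_pair \<kappa> \<kappa>' s 1 2 - G2 1 1 1 - G2 2 2 1) / lam + Q / lam\<^sup>2) 0 :>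
     (if \<kappa> \<noteq> \<kappa>' then 1 else 0) / lam"
    unfolding half_pair_def using lam(3) k by (auto intro!: derivative_eq_intros)
  have "jet2 (metric_unit 1 2) (half_pair \<kappa> \<kappa>' s) = sqrt \<bar>lam * lam\<bar> * ((2 / (lam * lam)) *
     curv (lam * lam) 0 lam lam (half_pair \<kappa> \<kappa>' s 1 2) (G2 1 1 1) (G2 2 2 1))" for s
    unfolding diagm_unit_12(4)[of G] diagm_unit_12(4)[of "G1 _"] diagm_unit_12(3)[of "G2 _ _"]
    by (subst Lg_block[of _ _ "lam * lam"]) (use lam(3) in \<open>simp_all add: lam(1,2) G1 G2 l1 l2 sy half_pair[OF k]\<close>)
  then show ?thesis unfolding mom2_def curv_flat by (rule deriv_eqI[OF h zero_less_one])
qed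

text \<open>Minus the Laplacian of ln \<open>lam\<close>, that is, \<open>lam\<close> times the
  scalar curvature of the block.\<close>

abbreviation "\<rho> \<equiv> - Lap / lam + Q / lam\<^sup>2"
abbreviation "K \<equiv> G 9 * G 10 * G 11"

text \<open>The root of the determinant contributes half of \<open>\<rho>\<close> over
  \<open>G a\<close>. The last summand is the response of the kinetic term, which feels
  \<open>G a\<close> only along 9, 10, 11.\<close>

lemma mom0_aa:
  assumes a: "a \<notin> {1,2}"
  shows "mom0 \<epsilon> G G1 G2 A1 (metric_unit a a) = \<rho> / (2 * G a) + (G2 1 1 a / (G a)\<^sup>2 - (3/2) * (G1 1 a)\<^sup>2 / G a ^ 3)
     + (G2 2 2 a / (G a)\<^sup>2 - (3/2) * (G1 2 a)\<^sup>2 / G a ^ 3) + (\<epsilon> / 2 * ((A1 1)\<^sup>2 + (A1 2)\<^sup>2)) * (if a \<in> {9,10,11} then 1 / K else 0) / G a"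
  unfolding mom0_def
proof (rule deriv_eqI[OF DERIV_warp[OF G], of "\<bar>G a\<bar>"])
  fix s assume s: "\<bar>s\<bar> < \<bar>G a\<bar>"
  let ?G' = "G(a := G a + s)"
  have n: "G a + s \<noteq> 0" using s by auto
  have p: "(G a + s) / G a > 0" using s by (auto simp: zero_less_divide_iff)
  have sp: "sqrt ((G a + s) / G a) = sqrt \<bar>(G a + s) / G a\<bar>" by (simp only: abs_of_pos[OF p])
  \<comment> \<open>For such \<open>a\<close> the product \<open>K\<close> is linear in
    \<open>G a\<close>, so 1/K is scaled by \<open>G a / (G a + s)\<close>, which differs from 1 by
    \<open>s / (G a + s)\<close>.\<close>
  have k: "1 / K - 1 / (?G' 9 * ?G' 10 * ?G' 11) = (if a \<in> {9,10,11} then 1 / K else 0) * (s / (G a + s))"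
  proof -
    have "1 / (x * y) - 1 / (w * y) = 1 / (x * y) * ((w - x) / w)" if "x \<noteq> 0" "w \<noteq> 0" for x y w :: real
      using that by (cases "y = 0") (simp_all add: field_simps)
    from this[OF G[of a] n] have E: "1 / (G a * y) - 1 / ((G a + s) * y) = 1 / (G a * y) * (s / (G a + s))" for y by simp
    consider "a = 9" | "a = 10" | "a = 11" | "a \<notin> {9,10,11}" by blast
    then show ?thesis
    proof cases
      case 1
      then show ?thesis using E[of "G 10 * G 11"] by (simp add: mult.assoc)
    next
      case 2
      then show ?thesis using E[of "G 9 * G 11"] by (simp add: mult.assoc mult.left_commute[of "G 9"])
    next
      case 3
      then show ?thesis using E[of "G 9 * G 10"] by (simp add: mult.assoc mult.commute[of _ "G 11"] mult.commute[of _ "G 11 + s"])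
    next
      case 4
      then have "a \<noteq> 9" "a \<noteq> 10" "a \<noteq> 11" by auto
      then show ?thesis by simp
    qed
  qed
  have d: "\<And>\<alpha>. \<alpha> \<notin> {1,2} \<Longrightarrow> G1 \<alpha> a = 0" by (rule G1)
  have dd: "\<And>\<alpha> \<beta>. \<alpha> \<notin> {1,2} \<or> \<beta> \<notin> {1,2} \<Longrightarrow> G2 \<alpha> \<beta> a = 0" by (rule G2)
  have sy': "G2 2 1 a = G2 1 2 a" using sy by simp
  show "Lg \<epsilon> (diagm G + s *\<^sub>R metric_unit a a) (\<lambda>\<alpha>. diagm (G1 \<alpha>)) (\<lambda>\<alpha> \<beta>. diagm (G2 \<alpha> \<beta>)) (\<lambda>\<alpha>. A1 \<alpha> *\<^sub>R \<omega>) =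
    sqrt ((G a + s) / G a) * (\<rho>
     + (- (G2 1 1 a / (G a + s)) + (3/4) * (G1 1 a / (G a + s))\<^sup>2 - (- (G2 1 1 a / G a) + (3/4) * (G1 1 a / G a)\<^sup>2) - (1/4) * (G1 1 a / (G a + s) - G1 1 a / G a)\<^sup>2)
     + (- (G2 2 2 a / (G a + s)) + (3/4) * (G1 2 a / (G a + s))\<^sup>2 - (- (G2 2 2 a / G a) + (3/4) * (G1 2 a / G a)\<^sup>2) - (1/4) * (G1 2 a / (G a + s) - G1 2 a / G a)\<^sup>2)
     + \<epsilon> / 2 * ((A1 1)\<^sup>2 + (A1 2)\<^sup>2) * ((if a \<in> {9,10,11} then 1 / K else 0) * (s / (G a + s))))"
    unfolding diagm_add_unit_diag k[symmetric] sp
    by (rule Lg_warp[of a "G a + s" "\<lambda>\<alpha>. G1 \<alpha> a" "\<lambda>\<alpha> \<beta>. G2 \<alpha> \<beta> a", unfolded fun_upd_triv]) (rule a n d dd sy'; assumption?)+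
qed (use G in simp)

lemma mom1_aa:
  assumes a: "a \<notin> {1,2}" and \<kappa>: "\<kappa> \<in> {1,2}"
  shows "mom1 \<epsilon> G G1 G2 A1 (metric_unit a a) \<kappa> = (3/2) * G1 \<kappa> a / (G a)\<^sup>2"
  unfolding mom1_def
proof (rule deriv_eqI[of "\<lambda>s. \<rho> + ((3/4) * ((G1 \<kappa> a + s) / G a)\<^sup>2 - (3/4) * (G1 \<kappa> a / G a)\<^sup>2 - (1/4) * ((G1 \<kappa> a + s) / G a - G1 \<kappa> a / G a)\<^sup>2)" _ 1])
  show "DERIV (\<lambda>s. \<rho> + ((3/4) * ((G1 \<kappa> a + s) / G a)\<^sup>2 - (3/4) * (G1 \<kappa> a / G a)\<^sup>2 - (1/4) * ((G1 \<kappa> a + s) / G a - G1 \<kappa> a / G a)\<^sup>2)) 0 :>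
     (3/2) * G1 \<kappa> a / (G a)\<^sup>2"
    using G[of a] by (auto intro!: derivative_eq_intros simp: field_simps power2_eq_square)
next
  fix s :: real
  have d: "\<And>\<alpha>. \<alpha> \<notin> {1,2} \<Longrightarrow> G1 \<alpha> a + (if \<alpha> = \<kappa> then s else 0) = 0" using G1 \<kappa> by auto
  have dd: "\<And>\<alpha> \<beta>. \<alpha> \<notin> {1,2} \<or> \<beta> \<notin> {1,2} \<Longrightarrow> G2 \<alpha> \<beta> a = 0" by (rule G2)
  have sy': "G2 2 1 a = G2 1 2 a" using sy by simp
  show "Lg \<epsilon> (diagm G) (\<lambda>\<alpha>. diagm (G1 \<alpha>) + (if \<alpha> = \<kappa> then s else 0) *\<^sub>R metric_unit a a) (\<lambda>\<alpha> \<beta>. diagm (G2 \<alpha> \<beta>)) (\<lambda>\<alpha>. A1 \<alpha> *\<^sub>R \<omega>) =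
    \<rho> + ((3/4) * ((G1 \<kappa> a + s) / G a)\<^sup>2 - (3/4) * (G1 \<kappa> a / G a)\<^sup>2 - (1/4) * ((G1 \<kappa> a + s) / G a - G1 \<kappa> a / G a)\<^sup>2)"
    unfolding diagm_add_unit_diag
    apply (subst Lg_warp[of a "G a" "\<lambda>\<alpha>. G1 \<alpha> a + (if \<alpha> = \<kappa> then s else 0)" "\<lambda>\<alpha> \<beta>. G2 \<alpha> \<beta> a", unfolded fun_upd_triv])
    apply (rule a G d dd sy'; assumption?)+
    using \<kappa> G[of a] by auto
qed simp

lemma mom2_aa:
  assumes a: "a \<notin> {1,2}" and k: "\<kappa> \<in> {1,2}" "\<kappa>' \<in> {1,2}"
  shows "mom2 \<epsilon> G G1 G2 A1 (metric_unit a a) \<kappa> \<kappa>' = (if \<kappa> = \<kappa>' then - 1 else 0) / G a"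
proof -
  let ?P = "half_pair \<kappa> \<kappa>'"
  have h: "DERIV (\<lambda>s. \<rho> - (?P s 1 1 + ?P s 2 2) / G a) 0 :> (if \<kappa> = \<kappa>' then - 1 else 0) / G a"
    unfolding half_pair_def using G[of a] k by (auto intro!: derivative_eq_intros)
  have d: "\<And>\<alpha>. \<alpha> \<notin> {1,2} \<Longrightarrow> G1 \<alpha> a = 0" by (rule G1)
  have dd: "G2 \<alpha> \<beta> a + ?P s \<alpha> \<beta> = 0" if "\<alpha> \<notin> {1,2} \<or> \<beta> \<notin> {1,2}" for \<alpha> \<beta> s
    using G2[OF that] half_pair(2)[OF k, of \<alpha> \<beta> s] that by simp
  have sy': "G2 2 1 a + ?P s 2 1 = G2 1 2 a + ?P s 1 2" for s using sy half_pair(1)[OF k] by simp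
  have "jet2 (metric_unit a a) (?P s) = \<rho> - (?P s 1 1 + ?P s 2 2) / G a" for s
    unfolding diagm_add_unit_diag
    apply (subst Lg_warp[of a "G a" "\<lambda>\<alpha>. G1 \<alpha> a" "\<lambda>\<alpha> \<beta>. G2 \<alpha> \<beta> a + ?P s \<alpha> \<beta>", unfolded fun_upd_triv])
    apply (rule a G d dd sy'; assumption?)+
    using G[of a] by (simp add: add_divide_distrib)
  then show ?thesis unfolding mom2_def by (rule deriv_eqI[OF h zero_less_one])
qed

text \<open>The curvature is constant in this variation. In the kinetic term the conformal factor
  cancels the root of the determinant, which leaves the flat square of the gradient over
  \<open>K\<close>.\<close>

lemma DERIV_Lg_form:
  assumes \<kappa>: "\<kappa> \<in> {1,2}"
  shows "DERIV (\<lambda>s. Lg \<epsilon> (diagm G) (\<lambda>\<alpha>. diagm (G1 \<alpha>)) (\<lambda>\<alpha> \<beta>. diagm (G2 \<alpha> \<beta>))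
    (\<lambda>\<alpha>. A1 \<alpha> *\<^sub>R \<omega> + (if \<alpha> = \<kappa> then s else 0) *\<^sub>R (t *\<^sub>R \<omega>))) 0 :> - \<epsilon> * A1 \<kappa> * t / K"
proof -
  define D where "D = lam * lam"
  have p: "diagm F = pairmat 1 2 0 F" for F :: "11 \<Rightarrow> real" by (rule diagm_pairmat) simp
  have D': "D = G 1 * G 2 - 0^2" "D \<noteq> 0" using lam by (simp_all add: D_def power2_eq_square)
  have sy': "(0::real) = 0" "G2 2 1 = G2 1 2" using sy by simp_all
  have det: "sqrt \<bar>det (diagm G)\<bar> = lam"
  proof -
    have "det (pairmat 1 2 0 G) = D * (\<Prod>b\<in>-{1,2}. G b)"
      by (rule det_pairmat_12[of G D 0 "\<lambda>_. 0" G1 "\<lambda>_ _. 0" G2]) (rule G D' G1 G2 refl sy; assumption?)+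
    then show ?thesis unfolding p using lam(3) by (simp add: abs_mult prodC D_def)
  qed
  have v: "(\<lambda>\<alpha>. A1 \<alpha> *\<^sub>R \<omega> + (if \<alpha> = \<kappa> then s else 0) *\<^sub>R (t *\<^sub>R \<omega>)) = (\<lambda>\<alpha>. (A1 \<alpha> + (if \<alpha> = \<kappa> then s else 0) * t) *\<^sub>R \<omega>)" for s
    by (simp add: scaleR_add_left fun_eq_iff)
  have F: "field_strength_sq (diagm G) (\<lambda>\<alpha>. (A1 \<alpha> + (if \<alpha> = \<kappa> then s else 0) * t) *\<^sub>R \<omega>) =
     24 / K * (G 2 / D * (A1 1 + (if 1 = \<kappa> then s else 0) * t)\<^sup>2 - 2 * 0 / D * (A1 1 + (if 1 = \<kappa> then s else 0) * t) * (A1 2 + (if 2 = \<kappa> then s else 0) * t)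
      + G 1 / D * (A1 2 + (if 2 = \<kappa> then s else 0) * t)\<^sup>2)" for s
    unfolding p
    by (rule field_strength_sq_pairmat[of G D 0 "\<lambda>_. 0" G1 "\<lambda>_ _. 0" G2]; (rule G D' G1 G2 refl sy; assumption?)?)
       (use A1 \<kappa> in auto)
  have alg: "lam * (R - \<epsilon> / (2 * fact 4) * (24 / k * (lam / D * x\<^sup>2 - 2 * 0 / D * x * y + lam / D * y\<^sup>2))) =
     lam * R - \<epsilon> / (2 * k) * (x\<^sup>2 + y\<^sup>2)" for R k x y
  proof -
    have "lam / D = 1 / lam" using lam(3) by (simp add: D_def)
    then show ?thesis using lam(3) by (cases "k = 0") (simp_all add: fact_numeral field_simps)
  qed
  have dc: "DERIV (\<lambda>s. lam * R - c * ((A1 1 + (if 1 = \<kappa> then s else 0) * t)\<^sup>2 + (A1 2 + (if 2 = \<kappa> then s else 0) * t)\<^sup>2)) 0 :>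
     - (2 * c) * A1 \<kappa> * t" for R c
  proof (cases "\<kappa> = 1")
    case True
    then show ?thesis by (auto intro!: derivative_eq_intros)
  next
    case False
    then have "\<kappa> = 2" using \<kappa> by auto
    then show ?thesis by (auto intro!: derivative_eq_intros)
  qed
  have c: "- (2 * (\<epsilon> / (2 * k))) * A1 \<kappa> * t = - \<epsilon> * A1 \<kappa> * t / k" for k by simp
  show ?thesis unfolding Lg_def v F det lam(1,2) alg by (rule dc[of _ "\<epsilon> / (2 * K)", unfolded c])
qed

end

subsection \<open>The Euler--Lagrange equations of the brane background\<close>

lemma pd_real_iff:
  fixes f :: "point \<Rightarrow> real"
  shows "pd D \<mu> f f' \<longleftrightarrow> (\<forall>x\<in>D. DERIV (\<lambda>t. f (x + t *\<^sub>R axis \<mu> 1)) 0 :> f' x)"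
  by (simp add: pd_def has_real_derivative_iff_has_vector_derivative)

lemma pd_scaleR_const:
  fixes f :: "point \<Rightarrow> real"
  assumes "pd D \<mu> f f'"
  shows "pd D \<mu> (\<lambda>x. f x *\<^sub>R c) (\<lambda>x. f' x *\<^sub>R c)"
  using assms unfolding pd_def
  by (auto intro!: bounded_linear.has_vector_derivative[OF bounded_linear_scaleR_left])

lemma diagm_sum:
  fixes F :: "'i::finite \<Rightarrow> real"
  shows "diagm F = (\<Sum>a\<in>UNIV. F a *\<^sub>R axis a (axis a 1))"
proof -
  have "(\<Sum>a\<in>UNIV. F a *\<^sub>R axis a (axis a (1::real)) :: real^'i^'i) $ i $ j = diagm F $ i $ j" for i j :: 'i
  proof -
    have "(\<Sum>a\<in>UNIV. F a *\<^sub>R axis a (axis a (1::real)) :: real^'i^'i) $ i $ j = (\<Sum>a\<in>UNIV. if a = i then (if i = j then F i else 0) else 0)"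
      unfolding sum_component by (rule sum.cong) (auto simp: axis_def)
    then show ?thesis by (simp add: diagm_def)
  qed
  then show ?thesis by (simp add: vec_eq_iff)
qed

lemma pd_diagm:
  assumes "\<And>a. pd D \<mu> (\<lambda>x. G x a) (\<lambda>x. G' x a)"
  shows "pd D \<mu> (\<lambda>x. diagm (G x)) (\<lambda>x. diagm (G' x))"
proof -
  have "pd D \<mu> (\<lambda>x. G x a *\<^sub>R axis a (axis a 1)) (\<lambda>x. G' x a *\<^sub>R axis a (axis a 1))" for a
    by (rule pd_scaleR_const) (rule assms)
  then show ?thesis
    unfolding diagm_sum pd_def by (auto intro!: has_vector_derivative_sum)
qed

lemma pd_Pair:
  assumes "pd D \<mu> f f'" "pd D \<mu> g g'"
  shows "pd D \<mu> (\<lambda>x. (f x, g x)) (\<lambda>x. (f' x, g' x))"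
  using assms unfolding pd_def by (auto intro!: has_vector_derivative_Pair)

lemma pd_const: "pd D \<mu> (\<lambda>x. c) (\<lambda>x. 0)"
  unfolding pd_def by auto

lemma pd_inverse:
  fixes f :: "point \<Rightarrow> real"
  assumes f: "pd D \<mu> f f'" and n: "\<And>x. x \<in> D \<Longrightarrow> f x \<noteq> 0"
  shows "pd D \<mu> (\<lambda>x. c / f x) (\<lambda>x. - c * f' x / (f x)\<^sup>2)"
  unfolding pd_real_iff
proof
  fix x assume x: "x \<in> D"
  have d: "DERIV (\<lambda>t. f (x + t *\<^sub>R axis \<mu> 1)) 0 :> f' x" using f x by (simp add: pd_real_iff)
  show "DERIV (\<lambda>t. c / f (x + t *\<^sub>R axis \<mu> 1)) 0 :> - c * f' x / (f x)\<^sup>2"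
    using n[OF x] by (auto intro!: derivative_eq_intros d simp: power2_eq_square)
qed

text \<open>All metric momenta below have the form of a constant over f or a constant times a
  derivative of f over its square, so this rule and \<open>pd_inverse\<close> give every total
  derivative required.\<close>

lemma pd_quot:
  fixes f g :: "point \<Rightarrow> real"
  assumes f: "pd D \<mu> f f'" and g: "pd D \<mu> g g'" and n: "\<And>x. x \<in> D \<Longrightarrow> f x \<noteq> 0"
  shows "pd D \<mu> (\<lambda>x. c * g x / (f x)\<^sup>2) (\<lambda>x. c * (g' x / (f x)\<^sup>2 - 2 * g x * f' x / f x ^ 3))"
  unfolding pd_real_iff
proof
  fix x assume x: "x \<in> D"
  have d: "DERIV (\<lambda>t. f (x + t *\<^sub>R axis \<mu> 1)) 0 :> f' x" "DERIV (\<lambda>t. g (x + t *\<^sub>R axis \<mu> 1)) 0 :> g' x"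
    using f g x by (auto simp: pd_real_iff)
  show "DERIV (\<lambda>t. c * g (x + t *\<^sub>R axis \<mu> 1) / (f (x + t *\<^sub>R axis \<mu> 1))\<^sup>2) 0 :> c * (g' x / (f x)\<^sup>2 - 2 * g x * f' x / f x ^ 3)"
    using n[OF x] by (auto intro!: derivative_eq_intros d) (simp add: field_simps eval_nat_numeral)
qed

lemma Compl_12: "- {1,2} = {3,4,5,6,7,8,9,10,11::11}"
proof -
  have "- {1,2::11} = UNIV - {1,2}" by (rule Compl_eq_Diff_UNIV)
  also have "\<dots> = {3,4,5,6,7,8,9,10,11::11}" unfolding UNIV_11 by simp
  finally show ?thesis .
qed

lemma metric_unit_commute: "metric_unit \<mu> \<nu> = metric_unit \<nu> \<mu>"
  by (simp add: metric_unit_def insert_commute)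

lemma omega_perm:
  assumes "{\<mu>,\<nu>,\<rho>} = {9,10,11::11}"
  shows "\<exists>t. form3 \<mu> \<nu> \<rho> = t *\<^sub>R \<omega>"
proof -
  have c: "(\<mu>,\<nu>,\<rho>) \<in> {(9,10,11),(9,11,10),(10,9,11),(10,11,9),(11,9,10),(11,10,9)}"
  proof -
    have "\<mu> \<in> {9,10,11}" "\<nu> \<in> {9,10,11}" "\<rho> \<in> {9,10,11}" using assms by blast+
    moreover have "\<mu> \<noteq> \<nu>" "\<mu> \<noteq> \<rho>" "\<nu> \<noteq> \<rho>"
    proof -
      have 3: "card {\<mu>,\<nu>,\<rho>} = 3" unfolding assms by simp
      show "\<mu> \<noteq> \<nu>" "\<mu> \<noteq> \<rho>" "\<nu> \<noteq> \<rho>"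
        using 3 by (auto simp: card_insert_if split: if_splits)
    qed
    ultimately show ?thesis by auto
  qed
  have p: "form3 9 11 10 = (-1) *\<^sub>R \<omega>" "form3 10 9 11 = (-1) *\<^sub>R \<omega>" "form3 10 11 9 = 1 *\<^sub>R \<omega>"
    "form3 11 9 10 = 1 *\<^sub>R \<omega>" "form3 11 10 9 = (-1) *\<^sub>R \<omega>" "\<omega> = 1 *\<^sub>R \<omega>"
    by (auto simp: vec_eq_iff form3_def Let_def algebra_simps)
  have "form3 \<mu> \<nu> \<rho> = 1 *\<^sub>R \<omega> \<or> form3 \<mu> \<nu> \<rho> = (-1) *\<^sub>R \<omega>" using c p by auto
  then show ?thesis by blast
qed

lemma omega_9: "9 \<notin> {a,b,c} \<Longrightarrow> \<omega> $ a $ b $ c = 0"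
  using form3_nonzero[of 9 10 11 a b c] by blast

lemma chern_simons_base: "chern_simons A (\<lambda>\<alpha>. f \<alpha> *\<^sub>R \<omega>) = 0"
proof (rule chern_simons_0[of 9])
  fix \<mu> \<nu> \<rho> \<sigma> :: 11 assume "9 \<notin> {\<mu>, \<nu>, \<rho>, \<sigma>}"
  then show "field_strength (\<lambda>\<alpha>. f \<alpha> *\<^sub>R \<omega>) \<mu> \<nu> \<rho> \<sigma> = 0"
    by (simp add: field_strength_def omega_9)
qed

lemma chern_simons_var:
  "chern_simons (t *\<^sub>R \<omega>) (\<lambda>\<alpha>. f \<alpha> *\<^sub>R \<omega> + (if \<alpha> = \<kappa> then s else 0) *\<^sub>R w) = s\<^sup>2 * chern_simons (t *\<^sub>R \<omega>) (\<lambda>\<alpha>. (if \<alpha> = \<kappa> then 1 else 0) *\<^sub>R w)"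
proof -
  have e: "(\<lambda>\<alpha>. f \<alpha> *\<^sub>R \<omega> + (if \<alpha> = \<kappa> then s else 0) *\<^sub>R w) = (\<lambda>\<alpha>. f \<alpha> *\<^sub>R \<omega> + s *\<^sub>R ((if \<alpha> = \<kappa> then 1 else 0) *\<^sub>R w))"
    by auto
  show ?thesis unfolding e
  proof (rule chern_simons_quadratic[of 9])
    fix \<mu> \<nu> \<rho> :: 11 assume "9 \<notin> {\<mu>, \<nu>, \<rho>}"
    then show "(t *\<^sub>R \<omega>) $ \<mu> $ \<nu> $ \<rho> = 0" by (simp add: omega_9)
  next
    fix \<mu> \<nu> \<rho> \<sigma> :: 11 assume "9 \<notin> {\<mu>, \<nu>, \<rho>, \<sigma>}"
    then show "field_strength (\<lambda>\<alpha>. f \<alpha> *\<^sub>R \<omega>) \<mu> \<nu> \<rho> \<sigma> = 0"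
      by (simp add: field_strength_def omega_9)
  qed
qed

text \<open>\<open>hm\<close> and \<open>hu\<close> are the harmonicity of ln \<open>m\<close> and
  of \<open>u\<^sup>3\<close> with denominators cleared. The sign \<open>s\<close> is at once the
  kinetic sign and the sign of directions 10 and 11, with \<open>-s\<close> at 9; the ratio of the
  kinetic sign to the product of the three metric entries is then \<open>- u x ^ 6\<close> in both
  theories.\<close>

context
  fixes D :: "point set" and m u :: "point \<Rightarrow> real" and m1 u1 :: "11 \<Rightarrow> point \<Rightarrow> real" and m2 u2 :: "11 \<Rightarrow> 11 \<Rightarrow> point \<Rightarrow> real"
    and s t c :: real
  assumes D: "open D"
    and pos: "\<And>x. x \<in> D \<Longrightarrow> m x > 0" "\<And>x. x \<in> D \<Longrightarrow> u x > 0"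
    and m1: "\<And>i. i \<in> {1,2} \<Longrightarrow> pd D i m (m1 i)" and u1: "\<And>i. i \<in> {1,2} \<Longrightarrow> pd D i u (u1 i)"
    and m2: "\<And>i j. i \<in> {1,2} \<Longrightarrow> j \<in> {1,2} \<Longrightarrow> pd D i (m1 j) (m2 i j)"
    and u2: "\<And>i j. i \<in> {1,2} \<Longrightarrow> j \<in> {1,2} \<Longrightarrow> pd D i (u1 j) (u2 i j)"
    and sym: "m2 2 1 = m2 1 2" "u2 2 1 = u2 1 2"
    and hm: "\<And>x. x \<in> D \<Longrightarrow> m x * (m2 1 1 x + m2 2 2 x) = (m1 1 x)\<^sup>2 + (m1 2 x)\<^sup>2"
    and hu: "\<And>x. x \<in> D \<Longrightarrow> u x * (u2 1 1 x + u2 2 2 x) = - 2 * ((u1 1 x)\<^sup>2 + (u1 2 x)\<^sup>2)"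
    and s: "s * s = 1" and t: "t * t = 1"
begin

definition "fG x a = (if a \<in> {1,2} then m x * u x else if a \<in> {3,4,5,6,7,8} then u x
   else if a = 9 then - s / (u x)\<^sup>2 else s / (u x)\<^sup>2)" for x :: point and a :: 11

definition "fG1 x \<alpha> a = (if \<alpha> \<in> {1,2} then (if a \<in> {1,2} then m1 \<alpha> x * u x + m x * u1 \<alpha> x else if a \<in> {3,4,5,6,7,8} then u1 \<alpha> x
   else if a = 9 then 2 * s * u1 \<alpha> x / u x ^ 3 else - 2 * s * u1 \<alpha> x / u x ^ 3) else 0)" for x :: point and \<alpha> a :: 11

definition "fG2 x \<alpha> \<beta> a = (if \<alpha> \<in> {1,2} \<and> \<beta> \<in> {1,2} then
   (if a \<in> {1,2} then m2 \<alpha> \<beta> x * u x + m1 \<beta> x * u1 \<alpha> x + m1 \<alpha> x * u1 \<beta> x + m x * u2 \<alpha> \<beta> x else if a \<in> {3,4,5,6,7,8} then u2 \<alpha> \<beta> x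
   else if a = 9 then 2 * s * (u2 \<alpha> \<beta> x / u x ^ 3 - 3 * u1 \<beta> x * u1 \<alpha> x / u x ^ 4)
   else - 2 * s * (u2 \<alpha> \<beta> x / u x ^ 3 - 3 * u1 \<beta> x * u1 \<alpha> x / u x ^ 4)) else 0)" for x :: point and \<alpha> \<beta> a :: 11

definition "fA x = t / u x ^ 3" for x :: point
definition "fA1 x \<alpha> = (if \<alpha> \<in> {1,2} then - 3 * t * u1 \<alpha> x / u x ^ 4 else 0)" for x :: point and \<alpha> :: 11
definition "fA2 x \<alpha> \<beta> = (if \<alpha> \<in> {1,2} \<and> \<beta> \<in> {1,2} then - 3 * t * (u2 \<alpha> \<beta> x / u x ^ 4 - 4 * u1 \<beta> x * u1 \<alpha> x / u x ^ 5) else 0)" for x :: point and \<alpha> \<beta> :: 11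

lemma pd_fG: "\<alpha> \<in> {1,2} \<Longrightarrow> pd D \<alpha> (\<lambda>x. fG x a) (\<lambda>x. fG1 x \<alpha> a)"
  unfolding pd_real_iff
proof
  fix x assume a: "\<alpha> \<in> {1,2}" and x: "x \<in> D"
  have d: "DERIV (\<lambda>t. m (x + t *\<^sub>R axis \<alpha> 1)) 0 :> m1 \<alpha> x" "DERIV (\<lambda>t. u (x + t *\<^sub>R axis \<alpha> 1)) 0 :> u1 \<alpha> x"
    using m1[OF a] u1[OF a] x by (auto simp: pd_real_iff)
  have 1: "DERIV (\<lambda>t. m (x + t *\<^sub>R axis \<alpha> 1) * u (x + t *\<^sub>R axis \<alpha> 1)) 0 :> m1 \<alpha> x * u x + m x * u1 \<alpha> x"
    by (auto intro!: derivative_eq_intros d)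
  have 2: "DERIV (\<lambda>t. k / (u (x + t *\<^sub>R axis \<alpha> 1))\<^sup>2) 0 :> - 2 * k * u1 \<alpha> x / u x ^ 3" for k
    using pos(2)[OF x] by (auto intro!: derivative_eq_intros d) (simp add: field_simps eval_nat_numeral)
  show "DERIV (\<lambda>t. fG (x + t *\<^sub>R axis \<alpha> 1) a) 0 :> fG1 x \<alpha> a"
    unfolding fG_def fG1_def using a 1 2[of s] 2[of "-s"] d(2) by (auto simp: if_distrib)
qed

lemma pd_fG1: "\<alpha> \<in> {1,2} \<Longrightarrow> \<beta> \<in> {1,2} \<Longrightarrow> pd D \<alpha> (\<lambda>x. fG1 x \<beta> a) (\<lambda>x. fG2 x \<alpha> \<beta> a)"
  unfolding pd_real_iff
proof
  fix x assume a: "\<alpha> \<in> {1,2}" and b: "\<beta> \<in> {1,2}" and x: "x \<in> D"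
  have d: "DERIV (\<lambda>t. m (x + t *\<^sub>R axis \<alpha> 1)) 0 :> m1 \<alpha> x" "DERIV (\<lambda>t. u (x + t *\<^sub>R axis \<alpha> 1)) 0 :> u1 \<alpha> x"
    "DERIV (\<lambda>t. m1 \<beta> (x + t *\<^sub>R axis \<alpha> 1)) 0 :> m2 \<alpha> \<beta> x" "DERIV (\<lambda>t. u1 \<beta> (x + t *\<^sub>R axis \<alpha> 1)) 0 :> u2 \<alpha> \<beta> x"
    using m1[OF a] u1[OF a] m2[OF a b] u2[OF a b] x by (auto simp: pd_real_iff)
  have 1: "DERIV (\<lambda>t. m1 \<beta> (x + t *\<^sub>R axis \<alpha> 1) * u (x + t *\<^sub>R axis \<alpha> 1) + m (x + t *\<^sub>R axis \<alpha> 1) * u1 \<beta> (x + t *\<^sub>R axis \<alpha> 1)) 0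
     :> m2 \<alpha> \<beta> x * u x + m1 \<beta> x * u1 \<alpha> x + m1 \<alpha> x * u1 \<beta> x + m x * u2 \<alpha> \<beta> x"
    by (auto intro!: derivative_eq_intros d)
  have 2: "DERIV (\<lambda>t. k * u1 \<beta> (x + t *\<^sub>R axis \<alpha> 1) / u (x + t *\<^sub>R axis \<alpha> 1) ^ 3) 0 :> k * (u2 \<alpha> \<beta> x / u x ^ 3 - 3 * u1 \<beta> x * u1 \<alpha> x / u x ^ 4)" for k
    using pos(2)[OF x] by (auto intro!: derivative_eq_intros d) (simp add: field_simps eval_nat_numeral)
  show "DERIV (\<lambda>t. fG1 (x + t *\<^sub>R axis \<alpha> 1) \<beta> a) 0 :> fG2 x \<alpha> \<beta> a"
    unfolding fG1_def fG2_def using a b 1 2[of "2 * s"] 2[of "- 2 * s"] d(4) by auto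
qed

lemma pd_fA: "\<alpha> \<in> {1,2} \<Longrightarrow> pd D \<alpha> fA (\<lambda>x. fA1 x \<alpha>)"
  unfolding pd_real_iff
proof
  fix x assume a: "\<alpha> \<in> {1,2}" and x: "x \<in> D"
  have d: "DERIV (\<lambda>t. u (x + t *\<^sub>R axis \<alpha> 1)) 0 :> u1 \<alpha> x"
    using u1[OF a] x by (auto simp: pd_real_iff)
  have "DERIV (\<lambda>t'. t / u (x + t' *\<^sub>R axis \<alpha> 1) ^ 3) 0 :> - 3 * t * u1 \<alpha> x / u x ^ 4"
    using pos(2)[OF x] by (auto intro!: derivative_eq_intros d) (simp add: field_simps eval_nat_numeral)
  then show "DERIV (\<lambda>t. fA (x + t *\<^sub>R axis \<alpha> 1)) 0 :> fA1 x \<alpha>"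
    unfolding fA_def fA1_def using a by simp
qed

lemma pd_fA1: "\<alpha> \<in> {1,2} \<Longrightarrow> \<beta> \<in> {1,2} \<Longrightarrow> pd D \<alpha> (\<lambda>x. fA1 x \<beta>) (\<lambda>x. fA2 x \<alpha> \<beta>)"
  unfolding pd_real_iff
proof
  fix x assume a: "\<alpha> \<in> {1,2}" and b: "\<beta> \<in> {1,2}" and x: "x \<in> D"
  have d: "DERIV (\<lambda>t. u (x + t *\<^sub>R axis \<alpha> 1)) 0 :> u1 \<alpha> x"
    "DERIV (\<lambda>t. u1 \<beta> (x + t *\<^sub>R axis \<alpha> 1)) 0 :> u2 \<alpha> \<beta> x"
    using u1[OF a] u2[OF a b] x by (auto simp: pd_real_iff)
  have "DERIV (\<lambda>t'. - 3 * t * u1 \<beta> (x + t' *\<^sub>R axis \<alpha> 1) / u (x + t' *\<^sub>R axis \<alpha> 1) ^ 4) 0 :> - 3 * t * (u2 \<alpha> \<beta> x / u x ^ 4 - 4 * u1 \<beta> x * u1 \<alpha> x / u x ^ 5)"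
    using pos(2)[OF x] by (auto intro!: derivative_eq_intros d) (simp add: field_simps eval_nat_numeral)
  then show "DERIV (\<lambda>t. fA1 (x + t *\<^sub>R axis \<alpha> 1) \<beta>) 0 :> fA2 x \<alpha> \<beta>"
    unfolding fA1_def fA2_def using a b by simp
qed

lemma ratio1:
  assumes x: "x \<in> D" and i: "i \<in> {1,2}"
  shows "fG1 x i 3 / fG x 3 = u1 i x / u x" "fG1 x i 4 / fG x 4 = u1 i x / u x" "fG1 x i 5 / fG x 5 = u1 i x / u x"
    "fG1 x i 6 / fG x 6 = u1 i x / u x" "fG1 x i 7 / fG x 7 = u1 i x / u x" "fG1 x i 8 / fG x 8 = u1 i x / u x"
    "fG1 x i 9 / fG x 9 = - 2 * (u1 i x / u x)" "fG1 x i 10 / fG x 10 = - 2 * (u1 i x / u x)" "fG1 x i 11 / fG x 11 = - 2 * (u1 i x / u x)"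
  using pos(2)[OF x] s i by (cases "s = 0"; simp add: fG_def fG1_def field_simps eval_nat_numeral)+

text \<open>The coefficients -2 and 6 are those of the second derivative of the power -2 of
  \<open>u\<close>.\<close>

lemma ratio2:
  assumes x: "x \<in> D" and i: "i \<in> {1,2}" "j \<in> {1,2}"
  shows "fG2 x i j 3 / fG x 3 = u2 i j x / u x" "fG2 x i j 4 / fG x 4 = u2 i j x / u x" "fG2 x i j 5 / fG x 5 = u2 i j x / u x"
    "fG2 x i j 6 / fG x 6 = u2 i j x / u x" "fG2 x i j 7 / fG x 7 = u2 i j x / u x" "fG2 x i j 8 / fG x 8 = u2 i j x / u x"
    "fG2 x i j 9 / fG x 9 = - 2 * (u2 i j x / u x) + 6 * ((u1 i x / u x) * (u1 j x / u x))"
    "fG2 x i j 10 / fG x 10 = - 2 * (u2 i j x / u x) + 6 * ((u1 i x / u x) * (u1 j x / u x))"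
    "fG2 x i j 11 / fG x 11 = - 2 * (u2 i j x / u x) + 6 * ((u1 i x / u x) * (u1 j x / u x))"
  using pos(2)[OF x] s i by (cases "s = 0"; simp add: fG_def fG2_def field_simps eval_nat_numeral)+

lemma K_eq: "fG x 9 * fG x 10 * fG x 11 = - s / u x ^ 6"
proof -
  have "s * s * s = s" using s by simp
  then show ?thesis by (simp add: fG_def field_simps eval_nat_numeral)
qed

lemma AA_eq: "i \<in> {1,2} \<Longrightarrow> j \<in> {1,2} \<Longrightarrow> fA1 x i * fA1 x j = 9 * (u1 i x * u1 j x) / u x ^ 8"
proof -
  assume i: "i \<in> {1,2}" "j \<in> {1,2}"
  have "fA1 x i * fA1 x j = 9 * (t * t) * (u1 i x * u1 j x) / u x ^ 8"
    using i by (simp add: fA1_def field_simps eval_nat_numeral)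
  then show ?thesis by (simp add: t)
qed

lemma base:
  assumes x: "x \<in> D"
  shows "\<And>a. fG x a \<noteq> 0" "\<And>\<alpha> a. \<alpha> \<notin> {1,2} \<Longrightarrow> fG1 x \<alpha> a = 0"
    "\<And>\<alpha> \<beta> a. \<alpha> \<notin> {1,2} \<or> \<beta> \<notin> {1,2} \<Longrightarrow> fG2 x \<alpha> \<beta> a = 0"
    "\<And>\<alpha>. \<alpha> \<notin> {1,2} \<Longrightarrow> fA1 x \<alpha> = 0"
    "fG x 1 = m x * u x" "fG x 2 = m x * u x" "m x * u x > 0"
    "\<And>i. fG1 x i 2 = fG1 x i 1" "\<And>i j. fG2 x i j 2 = fG2 x i j 1" "fG2 x 2 1 = fG2 x 1 2"
    "\<bar>\<Prod>a\<in>-{1,2}. fG x a\<bar> = 1"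
    "\<And>i. i \<in> {1,2} \<Longrightarrow> ysum (fG x) (fG1 x) i = 0"
    "\<And>i j. i \<in> {1,2} \<Longrightarrow> j \<in> {1,2} \<Longrightarrow> wsum (fG x) (fG1 x) (fG2 x) i j = s / 2 * (fA1 x i * fA1 x j / (fG x 9 * fG x 10 * fG x 11))"
proof -
  have p: "m x > 0" "u x > 0" using pos x by auto
  have sn: "s \<noteq> 0" using s by auto
  show "fG x a \<noteq> 0" for a using p sn by (auto simp: fG_def)
  show "\<alpha> \<notin> {1,2} \<Longrightarrow> fG1 x \<alpha> a = 0" "\<alpha> \<notin> {1,2} \<or> \<beta> \<notin> {1,2} \<Longrightarrow> fG2 x \<alpha> \<beta> a = 0" "\<alpha> \<notin> {1,2} \<Longrightarrow> fA1 x \<alpha> = 0" for \<alpha> \<beta> a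
    by (auto simp: fG1_def fG2_def fA1_def)
  show "fG x 1 = m x * u x" "fG x 2 = m x * u x" "m x * u x > 0" using p by (auto simp: fG_def)
  show "fG1 x i 2 = fG1 x i 1" "fG2 x i j 2 = fG2 x i j 1" for i j by (auto simp: fG1_def fG2_def)
  show "fG2 x 2 1 = fG2 x 1 2" using sym by (auto simp: fG2_def fun_eq_iff algebra_simps)
  have as: "\<bar>s\<bar> = 1" using s by (metis abs_mult abs_one abs_mult_self_eq power2_eq_1_iff power2_eq_square abs_minus_cancel)
  show "\<bar>\<Prod>a\<in>-{1,2}. fG x a\<bar> = 1"
    unfolding Compl_12 using p by (simp add: fG_def abs_mult as) (simp add: field_simps eval_nat_numeral)
  show "ysum (fG x) (fG1 x) i = 0" if i: "i \<in> {1,2}" for i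
    unfolding ysum_def Compl_12 by (simp add: ratio1[OF x i])
  show "wsum (fG x) (fG1 x) (fG2 x) i j = s / 2 * (fA1 x i * fA1 x j / (fG x 9 * fG x 10 * fG x 11))" if i: "i \<in> {1,2}" "j \<in> {1,2}" for i j
  proof -
    \<comment> \<open>Second derivatives: 6 * (-1) + 3 * 2 = 0. Squares: 6 * (3/4) + 3 * (-6 + 3) =
      -9/2. On the other side the 9 is the square of the exponent in
      \<open>t / u ^ 3\<close>.\<close>
    have "wsum (fG x) (fG1 x) (fG2 x) i j = - (9/2) * ((u1 i x / u x) * (u1 j x / u x))"
    proof -
      have ex: "(\<Sum>a\<in>{3,4,5,6,7,8,9,10,11::11}. f a) = f 3 + f 4 + f 5 + f 6 + f 7 + f 8 + f 9 + f 10 + f 11" for f :: "11 \<Rightarrow> real"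
        by (simp add: add.assoc)
      show ?thesis unfolding wsum_def Compl_12 ex ratio1[OF x i(1)] ratio1[OF x i(2)] ratio2[OF x i] by algebra
    qed
    also have "\<dots> = - (9/2) * (u1 i x * u1 j x / (u x)\<^sup>2)" by (simp add: power2_eq_square)
    also have "\<dots> = s / 2 * (fA1 x i * fA1 x j / (fG x 9 * fG x 10 * fG x 11))"
      unfolding K_eq AA_eq[OF i] using p sn by (simp add: field_simps eval_nat_numeral)
    finally show ?thesis .
  qed
qed

context
  fixes \<phi> :: "point \<Rightarrow> metric \<times> threeform"
  assumes z_phi: "zdep \<phi>" and phi: "\<And>x. x \<in> D \<Longrightarrow> \<phi> x = (diagm (fG x), fA x *\<^sub>R \<omega>)"
begin

lemma jet1: "y \<in> D \<Longrightarrow> pdrv \<alpha> \<phi> y = (diagm (fG1 y \<alpha>), fA1 y \<alpha> *\<^sub>R \<omega>)"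
proof (cases "\<alpha> \<in> {1,2}")
  case True
  assume y: "y \<in> D"
  have "pd D \<alpha> (\<lambda>x. (diagm (fG x), fA x *\<^sub>R \<omega>)) (\<lambda>x. (diagm (fG1 x \<alpha>), fA1 x \<alpha> *\<^sub>R \<omega>))"
    by (rule pd_Pair[OF pd_diagm pd_scaleR_const]) (use pd_fG pd_fA True in auto)
  then show ?thesis by (rule pdrv_eq[OF D]) (use phi y in auto)
next
  case False
  then show ?thesis using pdrv_zdep_0[OF z_phi False]
    by (simp add: diagm_def fG1_def fA1_def vec_eq_iff prod_eq_iff)
qed

lemma jet2: "y \<in> D \<Longrightarrow> pdrv \<alpha> (pdrv \<beta> \<phi>) y = (diagm (fG2 y \<alpha> \<beta>), fA2 y \<alpha> \<beta> *\<^sub>R \<omega>)"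
proof -
  assume y: "y \<in> D"
  show ?thesis
  proof (cases "\<alpha> \<in> {1,2} \<and> \<beta> \<in> {1,2}")
    case True
    have "pd D \<alpha> (\<lambda>y. (diagm (fG1 y \<beta>), fA1 y \<beta> *\<^sub>R \<omega>)) (\<lambda>y. (diagm (fG2 y \<alpha> \<beta>), fA2 y \<alpha> \<beta> *\<^sub>R \<omega>))"
      by (rule pd_Pair[OF pd_diagm pd_scaleR_const]) (use True pd_fG1 pd_fA1 in auto)
    then show ?thesis by (rule pdrv_eq[OF D]) (use jet1 y in auto)
  next
    case False
    have 0: "(diagm (fG2 y \<alpha> \<beta>), fA2 y \<alpha> \<beta> *\<^sub>R \<omega>) = 0"
      using False by (auto simp: diagm_def fG2_def fA2_def vec_eq_iff prod_eq_iff)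
    show ?thesis
    proof (cases "\<alpha> \<in> {1,2}")
      case True
      with False have "pdrv \<beta> \<phi> = (\<lambda>_. 0)" using pdrv_zdep_0[OF z_phi] by blast
      then show ?thesis unfolding 0 by (simp add: pdrv_def)
    next
      case False
      then show ?thesis unfolding 0 by (intro pdrv_zdep_0 zdep_pdrv z_phi)
    qed
  qed
qed

lemma sugra_Lg: "sugra_lagrangian s c q d dd =
    Lg s (fst q) (\<lambda>\<mu>. fst (d \<mu>)) (\<lambda>\<mu> \<nu>. fst (dd \<mu> \<nu>)) (\<lambda>\<mu>. snd (d \<mu>)) + c * chern_simons (snd q) (\<lambda>\<mu>. snd (d \<mu>))"
  by (simp add: sugra_lagrangian_def Lg_def Let_def)

text \<open>\<open>H \<mu> \<nu>\<close> is the \<mu>-derivative of the \<nu>-derivative of the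
  entry \<open>a\<close> over its square; since 1/f differentiates to minus that quotient, the last
  bracket has a minus sign. The map \<open>\<sigma>\<close> accommodates the exchanged index of
  \<open>mom1_12\<close>.\<close>

lemma euler_metric:
  fixes k1 :: "11 \<Rightarrow> real" and k2 :: "11 \<Rightarrow> 11 \<Rightarrow> real" and \<sigma> :: "11 \<Rightarrow> 11"
  assumes x: "x \<in> D"
    and M1: "\<And>y \<mu>. y \<in> D \<Longrightarrow> \<mu> \<in> {1,2} \<Longrightarrow> mom1 s (fG y) (fG1 y) (fG2 y) (fA1 y) w \<mu> = k1 \<mu> * fG1 y (\<sigma> \<mu>) a / (fG y a)\<^sup>2"
    and M2: "\<And>y \<mu> \<nu>. y \<in> D \<Longrightarrow> \<mu> \<in> {1,2} \<Longrightarrow> \<nu> \<in> {1,2} \<Longrightarrow> mom2 s (fG y) (fG1 y) (fG2 y) (fA1 y) w \<mu> \<nu> = k2 \<mu> \<nu> / fG y a"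
    and \<sigma>: "\<sigma> 1 \<in> {1,2}" "\<sigma> 2 \<in> {1,2}"
  defines "H \<equiv> \<lambda>\<mu> \<nu>. fG2 x \<mu> \<nu> a / (fG x a)\<^sup>2 - 2 * fG1 x \<nu> a * fG1 x \<mu> a / fG x a ^ 3"
  shows "euler (sugra_lagrangian s c) \<phi> (w, 0) x = mom0 s (fG x) (fG1 x) (fG2 x) (fA1 x) w
    - (k1 1 * H 1 (\<sigma> 1) + k1 2 * H 2 (\<sigma> 2)) - (k2 1 1 * H 1 1 + k2 1 2 * H 1 2 + (k2 2 1 * H 2 1 + k2 2 2 * H 2 2))"
proof -
  have n: "fG y a \<noteq> 0" if "y \<in> D" for y by (rule base(1)[OF that])
  let ?H = "\<lambda>\<mu> \<nu> x. fG2 x \<mu> \<nu> a / (fG x a)\<^sup>2 - 2 * fG1 x \<nu> a * fG1 x \<mu> a / fG x a ^ 3"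
  have \<sigma>': "\<sigma> \<mu> \<in> {1,2}" if "\<mu> \<in> {1,2}" for \<mu> using \<sigma> that by auto
  have "euler (sugra_lagrangian s c) \<phi> (w, 0) x = mom0 s (fG x) (fG1 x) (fG2 x) (fA1 x) w
    - (k1 1 * ?H 1 (\<sigma> 1) x + k1 2 * ?H 2 (\<sigma> 2) x) +
    (- k2 1 1 * ?H 1 1 x + - k2 1 2 * ?H 1 2 x + (- k2 2 1 * ?H 2 1 x + - k2 2 2 * ?H 2 2 x))"
  proof (rule euler_eval[where ?J1.0 = "\<lambda>y \<alpha>. (diagm (fG1 y \<alpha>), fA1 y \<alpha> *\<^sub>R \<omega>)" and ?J2.0 = "\<lambda>y \<alpha> \<beta>. (diagm (fG2 y \<alpha> \<beta>), fA2 y \<alpha> \<beta> *\<^sub>R \<omega>)"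
        and ?P1.0 = "\<lambda>\<mu> y. k1 \<mu> * fG1 y (\<sigma> \<mu>) a / (fG y a)\<^sup>2" and ?P2.0 = "\<lambda>\<mu> \<nu> y. k2 \<mu> \<nu> / fG y a"
        and ?Q1.0 = "\<lambda>\<mu> y. k1 \<mu> * ?H \<mu> (\<sigma> \<mu>) y"
        and ?Q2.0 = "\<lambda>\<mu> \<nu> y. - k2 \<mu> \<nu> * fG1 y \<nu> a / (fG y a)\<^sup>2" and ?R2.0 = "\<lambda>\<mu> \<nu> y. - k2 \<mu> \<nu> * ?H \<mu> \<nu> y"])
    show "deriv (\<lambda>r. sugra_lagrangian s c (\<phi> x + r *\<^sub>R (w, 0)) (\<lambda>\<alpha>. (diagm (fG1 x \<alpha>), fA1 x \<alpha> *\<^sub>R \<omega>))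
       (\<lambda>\<alpha> \<beta>. (diagm (fG2 x \<alpha> \<beta>), fA2 x \<alpha> \<beta> *\<^sub>R \<omega>))) 0 = mom0 s (fG x) (fG1 x) (fG2 x) (fA1 x) w"
      unfolding mom0_def sugra_Lg phi[OF x] by (simp add: chern_simons_base)
  next
    fix y \<mu> assume y: "y \<in> D" "\<mu> \<in> {1,2::11}"
    show "deriv (\<lambda>r. sugra_lagrangian s c (\<phi> y) (\<lambda>\<alpha>. (diagm (fG1 y \<alpha>), fA1 y \<alpha> *\<^sub>R \<omega>) + (if \<alpha> = \<mu> then r else 0) *\<^sub>R (w, 0))
       (\<lambda>\<alpha> \<beta>. (diagm (fG2 y \<alpha> \<beta>), fA2 y \<alpha> \<beta> *\<^sub>R \<omega>))) 0 = k1 \<mu> * fG1 y (\<sigma> \<mu>) a / (fG y a)\<^sup>2"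
      unfolding M1[OF y, symmetric] mom1_def sugra_Lg phi[OF y(1)] by (simp add: chern_simons_base)
  next
    fix y \<mu> \<nu> assume y: "y \<in> D" "\<mu> \<in> {1,2::11}" "\<nu> \<in> {1,2::11}"
    show "deriv (\<lambda>r. sugra_lagrangian s c (\<phi> y) (\<lambda>\<alpha>. (diagm (fG1 y \<alpha>), fA1 y \<alpha> *\<^sub>R \<omega>))
       (\<lambda>\<alpha> \<beta>. (diagm (fG2 y \<alpha> \<beta>), fA2 y \<alpha> \<beta> *\<^sub>R \<omega>) + ((if \<alpha> = \<mu> \<and> \<beta> = \<nu> then r / 2 else 0) + (if \<alpha> = \<nu> \<and> \<beta> = \<mu> then r / 2 else 0)) *\<^sub>R (w, 0))) 0
       = k2 \<mu> \<nu> / fG y a"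
      unfolding M2[OF y, symmetric] mom2_def half_pair_def sugra_Lg phi[OF y(1)] by (simp add: chern_simons_base)
  next
    fix \<mu> assume \<mu>: "\<mu> \<in> {1,2::11}"
    show "pd D \<mu> (\<lambda>y. k1 \<mu> * fG1 y (\<sigma> \<mu>) a / (fG y a)\<^sup>2) (\<lambda>y. k1 \<mu> * ?H \<mu> (\<sigma> \<mu>) y)"
      by (rule pd_quot[OF pd_fG[OF \<mu>] pd_fG1[OF \<mu> \<sigma>'[OF \<mu>]] n])
  next
    fix \<mu> \<nu> assume \<mu>: "\<mu> \<in> {1,2::11}" "\<nu> \<in> {1,2::11}"
    show "pd D \<nu> (\<lambda>y. k2 \<mu> \<nu> / fG y a) (\<lambda>y. - k2 \<mu> \<nu> * fG1 y \<nu> a / (fG y a)\<^sup>2)"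
      by (rule pd_inverse[OF pd_fG[OF \<mu>(2)] n])
    show "pd D \<mu> (\<lambda>y. - k2 \<mu> \<nu> * fG1 y \<nu> a / (fG y a)\<^sup>2) (\<lambda>y. - k2 \<mu> \<nu> * ?H \<mu> \<nu> y)"
      by (rule pd_quot[OF pd_fG[OF \<mu>(1)] pd_fG1[OF \<mu>] n])
  qed (use D x z_phi jet1 jet2 in auto)
  then show ?thesis unfolding H_def by simp
qed

lemma jet: "x \<in> D \<Longrightarrow> brane_jet (fG x) (fG1 x) (fG2 x) (fA1 x) s (fG x 1)"
  by unfold_locales ((rule base(1-4,8-13); assumption) | simp only: base(5-7))+

lemmas djet = brane_jet.axioms(1)[OF jet]

text \<open>The left side is minus the Laplacian of ln(m u). The part from ln m vanishes, and ln u
  is one third of the logarithm of a positive harmonic function, whose Laplacian is minus the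
  squared gradient of that logarithm; hence the factor 3.\<close>

lemma rho_eq:
  assumes x: "x \<in> D"
  shows "- (fG2 x 1 1 1 + fG2 x 2 2 1) / fG x 1 + ((fG1 x 1 1)\<^sup>2 + (fG1 x 2 1)\<^sup>2) / (fG x 1)\<^sup>2 = 3 * ((u1 1 x / u x)\<^sup>2 + (u1 2 x / u x)\<^sup>2)"
proof -
  have p: "m x > 0" "u x > 0" using pos x by auto
  have 1: "fG2 x 1 1 1 + fG2 x 2 2 1 = (m2 1 1 x + m2 2 2 x) * u x + 2 * (m1 1 x * u1 1 x + m1 2 x * u1 2 x) + m x * (u2 1 1 x + u2 2 2 x)"
    by (simp add: fG2_def algebra_simps)
  have 2: "(fG1 x 1 1)\<^sup>2 + (fG1 x 2 1)\<^sup>2 = (m1 1 x * u x + m x * u1 1 x)\<^sup>2 + (m1 2 x * u x + m x * u1 2 x)\<^sup>2"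
    by (simp add: fG1_def)
  have "(fG1 x 1 1)\<^sup>2 + (fG1 x 2 1)\<^sup>2 - (m x * u x) * (fG2 x 1 1 1 + fG2 x 2 2 1) = 3 * (m x)\<^sup>2 * ((u1 1 x)\<^sup>2 + (u1 2 x)\<^sup>2)"
    unfolding 1 2 using hm[OF x] hu[OF x] by algebra
  then have "(fG1 x 1 1)\<^sup>2 + (fG1 x 2 1)\<^sup>2 = (m x * u x) * (fG2 x 1 1 1 + fG2 x 2 2 1) + 3 * (m x)\<^sup>2 * ((u1 1 x)\<^sup>2 + (u1 2 x)\<^sup>2)"
    by simp
  then show ?thesis
    unfolding base(5)[OF x] using p by (simp add: field_simps power2_eq_square)
qed

text \<open>After division by the metric entry only the logarithmic derivatives \<open>v1\<close>,
  \<open>v2\<close> and second derivatives \<open>w1\<close>, \<open>w2\<close> of \<open>u\<close>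
  remain. The constants \<open>c1\<close>, \<open>c2\<close>, \<open>c3\<close> distinguish an entry
  \<open>u\<close> from one proportional to the power -2 of \<open>u\<close>.\<close>

lemma eom_aa:
  assumes x: "x \<in> D" and a: "a \<notin> {1,2}"
  shows "euler (sugra_lagrangian s c) \<phi> (metric_unit a a, 0) x = 0"
proof -
  define g where "g = fG x a"
  have g: "g \<noteq> 0" unfolding g_def by (rule base(1)[OF x])
  define v1 v2 w1 w2 where "v1 = u1 1 x / u x" and "v2 = u1 2 x / u x" and "w1 = u2 1 1 x / u x" and "w2 = u2 2 2 x / u x"
  have p: "u x > 0" "s \<noteq> 0" using pos x s by auto
  have w: "w1 + w2 = - 2 * (v1\<^sup>2 + v2\<^sup>2)"
  proof -
    have "w1 + w2 = u x * (u2 1 1 x + u2 2 2 x) / (u x)\<^sup>2"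
      unfolding w1_def w2_def using p by (simp add: add_divide_distrib power2_eq_square)
    then show ?thesis unfolding hu[OF x] v1_def v2_def by (simp add: power_divide add_divide_distrib diff_divide_distrib)
  qed
  define R where "R = (if a \<in> {9,10,11} then 1 else (0::real))"
  have kap: "(s / 2 * ((fA1 x 1)\<^sup>2 + (fA1 x 2)\<^sup>2)) * (if a \<in> {9,10,11} then 1 / (fG x 9 * fG x 10 * fG x 11) else 0) = - (9/2) * R * (v1\<^sup>2 + v2\<^sup>2)"
    unfolding K_eq power2_eq_square[of "fA1 x _"] AA_eq[of 1 1, simplified] AA_eq[of 2 2, simplified] R_def v1_def v2_def
    using p by (simp add: field_simps eval_nat_numeral)
  define c1 c2 c3 where "c1 = (if a \<in> {9,10,11} then - 2 else (1::real))" and "c2 = (if a \<in> {9,10,11} then - 2 else (1::real))"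
    and "c3 = (if a \<in> {9,10,11} then 6 else (0::real))"
  have a3: "a \<in> {3,4,5,6,7,8,9,10,11}" using a Compl_12 by blast
  have r: "fG1 x 1 a / g = c1 * v1" "fG1 x 2 a / g = c1 * v2" "fG2 x 1 1 a / g = c2 * w1 + c3 * v1\<^sup>2" "fG2 x 2 2 a / g = c2 * w2 + c3 * v2\<^sup>2"
    using a3 unfolding g_def c1_def c2_def c3_def v1_def v2_def w1_def w2_def
    by (auto simp: ratio1[OF x] ratio2[OF x] power2_eq_square)
  have f: "fG1 x 1 a = c1 * v1 * g" "fG1 x 2 a = c1 * v2 * g" "fG2 x 1 1 a = (c2 * w1 + c3 * v1\<^sup>2) * g" "fG2 x 2 2 a = (c2 * w2 + c3 * v2\<^sup>2) * g"
    using r g by (simp_all add: field_simps)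
  \<comment> \<open>With V the sum of squares of \<open>v1\<close> and \<open>v2\<close>, and w1 +
    w2 = -2 V, the coefficients of V are 3/2 - 1 - 1/2 = 0 for an entry \<open>u\<close>, and 3/2 +
    2 + 3 - 2 - 9/2 = 0 along 9, 10, 11.\<close>
  have num: "3 / 2 * (v1\<^sup>2 + v2\<^sup>2) + 1 / 2 * (c2 * w1 + c3 * v1\<^sup>2 + c2 * w2 + c3 * v2\<^sup>2) - 1 / 2 * c1\<^sup>2 * (v1\<^sup>2 + v2\<^sup>2) - (9/2) * R * (v1\<^sup>2 + v2\<^sup>2) = 0"
  proof -
    have w': "w1 = - 2 * (v1\<^sup>2 + v2\<^sup>2) - w2" using w by simp
    show ?thesis unfolding c1_def c2_def c3_def R_def w' by (cases "a \<in> {9,10,11}") (simp_all add: field_simps)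
  qed
  have "euler (sugra_lagrangian s c) \<phi> (metric_unit a a, 0) x = mom0 s (fG x) (fG1 x) (fG2 x) (fA1 x) (metric_unit a a)
    - ((3/2) * (fG2 x 1 1 a / (fG x a)\<^sup>2 - 2 * fG1 x 1 a * fG1 x 1 a / fG x a ^ 3) + (3/2) * (fG2 x 2 2 a / (fG x a)\<^sup>2 - 2 * fG1 x 2 a * fG1 x 2 a / fG x a ^ 3))
    - ((if 1 = (1::11) then -1 else 0) * (fG2 x 1 1 a / (fG x a)\<^sup>2 - 2 * fG1 x 1 a * fG1 x 1 a / fG x a ^ 3)
      + (if 1 = (2::11) then -1 else 0) * (fG2 x 1 2 a / (fG x a)\<^sup>2 - 2 * fG1 x 2 a * fG1 x 1 a / fG x a ^ 3)
      + ((if 2 = (1::11) then -1 else 0) * (fG2 x 2 1 a / (fG x a)\<^sup>2 - 2 * fG1 x 1 a * fG1 x 2 a / fG x a ^ 3)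
      + (if 2 = (2::11) then -1 else 0) * (fG2 x 2 2 a / (fG x a)\<^sup>2 - 2 * fG1 x 2 a * fG1 x 2 a / fG x a ^ 3)))"
    by (rule euler_metric[OF x, where \<sigma> = "\<lambda>\<mu>. \<mu>"]) (auto simp: brane_jet.mom1_aa[OF jet a] brane_jet.mom2_aa[OF jet a])
  \<comment> \<open>The value and the two total derivatives contribute 1 - 3/2 + 1 = 1/2 to the
    second derivatives and -3/2 + 3 - 2 = -1/2 to the squares of first derivatives.\<close>
  also have "\<dots> = (1 / g) * (3 / 2 * (v1\<^sup>2 + v2\<^sup>2) + 1 / 2 * (c2 * w1 + c3 * v1\<^sup>2 + c2 * w2 + c3 * v2\<^sup>2) - 1 / 2 * c1\<^sup>2 * (v1\<^sup>2 + v2\<^sup>2) - (9/2) * R * (v1\<^sup>2 + v2\<^sup>2))"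
    unfolding brane_jet.mom0_aa[OF jet[OF x] a] rho_eq[OF x] kap g_def[symmetric] v1_def[symmetric] v2_def[symmetric] f
    using g by (simp add: field_simps power2_eq_square power3_eq_cube)
  finally show ?thesis unfolding num by simp
qed

text \<open>An identity for every conformal factor: the second derivatives cancel as 1/2 - 1/2 and
  1/2 - 3/2 + 1, the squares as -1 + 1 and -1 + 3 - 2. No harmonicity enters here.\<close>

lemma eom_11:
  assumes x: "x \<in> D"
  shows "euler (sugra_lagrangian s c) \<phi> (metric_unit 1 1, 0) x = 0"
proof -
  note m = brane_jet.mom0_11[OF jet] brane_jet.mom1_11[OF jet] brane_jet.mom2_11[OF jet]
  have "fG x 1 \<noteq> 0" by (rule base(1)[OF x])
  then show ?thesis
    by (subst euler_metric[OF x, where \<sigma> = "\<lambda>\<mu>. \<mu>" and a = 1 and ?k1.0 = "\<lambda>\<kappa>. if \<kappa> = 1 then 1/2 else 3/2" and ?k2.0 = "\<lambda>\<kappa> \<kappa>'. if \<kappa> = 2 \<and> \<kappa>' = 2 then -1 else 0"])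
       (simp_all add: m x field_simps power2_eq_square power3_eq_cube)
qed

lemma eom_22:
  assumes x: "x \<in> D"
  shows "euler (sugra_lagrangian s c) \<phi> (metric_unit 2 2, 0) x = 0"
proof -
  note m = brane_jet.mom0_22[OF jet] brane_jet.mom1_22[OF jet] brane_jet.mom2_22[OF jet]
  have "fG x 1 \<noteq> 0" by (rule base(1)[OF x])
  then show ?thesis
    by (subst euler_metric[OF x, where \<sigma> = "\<lambda>\<mu>. \<mu>" and a = 1 and ?k1.0 = "\<lambda>\<kappa>. if \<kappa> = 2 then 1/2 else 3/2" and ?k2.0 = "\<lambda>\<kappa> \<kappa>'. if \<kappa> = 1 \<and> \<kappa>' = 1 then -1 else 0"])
       (simp_all add: m x field_simps power2_eq_square power3_eq_cube)
qed

text \<open>Here \<open>mom0\<close> vanishes, and the two total derivatives of \<open>mom1\<close>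
  cancel the two mixed ones of \<open>mom2\<close>.\<close>

lemma eom_12:
  assumes x: "x \<in> D"
  shows "euler (sugra_lagrangian s c) \<phi> (metric_unit 1 2, 0) x = 0"
proof -
  note m = brane_jet.mom0_12[OF jet] brane_jet.mom1_12[OF jet] brane_jet.mom2_12[OF jet]
  have "fG x 1 \<noteq> 0" by (rule base(1)[OF x])
  then show ?thesis
    by (subst euler_metric[OF x, where \<sigma> = "\<lambda>\<mu>. if \<mu> = 1 then 2 else 1" and a = 1 and ?k1.0 = "\<lambda>\<kappa>. -1" and ?k2.0 = "\<lambda>\<kappa> \<kappa>'. if \<kappa> \<noteq> \<kappa>' then 1 else 0"])
       (simp_all add: m x field_simps power2_eq_square power3_eq_cube)
qed

lemma eom_offdiag:
  assumes x: "x \<in> D" and mn: "\<mu> \<noteq> \<nu>" "{\<mu>,\<nu>} \<noteq> {1,2}"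
  shows "euler (sugra_lagrangian s c) \<phi> (metric_unit \<mu> \<nu>, 0) x = 0"
proof -
  have 0: "mom0 s (fG y) (fG1 y) (fG2 y) (fA1 y) (metric_unit \<mu> \<nu>) = 0" if "y \<in> D" for y
    unfolding mom0_def by (rule diag_jet.Lg_offdiag_0[OF djet[OF that] mn])
  have 1: "mom1 s (fG y) (fG1 y) (fG2 y) (fA1 y) (metric_unit \<mu> \<nu>) \<kappa> = 0 * fG1 y \<kappa> 1 / (fG y 1)\<^sup>2" if "y \<in> D" "\<kappa> \<in> {1,2}" for y \<kappa>
  proof -
    have "mom1 s (fG y) (fG1 y) (fG2 y) (fA1 y) (metric_unit \<mu> \<nu>) \<kappa> = 0"
      unfolding mom1_def by (rule diag_jet.Lg_offdiag_1[OF djet[OF that(1)] mn that(2)])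
    then show ?thesis by simp
  qed
  have 2: "mom2 s (fG y) (fG1 y) (fG2 y) (fA1 y) (metric_unit \<mu> \<nu>) \<kappa> \<kappa>' = 0 / fG y 1" if "y \<in> D" "\<kappa> \<in> {1,2}" "\<kappa>' \<in> {1,2}" for y \<kappa> \<kappa>'
  proof -
    have "mom2 s (fG y) (fG1 y) (fG2 y) (fA1 y) (metric_unit \<mu> \<nu>) \<kappa> \<kappa>' = 0"
      unfolding mom2_def by (rule diag_jet.Lg_offdiag_2[OF djet[OF that(1)] mn that(2,3)])
    then show ?thesis by simp
  qed
  show ?thesis
    by (subst euler_metric[OF x, where \<sigma> = "\<lambda>\<mu>. \<mu>" and a = 1 and ?k1.0 = "\<lambda>\<kappa>. 0" and ?k2.0 = "\<lambda>\<kappa> \<kappa>'. 0"])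
       (use 0 1 2 x in simp_all)
qed

text \<open>The momentum of the potential along \<omega> is a constant times the gradient of
  \<open>u\<^sup>3\<close>, because the powers of \<open>u\<close> in the potential and in the
  metric combine to that; its divergence vanishes by \<open>hu\<close>. All other components have
  zero momentum and are covered by \<open>tt = 0\<close>.\<close>

lemma eom_form:
  assumes x: "x \<in> D"
  shows "euler (sugra_lagrangian s c) \<phi> (0, form3 \<mu> \<nu> \<rho>) x = 0"
proof -
  let ?f = "\<lambda>y \<kappa> r. Lg s (diagm (fG y)) (\<lambda>\<alpha>. diagm (fG1 y \<alpha>)) (\<lambda>\<alpha> \<beta>. diagm (fG2 y \<alpha> \<beta>))
      (\<lambda>\<alpha>. fA1 y \<alpha> *\<^sub>R \<omega> + (if \<alpha> = \<kappa> then r else 0) *\<^sub>R form3 \<mu> \<nu> \<rho>)"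
  obtain tt where tt: "\<And>y \<kappa>. y \<in> D \<Longrightarrow> \<kappa> \<in> {1,2} \<Longrightarrow> DERIV (?f y \<kappa>) 0 :> - s * fA1 y \<kappa> * tt / (fG y 9 * fG y 10 * fG y 11)"
  proof (cases "{\<mu>,\<nu>,\<rho>} = {9,10,11}")
    case True
    then obtain tt where w: "form3 \<mu> \<nu> \<rho> = tt *\<^sub>R \<omega>" using omega_perm by blast
    show thesis
    proof (rule that[of tt])
      fix y \<kappa> assume y: "y \<in> D" and k: "\<kappa> \<in> {1,2::11}"
      show "DERIV (?f y \<kappa>) 0 :> - s * fA1 y \<kappa> * tt / (fG y 9 * fG y 10 * fG y 11)"
        unfolding w by (rule brane_jet.DERIV_Lg_form[OF jet[OF y] k])
    qed
  next
    case False
    show thesis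
    proof (rule that[of 0])
      fix y \<kappa> assume y: "y \<in> D" and k: "\<kappa> \<in> {1,2::11}"
      have "?f y \<kappa> differentiable (at 0)" by (rule diag_jet.Lg_form(1)[OF djet[OF y] k False])
      moreover have "deriv (?f y \<kappa>) 0 = 0" by (rule diag_jet.Lg_form(2)[OF djet[OF y] k False])
      ultimately have "DERIV (?f y \<kappa>) 0 :> 0" using DERIV_imp_deriv by (fastforce simp: real_differentiable_def)
      then show "DERIV (?f y \<kappa>) 0 :> - s * fA1 y \<kappa> * 0 / (fG y 9 * fG y 10 * fG y 11)" by simp
    qed
  qed
  define P where "P \<kappa> y = - 3 * t * tt * (u1 \<kappa> y * (u y)\<^sup>2)" for \<kappa> y
  define P' where "P' \<kappa> y = - 3 * t * tt * (u2 \<kappa> \<kappa> y * (u y)\<^sup>2 + 2 * u y * (u1 \<kappa> y)\<^sup>2)" for \<kappa> y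
  have P: "- s * fA1 y \<kappa> * tt / (fG y 9 * fG y 10 * fG y 11) = P \<kappa> y" if "y \<in> D" "\<kappa> \<in> {1,2}" for y \<kappa>
  proof -
    have "u y > 0" "s \<noteq> 0" using pos that s by auto
    then show ?thesis using that(2) unfolding K_eq P_def by (simp add: fA1_def field_simps eval_nat_numeral)
  qed
  have dP: "pd D \<kappa> (P \<kappa>) (P' \<kappa>)" if k: "\<kappa> \<in> {1,2}" for \<kappa>
    unfolding pd_real_iff
  proof
    fix y assume y: "y \<in> D"
    have d: "DERIV (\<lambda>t. u (y + t *\<^sub>R axis \<kappa> 1)) 0 :> u1 \<kappa> y" "DERIV (\<lambda>t. u1 \<kappa> (y + t *\<^sub>R axis \<kappa> 1)) 0 :> u2 \<kappa> \<kappa> y"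
      using u1[OF k] u2[OF k k] y by (auto simp: pd_real_iff)
    show "DERIV (\<lambda>t. P \<kappa> (y + t *\<^sub>R axis \<kappa> 1)) 0 :> P' \<kappa> y"
      unfolding P_def P'_def by (auto intro!: derivative_eq_intros d) (simp add: algebra_simps power2_eq_square)
  qed
  have "euler (sugra_lagrangian s c) \<phi> (0, form3 \<mu> \<nu> \<rho>) x = 0 - (P' 1 x + P' 2 x) + (0 + 0 + (0 + 0))"
  proof (rule euler_eval[where ?J1.0 = "\<lambda>y \<alpha>. (diagm (fG1 y \<alpha>), fA1 y \<alpha> *\<^sub>R \<omega>)" and ?J2.0 = "\<lambda>y \<alpha> \<beta>. (diagm (fG2 y \<alpha> \<beta>), fA2 y \<alpha> \<beta> *\<^sub>R \<omega>)"
        and ?P1.0 = P and ?P2.0 = "\<lambda>\<mu> \<nu> y. 0" and ?Q1.0 = P' and ?Q2.0 = "\<lambda>\<mu> \<nu> y. 0" and ?R2.0 = "\<lambda>\<mu> \<nu> y. 0"])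
    show "deriv (\<lambda>r. sugra_lagrangian s c (\<phi> x + r *\<^sub>R (0, form3 \<mu> \<nu> \<rho>)) (\<lambda>\<alpha>. (diagm (fG1 x \<alpha>), fA1 x \<alpha> *\<^sub>R \<omega>))
       (\<lambda>\<alpha> \<beta>. (diagm (fG2 x \<alpha> \<beta>), fA2 x \<alpha> \<beta> *\<^sub>R \<omega>))) 0 = 0"
      unfolding sugra_Lg phi[OF x] by (simp add: chern_simons_base)
  next
    fix y \<kappa> assume y: "y \<in> D" "\<kappa> \<in> {1,2::11}"
    \<comment> \<open>The Chern-Simons part of the variation is of second order in \<open>r\<close>,
      whatever its coefficient \<open>q\<close>, and adds nothing to the derivative.\<close>
    have "DERIV (\<lambda>r. ?f y \<kappa> r + c * (r\<^sup>2 * q)) 0 :> P \<kappa> y" for q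
      by (rule DERIV_cong[OF DERIV_add[OF tt[OF y, unfolded P[OF y]]]]) (auto intro!: derivative_eq_intros)
    from DERIV_imp_deriv[OF this]
    show "deriv (\<lambda>r. sugra_lagrangian s c (\<phi> y) (\<lambda>\<alpha>. (diagm (fG1 y \<alpha>), fA1 y \<alpha> *\<^sub>R \<omega>) + (if \<alpha> = \<kappa> then r else 0) *\<^sub>R (0, form3 \<mu> \<nu> \<rho>))
       (\<lambda>\<alpha> \<beta>. (diagm (fG2 y \<alpha> \<beta>), fA2 y \<alpha> \<beta> *\<^sub>R \<omega>))) 0 = P \<kappa> y"
      unfolding sugra_Lg phi[OF y(1)] by (simp add: chern_simons_var)
  next
    fix y \<kappa> \<kappa>' assume y: "y \<in> D" "\<kappa> \<in> {1,2::11}" "\<kappa>' \<in> {1,2::11}"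
    show "deriv (\<lambda>r. sugra_lagrangian s c (\<phi> y) (\<lambda>\<alpha>. (diagm (fG1 y \<alpha>), fA1 y \<alpha> *\<^sub>R \<omega>))
       (\<lambda>\<alpha> \<beta>. (diagm (fG2 y \<alpha> \<beta>), fA2 y \<alpha> \<beta> *\<^sub>R \<omega>) + ((if \<alpha> = \<kappa> \<and> \<beta> = \<kappa>' then r / 2 else 0) + (if \<alpha> = \<kappa>' \<and> \<beta> = \<kappa> then r / 2 else 0)) *\<^sub>R (0, form3 \<mu> \<nu> \<rho>))) 0
       = 0"
      unfolding sugra_Lg phi[OF y(1)] by (simp add: chern_simons_base)
  qed (use D x z_phi jet1 jet2 dP pd_const in auto)
  also have "\<dots> = 0"
  proof -
    have "P' 1 x + P' 2 x = - 3 * t * tt * u x * (u x * (u2 1 1 x + u2 2 2 x) + 2 * ((u1 1 x)\<^sup>2 + (u1 2 x)\<^sup>2))"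
      unfolding P'_def by (simp add: algebra_simps power2_eq_square)
    then show ?thesis unfolding hu[OF x] by simp
  qed
  finally show ?thesis .
qed

lemma bosonic_eom_phi:
  assumes "\<phi> = (\<lambda>y. (g y, A y))"
  shows "bosonic_eom s c D g A"
  unfolding bosonic_eom_def assms[symmetric]
proof (intro ballI conjI allI)
  fix x \<mu> \<nu> assume x: "x \<in> D"
  show "euler (sugra_lagrangian s c) \<phi> (metric_unit \<mu> \<nu>, 0) x = 0"
  proof (cases "\<mu> = \<nu>")
    case True
    then show ?thesis using eom_11[OF x] eom_22[OF x] eom_aa[OF x, of \<mu>] by (cases "\<mu> \<in> {1,2}") auto
  next
    case False
    show ?thesis
    proof (cases "{\<mu>,\<nu>} = {1,2}")
      case True
      then show ?thesis using eom_12[OF x] metric_unit_commute[of 2 1] by (auto simp: doubleton_eq_iff)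
    next
      case 2: False
      show ?thesis by (rule eom_offdiag[OF x False 2])
    qed
  qed
next
  fix x \<mu> \<nu> \<rho> assume x: "x \<in> D"
  show "euler (sugra_lagrangian s c) \<phi> (0, form3 \<mu> \<nu> \<rho>) x = 0" by (rule eom_form[OF x])
qed

end

lemma bosonic_eom_diag:
  assumes z: "zdep g" "zdep A"
    and g: "\<And>x. x \<in> D \<Longrightarrow> g x = (\<chi> a b. if a \<noteq> b then 0 else if a \<in> {1,2} then m x * u x else if a \<in> {3,4,5,6,7,8} then u x
       else if a = 9 then - s / (u x)\<^sup>2 else s / (u x)\<^sup>2)"
    and A: "\<And>x. x \<in> D \<Longrightarrow> A x = (t / u x ^ 3) *\<^sub>R \<omega>"
  shows "bosonic_eom s c D g A"
proof (rule bosonic_eom_phi)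
  show "zdep (\<lambda>y. (g y, A y))" using z unfolding zdep_def by blast
  show "(g x, A x) = (diagm (fG x), fA x *\<^sub>R \<omega>)" if "x \<in> D" for x
    by (simp add: g[OF that] A[OF that] diagm_def fG_def fA_def vec_eq_iff)
qed simp

end

subsection \<open>Holomorphic data\<close>

definition zdir :: "11 \<Rightarrow> complex" where
  "zdir i = (if i = 1 then 1 else \<i>)"

lemma pd_holomorphic:
  assumes f: "f holomorphic_on U" and U: "open U" and i: "i \<in> {1,2}"
  shows "pd {x. zcoord x \<in> U} i (\<lambda>x. f (zcoord x)) (\<lambda>x. zdir i * deriv f (zcoord x))"
  unfolding pd_def
proof
  fix x assume "x \<in> {x. zcoord x \<in> U}"
  then have z: "zcoord x \<in> U" by simp
  have zc: "zcoord (x + t *\<^sub>R axis i 1) = zcoord x + of_real t * zdir i" for t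
    using i zcoord_shift(1,2)[of x t] by (auto simp: zdir_def)
  have c: "((\<lambda>t. zcoord x + of_real t * zdir i) has_vector_derivative zdir i) (at 0)"
    by (auto intro!: derivative_eq_intros simp: has_vector_derivative_def scaleR_conv_of_real)
  have "(f has_field_derivative deriv f (zcoord x)) (at (zcoord x + of_real 0 * zdir i))"
    using holomorphic_derivI[OF f U z] by simp
  from field_vector_diff_chain_at[OF c this]
  show "((\<lambda>t. f (zcoord (x + t *\<^sub>R axis i 1))) has_vector_derivative zdir i * deriv f (zcoord x)) (at 0)"
    by (simp add: zc o_def)
qed

lemma pd_Re: "pd D i f f' \<Longrightarrow> pd D i (\<lambda>x. Re (f x)) (\<lambda>x. Re (f' x))"
  unfolding pd_def by (auto intro: bounded_linear.has_vector_derivative[OF bounded_linear_Re])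

lemma pd_Im: "pd D i f f' \<Longrightarrow> pd D i (\<lambda>x. Im (f x)) (\<lambda>x. Im (f' x))"
  unfolding pd_def by (auto intro: bounded_linear.has_vector_derivative[OF bounded_linear_Im])

lemma pd_mult_left: "pd D i f f' \<Longrightarrow> pd D i (\<lambda>x. c * f x) (\<lambda>x. c * f' x)" for c :: complex
  unfolding pd_def by (auto intro: bounded_linear.has_vector_derivative[OF bounded_linear_mult_right])

lemma pd_add: "pd D i f f' \<Longrightarrow> pd D i g g' \<Longrightarrow> pd D i (\<lambda>x. f x + g x) (\<lambda>x. f' x + g' x)"
  unfolding pd_def by (auto intro!: has_vector_derivative_add)

lemma pd_mult:
  fixes f g :: "point \<Rightarrow> real"
  assumes "pd D i f f'" "pd D i g g'"
  shows "pd D i (\<lambda>x. f x * g x) (\<lambda>x. f' x * g x + f x * g' x)"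
  using assms unfolding pd_real_iff by (auto intro!: derivative_eq_intros)

text \<open>The exponent -2/3 is written as a division by the square of the cube root, so that
  \<open>pd_quot\<close> applies to the result.\<close>

lemma pd_powr_third:
  assumes f: "pd D i f f'" and pos: "\<And>x. x \<in> D \<Longrightarrow> f x > (0::real)"
  shows "pd D i (\<lambda>x. f x powr (1/3)) (\<lambda>x. 1/3 * f' x / (f x powr (1/3))\<^sup>2)"
  unfolding pd_real_iff
proof
  fix x assume x: "x \<in> D"
  have d: "DERIV (\<lambda>t. f (x + t *\<^sub>R axis i 1)) 0 :> f' x" using f x by (simp add: pd_real_iff)
  have "DERIV (\<lambda>t. f (x + t *\<^sub>R axis i 1) powr (1/3)) 0 :> (1/3) * f x powr (1/3 - 1) * f' x"
    using pos[OF x] by (auto intro!: derivative_eq_intros d simp: powr_diff)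
  moreover have "f x powr (1/3 - 1) = 1 / (f x powr (1/3))\<^sup>2"
  proof -
    have "f x powr (1/3 - 1) * (f x powr (1/3))\<^sup>2 = 1"
      using pos[OF x] by (simp add: power2_eq_square powr_add[symmetric])
    then show ?thesis using pos[OF x] by (simp add: field_simps)
  qed
  ultimately show "DERIV (\<lambda>t. f (x + t *\<^sub>R axis i 1) powr (1/3)) 0 :> 1/3 * f' x / (f x powr (1/3))\<^sup>2"
    by (simp add: mult.commute)
qed

section \<open>The equations of motion for an arbitrary pair of holomorphic functions\<close>

lemma bosonic_eom_brane:
  fixes E F :: "complex \<Rightarrow> complex" and s t c :: real
  assumes U: "open U" and E: "E holomorphic_on U" and F: "F holomorphic_on U"
    and E0: "\<And>z. z \<in> U \<Longrightarrow> Re (E z) > 0" and F0: "\<And>z. z \<in> U \<Longrightarrow> F z \<noteq> 0"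
    and s: "s * s = 1" and t: "t * t = 1"
  shows "bosonic_eom s c {x. zcoord x \<in> U}
    (\<lambda>x. brane_metric (F (zcoord x)) (Re (E (zcoord x))) (- s) s) (\<lambda>x. (t / Re (E (zcoord x))) *\<^sub>R form3 9 10 11)"
proof -
  let ?D = "{x. zcoord x \<in> U}"
  define h where "h x = Re (E (zcoord x))" for x
  define h1 where "h1 i x = Re (zdir i * deriv E (zcoord x))" for i x
  define h2 where "h2 i j x = Re (zdir j * (zdir i * deriv (deriv E) (zcoord x)))" for i j x
  define a where "a x = Re (F (zcoord x))" for x
  define a1 where "a1 i x = Re (zdir i * deriv F (zcoord x))" for i x
  define a2 where "a2 i j x = Re (zdir j * (zdir i * deriv (deriv F) (zcoord x)))" for i j x
  define b where "b x = Im (F (zcoord x))" for x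
  define b1 where "b1 i x = Im (zdir i * deriv F (zcoord x))" for i x
  define b2 where "b2 i j x = Im (zdir j * (zdir i * deriv (deriv F) (zcoord x)))" for i j x
  note defs = h_def h1_def h2_def a_def a1_def a2_def b_def b1_def b2_def
  define m where "m x = a x * a x + b x * b x" for x
  define m1 where "m1 i x = (a1 i x * a x + a x * a1 i x) + (b1 i x * b x + b x * b1 i x)" for i x
  define m2 where "m2 i j x = ((a2 i j x * a x + a1 j x * a1 i x) + (a1 i x * a1 j x + a x * a2 i j x))
     + ((b2 i j x * b x + b1 j x * b1 i x) + (b1 i x * b1 j x + b x * b2 i j x))" for i j x
  define u where "u x = h x powr (1/3)" for x
  define u1 where "u1 i x = 1/3 * h1 i x / (u x)\<^sup>2" for i x
  define u2 where "u2 i j x = 1/3 * (h2 i j x / (u x)\<^sup>2 - 2 * h1 j x * u1 i x / u x ^ 3)" for i j x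
  have D: "open ?D"
  proof -
    have "continuous_on UNIV zcoord" unfolding zcoord_def Complex_eq by (intro continuous_intros)
    then show ?thesis using U by (simp add: continuous_on_open_vimage vimage_def)
  qed
  have dE: "deriv E holomorphic_on U" and dF: "deriv F holomorphic_on U"
    using E F U by (auto intro: holomorphic_deriv)
  have pa: "pd ?D i a (a1 i)" "pd ?D i b (b1 i)" "pd ?D i h (h1 i)" if i: "i \<in> {1,2}" for i
    unfolding defs by (intro pd_Re pd_Im pd_holomorphic[OF F U i] pd_holomorphic[OF E U i])+
  have pa2: "pd ?D i (a1 j) (a2 i j)" "pd ?D i (b1 j) (b2 i j)" "pd ?D i (h1 j) (h2 i j)" if i: "i \<in> {1,2}" for i j
    unfolding defs by (intro pd_Re pd_Im pd_mult_left pd_holomorphic[OF dF U i] pd_holomorphic[OF dE U i])+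
  have hp: "h x > 0" if "x \<in> ?D" for x using that E0 by (simp add: h_def)
  have up: "u x > 0" if "x \<in> ?D" for x using hp[OF that] by (simp add: u_def)
  have u3: "u x ^ 3 = h x" if "x \<in> ?D" for x
    using hp[OF that] by (simp add: u_def power3_eq_cube powr_add[symmetric])
  have pu: "pd ?D i u (u1 i)" if i: "i \<in> {1,2}" for i
    unfolding u_def u1_def by (rule pd_powr_third[OF pa(3)[OF i] hp])
  have pu2: "pd ?D i (u1 j) (u2 i j)" if i: "i \<in> {1,2}" for i j
    unfolding u1_def[of j] u2_def by (rule pd_quot[OF pu[OF i] pa2(3)[OF i]]) (use up in force)
  show ?thesis
  proof (rule bosonic_eom_diag[of ?D m u m1 u1 m2 u2 s t])
    show "open ?D" by (rule D)
    show "m x > 0" if "x \<in> ?D" for x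
    proof -
      have "F (zcoord x) \<noteq> 0" using F0 that by simp
      then have "(cmod (F (zcoord x)))\<^sup>2 > 0" by simp
      then show ?thesis unfolding cmod_power2 by (simp add: m_def a_def b_def power2_eq_square)
    qed
    show "u x > 0" if "x \<in> ?D" for x by (rule up[OF that])
    show "pd ?D i m (m1 i)" if "i \<in> {1,2}" for i
      unfolding m_def m1_def by (intro pd_add pd_mult pa that)
    show "pd ?D i u (u1 i)" if "i \<in> {1,2}" for i by (rule pu[OF that])
    show "pd ?D i (m1 j) (m2 i j)" if "i \<in> {1,2}" "j \<in> {1,2}" for i j
      unfolding m1_def m2_def by (intro pd_add pd_mult pa pa2 that)
    show "pd ?D i (u1 j) (u2 i j)" if "i \<in> {1,2}" "j \<in> {1,2}" for i j by (rule pu2[OF that(1)])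
    show "m2 2 1 = m2 1 2" by (simp add: fun_eq_iff m2_def a2_def b2_def mult_ac)
    show "u2 2 1 = u2 1 2" by (simp add: fun_eq_iff u2_def u1_def h2_def mult_ac)
    \<comment> \<open>Second derivatives of \<open>F\<close> cancel since the squares of 1 and \<i>
      add up to zero; both sides then equal four times the product of the squared moduli of
      \<open>F\<close> and its derivative.\<close>
    show "m x * (m2 1 1 x + m2 2 2 x) = (m1 1 x)\<^sup>2 + (m1 2 x)\<^sup>2" for x
      unfolding m_def m1_def m2_def a1_def a2_def b1_def b2_def zdir_def
      by simp algebra
    show "u x * (u2 1 1 x + u2 2 2 x) = - 2 * ((u1 1 x)\<^sup>2 + (u1 2 x)\<^sup>2)" if x: "x \<in> ?D" for x
    proof -
      \<comment> \<open>The same cancellation makes \<open>h\<close> harmonic; rewriting its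
        derivatives through those of its cube root gives the equation for \<open>u\<close>.\<close>
      have "h2 1 1 x + h2 2 2 x = 0" by (simp add: h2_def zdir_def)
      then have h22: "h2 2 2 x = - h2 1 1 x" by simp
      have "h1 i x = 3 * (u x)\<^sup>2 * u1 i x" for i using up[OF x] by (simp add: u1_def)
      then show ?thesis
        unfolding u2_def h22 using up[OF x] by (simp add: field_simps eval_nat_numeral)
    qed
    show "s * s = 1" "t * t = 1" by (fact s t)+
    show "zdep (\<lambda>x. brane_metric (F (zcoord x)) (Re (E (zcoord x))) (- s) s)"
      "zdep (\<lambda>x. (t / Re (E (zcoord x))) *\<^sub>R \<omega>)" by (simp_all add: zdep_def)
    fix x assume x: "x \<in> ?D"
    have m: "Re (F (zcoord x) * cnj (F (zcoord x))) = m x" by (simp add: m_def a_def b_def)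
    have h': "Re (E (zcoord x)) = h x" by (simp add: h_def)
    have u2': "h x powr (-2/3) = 1 / (u x)\<^sup>2"
    proof -
      have "h x powr (-2/3) * (u x)\<^sup>2 = 1"
        using hp[OF x] by (simp add: u_def power2_eq_square powr_add[symmetric])
      then show ?thesis using up[OF x] by (simp add: field_simps)
    qed
    show "brane_metric (F (zcoord x)) (Re (E (zcoord x))) (- s) s =
      (\<chi> a b. if a \<noteq> b then 0 else if a \<in> {1,2} then m x * u x else if a \<in> {3,4,5,6,7,8} then u x
       else if a = 9 then - s / (u x)\<^sup>2 else s / (u x)\<^sup>2)"
      unfolding brane_metric_def m h' u2' u_def[symmetric] by (simp add: vec_eq_iff)
    show "(t / Re (E (zcoord x))) *\<^sub>R \<omega> = (t / u x ^ 3) *\<^sub>R \<omega>"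
      unfolding h' u3[OF x] ..
  qed
qed

section \<open>Signature and the two theories\<close>

lemma brane_metric_signature:
  assumes h: "h > 0" and F: "F \<noteq> 0"
  shows "has_signature 1 10 (brane_metric F h (- 1) 1)" "time_coordinates (brane_metric F h (- 1) 1) = {9}"
    "has_signature 2 9 (brane_metric F h 1 (- 1))" "time_coordinates (brane_metric F h 1 (- 1)) = {10,11}"
proof -
  define d where "d a b \<mu> = (if \<mu> \<in> {1,2} then Re (F * cnj F) * h powr (1/3) else if \<mu> \<in> {3,4,5,6,7,8} then h powr (1/3)
    else if \<mu> = 9 then a * h powr (-2/3) else b * h powr (-2/3))" for a b :: real and \<mu> :: 11
  have g: "brane_metric F h a b = (\<chi> \<mu> \<nu>. if \<mu> = \<nu> then d a b \<mu> else 0)" for a b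
    unfolding brane_metric_def d_def by (simp add: vec_eq_iff)
  have FF: "Re (F * cnj F) > 0"
  proof -
    have "(cmod F)\<^sup>2 > 0" using F by simp
    then show ?thesis unfolding cmod_power2 by (simp add: power2_eq_square)
  qed
  have neg1: "{\<mu>. d (- 1) 1 \<mu> < 0} = {9}" and neg2: "{\<mu>. d 1 (- 1) \<mu> < 0} = {10,11}"
  proof -
    \<comment> \<open>The last branch of \<open>brane_metric\<close> must be shown to contain only
      10 and 11, by enumerating the index type, in which 11 is 0.\<close>
    have *: "\<mu> \<notin> {1,2} \<Longrightarrow> \<mu> \<notin> {3,4,5,6,7,8} \<Longrightarrow> \<mu> \<noteq> 9 \<Longrightarrow> \<mu> \<in> {10,11::11}" for \<mu>
      using UNIV_I[of \<mu>] unfolding UNIV_11 by blast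
    show "{\<mu>. d (- 1) 1 \<mu> < 0} = {9}" using FF h by (auto simp: d_def mult_less_0_iff split: if_splits)
    show "{\<mu>. d 1 (- 1) \<mu> < 0} = {10,11}" using FF h * by (auto simp: d_def mult_less_0_iff split: if_splits)
  qed
  have nz: "d a b \<mu> \<noteq> 0" if "a \<noteq> 0" "b \<noteq> 0" for a b \<mu> using that FF h by (auto simp: d_def)
  have sig: "has_signature (card {\<mu>. d a b \<mu> < 0}) (11 - card {\<mu>. d a b \<mu> < 0}) (brane_metric F h a b)" if "a \<noteq> 0" "b \<noteq> 0" for a b
    unfolding has_signature_def
  proof (intro exI conjI allI)
    show "invertible (mat 1 :: real^11^11)" by (simp add: invertible_def)
    show "transpose (mat 1) ** brane_metric F h a b ** mat 1 = (\<chi> \<mu> \<nu>. if \<mu> = \<nu> then d a b \<mu> else 0)"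
      by (simp add: g transpose_mat matrix_mul_lid matrix_mul_rid)
    show "d a b \<mu> \<noteq> 0" for \<mu> by (rule nz[OF that])
    have "{\<mu>. d a b \<mu> > 0} = UNIV - {\<mu>. d a b \<mu> < 0}" using nz[OF that] by (auto simp: less_le)
    then show "card {\<mu>. d a b \<mu> > 0} = 11 - card {\<mu>. d a b \<mu> < 0}" by (simp add: card_Diff_subset)
  qed simp
  show "has_signature 1 10 (brane_metric F h (- 1) 1)" using sig[of "-1" 1] unfolding neg1 by simp
  show "has_signature 2 9 (brane_metric F h 1 (- 1))" using sig[of 1 "-1"] unfolding neg2 by (simp flip: numeral_2_eq_2)
  show "time_coordinates (brane_metric F h (- 1) 1) = {9}" "time_coordinates (brane_metric F h 1 (- 1)) = {10,11}"
    unfolding time_coordinates_def g using neg1 neg2 by simp_all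
qed

text \<open>The sign of the potential always equals the sign of directions 10 and 11, so only the
  pairs (1, 1) and (-1, -1) of \<open>s\<close> and \<open>t\<close> occur.\<close>

lemma solves_theory_brane:
  fixes E F :: "complex \<Rightarrow> complex" and c :: real
  assumes U: "open U" and E: "E holomorphic_on U" and F: "F holomorphic_on U"
    and E0: "\<And>z. z \<in> U \<Longrightarrow> Re (E z) > 0" and F0: "\<And>z. z \<in> U \<Longrightarrow> F z \<noteq> 0"
  shows "solves_theory 1 10 1 c {9} {x. zcoord x \<in> U}
      (\<lambda>x. brane_metric (F (zcoord x)) (Re (E (zcoord x))) (- 1) 1) (\<lambda>x. (1 / Re (E (zcoord x))) *\<^sub>R form3 9 10 11)"
    "solves_theory 2 9 (- 1) c {10,11} {x. zcoord x \<in> U}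
      (\<lambda>x. brane_metric (F (zcoord x)) (Re (E (zcoord x))) 1 (- 1)) (\<lambda>x. (- 1 / Re (E (zcoord x))) *\<^sub>R form3 9 10 11)"
  using bosonic_eom_brane[OF assms, of 1 1 c] bosonic_eom_brane[OF assms, of "-1" "-1" c] brane_metric_signature E0 F0
  unfolding solves_theory_def by simp_all

section \<open>Holomorphy of the recursively defined functions\<close>

text \<open>By the Cauchy-Riemann equations the real derivative of the pair is multiplication by the
  complex number formed from its values in direction 1.\<close>

lemma conjugate_harmonic_holomorphic:
  assumes U: "open U" and HB: "conjugate_harmonic_on U H B"
  shows "(\<lambda>z. Complex (H z) (B z)) holomorphic_on U"
  unfolding holomorphic_on_def
proof
  fix z assume z: "z \<in> U"
  let ?H = "frechet_derivative H (at z)" and ?B = "frechet_derivative B (at z)"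
  have d: "(H has_derivative ?H) (at z)" "(B has_derivative ?B) (at z)"
    and cr: "?H 1 = ?B \<i>" "?H \<i> = - ?B 1"
    using HB z by (auto simp: conjugate_harmonic_on_def frechet_derivative_works[symmetric])
  have lin: "linear ?H" "linear ?B" using d by (auto intro: has_derivative_linear)
  have ex: "f w = Re w * f 1 + Im w * f \<i>" if "linear f" for f :: "complex \<Rightarrow> real" and w
  proof -
    have "w = Re w *\<^sub>R 1 + Im w *\<^sub>R \<i>" by (simp add: complex_eq_iff)
    then have "f w = f (Re w *\<^sub>R 1 + Im w *\<^sub>R \<i>)" by simp
    also have "\<dots> = Re w * f 1 + Im w * f \<i>" by (simp add: linear_add[OF that] linear_scale[OF that])
    finally show ?thesis .
  qed
  have "((\<lambda>z. of_real (H z) + \<i> * of_real (B z)) has_derivative (\<lambda>w. of_real (?H w) + \<i> * of_real (?B w))) (at z)"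
    by (intro derivative_intros d)
  moreover have "(\<lambda>w. of_real (?H w) + \<i> * of_real (?B w)) = (*) (Complex (?H 1) (?B 1))"
  proof
    fix w
    show "of_real (?H w) + \<i> * of_real (?B w) = Complex (?H 1) (?B 1) * w"
      unfolding ex[OF lin(1), of w] ex[OF lin(2), of w] cr(2) by (simp add: complex_eq_iff cr(1))
  qed
  ultimately have "((\<lambda>z. Complex (H z) (B z)) has_field_derivative Complex (?H 1) (?B 1)) (at z)"
    by (simp add: has_field_derivative_def Complex_eq)
  then show "(\<lambda>z. Complex (H z) (B z)) field_differentiable (at z within U)"
    using field_differentiable_at_within field_differentiable_def by blast
qed

text \<open>Only earlier members of the sequence occur as denominators, hence the half-open
  range.\<close>

lemma calE_holomorphic:
  assumes "e holomorphic_on U" "\<And>z q. z \<in> U \<Longrightarrow> q \<in> {1..<p} \<Longrightarrow> calE (e z) q \<noteq> 0"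
  shows "(\<lambda>z. calE (e z) p) holomorphic_on U"
  using assms(2)
proof (induction p)
  case 0
  then show ?case by simp
next
  case (Suc p)
  then have IH: "(\<lambda>z. calE (e z) p) holomorphic_on U" by simp
  show ?case
  proof (cases "p = 0")
    case True
    then show ?thesis using assms(1) by simp
  next
    case False
    then have "calE (e z) p \<noteq> 0" if "z \<in> U" for z using Suc.prems[OF that, of p] by simp
    then show ?thesis using False IH by (cases "even (Suc p)") (auto intro!: holomorphic_intros)
  qed
qed

text \<open>The factors have odd indices up to 2n-1. For \<open>n = 0\<close> natural subtraction
  makes the range empty, in accordance with the empty product 1.\<close>

lemma calF_holomorphic:
  assumes "e holomorphic_on U" "\<And>z q. z \<in> U \<Longrightarrow> q \<in> {1..2*n-1} \<Longrightarrow> calE (e z) q \<noteq> 0"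
  shows "(\<lambda>z. calF (e z) n) holomorphic_on U" "\<And>z. z \<in> U \<Longrightarrow> calF (e z) n \<noteq> 0"
proof -
  show "(\<lambda>z. calF (e z) n) holomorphic_on U"
    unfolding calF_def
    by (intro holomorphic_on_prod calE_holomorphic assms) auto
  show "calF (e z) n \<noteq> 0" if "z \<in> U" for z
  proof -
    have "calE (e z) (2*k-1) \<noteq> 0" if "k \<in> {1..n}" for k
      by (rule assms(2)[OF \<open>z \<in> U\<close>]) (use that in auto)
    then show ?thesis unfolding calF_def by (simp add: prod_zero_iff)
  qed
qed

theorem mainTheorem3:
  fixes U :: "complex set" and H B :: "complex \<Rightarrow> real" and c :: real
    and E1 :: "point \<Rightarrow> complex" and D :: "point set"
  assumes "open U" and "conjugate_harmonic_on U H B"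
    and E1: "\<And>x. E1 x = Complex (H (zcoord x)) (B (zcoord x))"
    and D: "D = {x. zcoord x \<in> U}"
  shows
    "(\<forall>n::nat.
       (\<forall>x\<in>D. (\<forall>p\<in>{1..2*n+1}. calE (E1 x) p \<noteq> 0) \<and> Re (calE (E1 x) (2*n+1)) > 0) \<longrightarrow>
       (let g = (\<lambda>x. brane_metric (calF (E1 x) n) (Re (calE (E1 x) (2*n+1))) ((-1)^(n+1)) ((-1)^n));
            A = (\<lambda>x. ((-1)^n / Re (calE (E1 x) (2*n+1))) *\<^sub>R form3 9 10 11)
        in (even n \<longrightarrow> solves_theory 1 10 1 c {9} D g A) \<and>
           (odd n \<longrightarrow> solves_theory 2 9 (-1) c {10, 11} D g A)))
     \<and>
     (\<forall>n::nat. n > 0 \<longrightarrow>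
       (\<forall>x\<in>D. (\<forall>p\<in>{1..2*n}. calE (E1 x) p \<noteq> 0) \<and> Re (calE (E1 x) (2*n)) > 0) \<longrightarrow>
       (let g = (\<lambda>x. brane_metric (calF (E1 x) n) (Re (calE (E1 x) (2*n))) ((-1)^n) ((-1)^(n+1)));
            A = (\<lambda>x. ((-1)^(n+1) / Re (calE (E1 x) (2*n))) *\<^sub>R form3 9 10 11)
        in (odd n \<longrightarrow> solves_theory 1 10 1 c {9} D g A) \<and>
           (even n \<longrightarrow> solves_theory 2 9 (-1) c {10, 11} D g A)))"
proof -
  define e where "e z = Complex (H z) (B z)" for z
  have e: "e holomorphic_on U"
    using conjugate_harmonic_holomorphic[OF assms(1,2)] by (simp add: e_def[abs_def])
  have E1e: "E1 x = e (zcoord x)" for x by (simp add: E1 e_def)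
  \<comment> \<open>The hypotheses speak of points of the eleven-dimensional space; surjectivity of
    \<open>zcoord\<close> transfers them to \<open>U\<close>.\<close>
  have ex: "\<exists>x\<in>D. zcoord x = z" if "z \<in> U" for z
  proof -
    let ?x = "(\<chi> i. if i = 1 then Re z else if i = 2 then Im z else 0) :: point"
    have "zcoord ?x = z" by (simp add: zcoord_def complex_eq_iff)
    then show ?thesis using that D by auto
  qed
  \<comment> \<open>Both levels at once: \<open>p\<close> is 2n+1 or 2n, and
    \<open>2 * n - 1 \<le> p\<close> ensures that the nonvanishing up to \<open>p\<close> covers all
    factors of \<open>calF\<close> as well.\<close>
  have main: "solves_theory 1 10 1 c {9} D
      (\<lambda>x. brane_metric (calF (E1 x) n) (Re (calE (E1 x) p)) (- 1) 1) (\<lambda>x. (1 / Re (calE (E1 x) p)) *\<^sub>R form3 9 10 11)" (is ?A)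
    "solves_theory 2 9 (- 1) c {10,11} D
      (\<lambda>x. brane_metric (calF (E1 x) n) (Re (calE (E1 x) p)) 1 (- 1)) (\<lambda>x. (- 1 / Re (calE (E1 x) p)) *\<^sub>R form3 9 10 11)" (is ?B)
    if h: "\<forall>x\<in>D. (\<forall>q\<in>{1..p}. calE (E1 x) q \<noteq> 0) \<and> Re (calE (E1 x) p) > 0" and np: "2 * n - 1 \<le> p" for n p
  proof -
    have nz: "calE (e z) q \<noteq> 0" if "z \<in> U" "q \<in> {1..p}" for z q using h ex[OF that(1)] that(2) E1e by metis
    have pos: "Re (calE (e z) p) > 0" if "z \<in> U" for z using h ex[OF that(1)] E1e by metis
    have hE: "(\<lambda>z. calE (e z) p) holomorphic_on U" by (rule calE_holomorphic[OF e]) (use nz in auto)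
    have nz': "calE (e z) q \<noteq> 0" if "z \<in> U" "q \<in> {1..2*n-1}" for z q using nz[OF that(1), of q] that(2) np by auto
    note F = calF_holomorphic[OF e nz']
    show ?A ?B
      unfolding D E1e by (rule solves_theory_brane[OF assms(1) hE F(1) pos F(2)]; assumption)+
  qed
  show ?thesis
    unfolding Let_def
  \<comment> \<open>The four cases are the two parities at each level; fixing the parity of
    \<open>n\<close> turns all powers of -1 into the constants of \<open>main\<close>.\<close>
  proof (intro conjI allI impI, goal_cases)
    case (1 n)
    then show ?case using main(1)[OF 1(1), of n] by simp
  next
    case (2 n)
    then show ?case using main(2)[OF 2(1), of n] by simp
  next
    case (3 n)
    then show ?case using main(1)[OF 3(2), of n] by simp
  next
    case (4 n)
    then show ?case using main(2)[OF 4(2), of n] by simp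
  qed
qed

end
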